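(* Let $N\ge2$, $0\le k\le N$, and let $\mathcal{K}$ be a partial categorical $\dot{\mathcal{U}}_{0,N}(L\mathfrak{sl}_2)$ action. For $\boldsymbol{\mu}=(\mu_1,\dots,\mu_{N-k})\in P(k,N-k)$ put $\mathsf{E}_{-\boldsymbol{\mu}}\mathbf{1}_{(N,0)}:=\mathsf{E}_{-\mu_1}\cdots\mathsf{E}_{-\mu_{N-k}}\mathbf{1}_{(N,0)}:\mathcal{K}(N,0)\to\mathcal{K}(k,N-k)$. Then each $\mathsf{E}_{-\boldsymbol{\mu}}\mathbf{1}_{(N,0)}$, $\boldsymbol{\mu}\in P(k,N-k)$, is fully faithful. Moreover, letting $\mathrm{Im}\,\mathsf{E}_{-\boldsymbol{\mu}}\mathbf{1}_{(N,0)}$ be the minimal full triangulated subcategory of $\mathcal{K}(k,N-k)$ generated by the objects in the essential image of $\mathsf{E}_{-\boldsymbol{\mu}}\mathbf{1}_{(N,0)}$, there is a semiorthogonal decomposition $$\mathcal{K}(k,N-k)=\langle\mathcal{B}(k,N-k),\ \mathrm{Im}\,\mathsf{E}_{-\boldsymbol{\mu}}\mathbf{1}_{(N,0)}\rangle_{\boldsymbol{\mu}\in P(k,N-k)},\qquad \mathcal{B}(k,N-k):=\langle\mathrm{Im}\,\mathsf{E}_{-\boldsymbol{\mu}}\mathbf{1}_{(N,0)}\rangle_{\boldsymbol{\mu}\in P(k,N-k)}^{\perp},$$ with the components $\mathrm{Im}\,\mathsf{E}_{-\boldsymbol{\mu}}\mathbf{1}_{(N,0)}$ arranged from left to right in decreasing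 lexicographic order of $\boldsymbol{\mu}$.
   Context: **Semiorthogonal decompositions.** For a triangulated category $\mathcal{D}$ and a full triangulated subcategory $\mathcal{A}$, $\mathcal{A}^\perp=\{X:\mathrm{Hom}_{\mathcal{D}}(A,X)=0\ \forall A\in\mathcal{A}\}$. $\langle\cdot\rangle$ denotes the minimal full triangulated subcategory containing the given objects/subcategories (closed under direct summands for a class of objects). A semiorthogonal decomposition $\mathcal{D}=\langle\mathcal{A}_1,\dots,\mathcal{A}_m\rangle$ is a sequence of full triangulated subcategories with $\mathrm{Hom}_{\mathcal{D}}(A_i,A_j)=0$ for all $A_i\in\mathcal{A}_i$, $A_j\in\mathcal{A}_j$, $j<i$, such that the smallest full triangulated subcategory containing all $\mathcal{A}_i$ is $\mathcal{D}$. $P(a,b)$ is the set of integer sequences $(\mu_1,\dots,\mu_b)$ with $a\ge\mu_1\ge\dots\ge\mu_b\ge0$. Lexicographic order: $\boldsymbol{\mu}<_l\boldsymbol{\mu}'$ iff at the first index $j$ where they differ, $\mu_j<\mu_j'$. **Partial categorical $\dot{\mathcal{U}}_{0,N}(L\mathfrak{sl}_2)$ action.** Weights: $C(2,N)=\{(k_1,k_2)\in\mathbb{Z}_{\ge0}^2:k_1+k_2=N\}$, $\alpha=(-1,1)$. The action consists of a 2-category $\mathcal{K}$ which is triangulated (Hom-categories are triangulated and composition is exact), $\mathbb{C}$-linear and idempotent complete, with objects triangulated categories $\mathcal{K}(k_1,k_2)$, $(k_1,k_2)\in C(2,N)$, and triangulated categories $\mathrm{Hom}(\mathcal{K}(\underline{k}),\mathcal{K}(\underline{l}))$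 of 1-morphisms, which are (exact) functors. There are 1-morphisms: identities $\mathbf{1}_{\underline{k}}$; $\mathsf{E}_r\mathbf{1}_{\underline{k}}=\mathbf{1}_{\underline{k}+\alpha}\mathsf{E}_r:\mathcal{K}(\underline{k})\to\mathcal{K}(\underline{k}+\alpha)$, $-k_1-1\le r\le0$; $\mathsf{F}_s\mathbf{1}_{\underline{k}}=\mathbf{1}_{\underline{k}-\alpha}\mathsf{F}_s:\mathcal{K}(\underline{k})\to\mathcal{K}(\underline{k}-\alpha)$, $0\le s\le k_2+1$; $(\mathsf{\Psi}^\pm)^{\pm1}\mathbf{1}_{\underline{k}}$ (endo-1-morphisms of $\mathcal{K}(\underline{k})$, mutually inverse); and $\mathsf{H}_{\pm1}\mathbf{1}_{\underline{k}}$, on which no condition is imposed. Weights outside $C(2,N)$ are treated as zero: any 1-morphism through such a weight is $0$. Conditions, for all $r,s$ for which they make sense (isomorphisms abstract): 1. The space of maps between any two 1-morphisms is finite-dimensional. 2. $\mathbf{1}_{\underline{k}+r\alpha}=0$ for $r\gg0$ or $r\ll0$. 3. (A condition involving two distinct simple roots; vacuous for $\mathfrak{sl}_2$.) 4. (a) $(\mathsf{E}_r\mathbf{1}_{\underline{k}})^R\cong\mathbf{1}_{\underline{k}}(\mathsf{\Psi}^+)^{r+1}\mathsf{F}_{k_2+2}(\mathsf{\Psi}^+)^{-r-2}[-r-1]$; (b) $(\mathsf{F}_s\mathbf{1}_{\underline{k}})^R\cong\mathbf{1}_{\underline{k}}(\mathsf{\Psi}^-)^{-s+1}\mathsf{E}_{-k_1-2}(\mathsf{\Psi}^-)^{s-2}[s-1]$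 (right adjoints). 5. (a) $\mathsf{\Psi}^\pm\mathsf{E}_r\mathbf{1}_{\underline{k}}\cong\mathsf{E}_{r+1}\mathsf{\Psi}^\pm\mathbf{1}_{\underline{k}}[\mp1]$; (b) $\mathsf{\Psi}^\pm\mathsf{F}_s\mathbf{1}_{\underline{k}}\cong\mathsf{F}_{s-1}\mathsf{\Psi}^\pm\mathbf{1}_{\underline{k}}[\pm1]$. 6. (a) if $r+s=k_2$ there is an exact triangle $\mathsf{F}_s\mathsf{E}_r\mathbf{1}_{\underline{k}}\to\mathsf{E}_r\mathsf{F}_s\mathbf{1}_{\underline{k}}\to\mathsf{\Psi}^+\mathbf{1}_{\underline{k}}$; (b) if $r+s=-k_1$ there is an exact triangle $\mathsf{E}_r\mathsf{F}_s\mathbf{1}_{\underline{k}}\to\mathsf{F}_s\mathsf{E}_r\mathbf{1}_{\underline{k}}\to\mathsf{\Psi}^-\mathbf{1}_{\underline{k}}$; (c) if $-k_1+1\le r+s\le k_2-1$ then $\mathsf{F}_s\mathsf{E}_r\mathbf{1}_{\underline{k}}\cong\mathsf{E}_r\mathsf{F}_s\mathbf{1}_{\underline{k}}$. *)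

theory Defs
  imports Complex_Main "HOL-Algebra.Module" "HOL-Library.List_Lexorder"
begin

section \<open>Categories and additive categories\<close>

record ('o, 'a) cat =
  Ob :: "'o set"
  Arr :: "'a set"
  Src :: "'a \<Rightarrow> 'o"
  Tgt :: "'a \<Rightarrow> 'o"
  Idn :: "'o \<Rightarrow> 'a"
  Cmp :: "'a \<Rightarrow> 'a \<Rightarrow> 'a"  (infixr "\<cdot>\<index>" 75)

definition Hom :: "('o, 'a, 'm) cat_scheme \<Rightarrow> 'o \<Rightarrow> 'o \<Rightarrow> 'a set" where
  "Hom C X Y = {f \<in> Arr C. Src C f = X \<and> Tgt C f = Y}"

locale category =
  fixes C :: "('o, 'a, 'm) cat_scheme" (structure)
  assumes Src_Ob: "f \<in> Arr C \<Longrightarrow> Src C f \<in> Ob C"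
    and Tgt_Ob: "f \<in> Arr C \<Longrightarrow> Tgt C f \<in> Ob C"
    and Idn_Hom: "X \<in> Ob C \<Longrightarrow> Idn C X \<in> Hom C X X"
    and Cmp_Hom: "\<lbrakk>f \<in> Hom C X Y; g \<in> Hom C Y Z\<rbrakk> \<Longrightarrow> g \<cdot> f \<in> Hom C X Z"
    and Cmp_Idn: "f \<in> Hom C X Y \<Longrightarrow> f \<cdot> Idn C X = f"
    and Idn_Cmp: "f \<in> Hom C X Y \<Longrightarrow> Idn C Y \<cdot> f = f"
    and Cmp_assoc: "\<lbrakk>f \<in> Hom C W X; g \<in> Hom C X Y; h \<in> Hom C Y Z\<rbrakk>
                      \<Longrightarrow> (h \<cdot> g) \<cdot> f = h \<cdot> (g \<cdot> f)"

definition iso_arr :: "('o, 'a, 'm) cat_scheme \<Rightarrow> 'a \<Rightarrow> bool" where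
  "iso_arr C f \<longleftrightarrow> f \<in> Arr C \<and>
     (\<exists>g \<in> Hom C (Tgt C f) (Src C f).
        g \<cdot>\<^bsub>C\<^esub> f = Idn C (Src C f) \<and> f \<cdot>\<^bsub>C\<^esub> g = Idn C (Tgt C f))"

definition isomorphic :: "('o, 'a, 'm) cat_scheme \<Rightarrow> 'o \<Rightarrow> 'o \<Rightarrow> bool" where
  "isomorphic C X Y \<longleftrightarrow> (\<exists>f \<in> Hom C X Y. iso_arr C f)"

definition zero_object :: "('o, 'a, 'm) cat_scheme \<Rightarrow> 'o \<Rightarrow> bool" where
  "zero_object C Z \<longleftrightarrow> Z \<in> Ob C \<and>
     (\<forall>X \<in> Ob C. (\<exists>!f. f \<in> Hom C X Z) \<and> (\<exists>!f. f \<in> Hom C Z X))"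

definition idempotent_complete :: "('o, 'a, 'm) cat_scheme \<Rightarrow> bool" where
  "idempotent_complete C \<longleftrightarrow>
     (\<forall>X \<in> Ob C. \<forall>e \<in> Hom C X X. e \<cdot>\<^bsub>C\<^esub> e = e \<longrightarrow>
        (\<exists>Y \<in> Ob C. \<exists>p \<in> Hom C X Y. \<exists>i \<in> Hom C Y X.
           i \<cdot>\<^bsub>C\<^esub> p = e \<and> p \<cdot>\<^bsub>C\<^esub> i = Idn C Y))"

record ('o, 'a) preadd_cat = "('o, 'a) cat" +
  Add :: "'a \<Rightarrow> 'a \<Rightarrow> 'a"
  Zer :: "'o \<Rightarrow> 'o \<Rightarrow> 'a"

definition hom_group :: "('o, 'a, 'm) preadd_cat_scheme \<Rightarrow> 'o \<Rightarrow> 'o \<Rightarrow> 'a monoid" where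
  "hom_group C X Y = \<lparr>carrier = Hom C X Y, mult = Add C, one = Zer C X Y\<rparr>"

definition Neg :: "('o, 'a, 'm) preadd_cat_scheme \<Rightarrow> 'a \<Rightarrow> 'a" where
  "Neg C f = inv\<^bsub>hom_group C (Src C f) (Tgt C f)\<^esub> f"

locale preadditive_category = category C for C :: "('o, 'a, 'm) preadd_cat_scheme" (structure) +
  assumes hom_comm_group: "\<lbrakk>X \<in> Ob C; Y \<in> Ob C\<rbrakk> \<Longrightarrow> comm_group (hom_group C X Y)"
    and Cmp_Add: "\<lbrakk>f \<in> Hom C X Y; g \<in> Hom C Y Z; h \<in> Hom C Y Z\<rbrakk>
                    \<Longrightarrow> Add C g h \<cdot> f = Add C (g \<cdot> f) (h \<cdot> f)"
    and Add_Cmp: "\<lbrakk>f \<in> Hom C X Y; g \<in> Hom C X Y; h \<in> Hom C Y Z\<rbrakk>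
                    \<Longrightarrow> h \<cdot> Add C f g = Add C (h \<cdot> f) (h \<cdot> g)"

definition biproduct :: "('o, 'a, 'm) preadd_cat_scheme \<Rightarrow> 'o \<Rightarrow> 'o \<Rightarrow> 'o \<Rightarrow> bool" where
  "biproduct C X Y Z \<longleftrightarrow> Z \<in> Ob C \<and>
     (\<exists>i \<in> Hom C X Z. \<exists>j \<in> Hom C Y Z. \<exists>p \<in> Hom C Z X. \<exists>q \<in> Hom C Z Y.
        p \<cdot>\<^bsub>C\<^esub> i = Idn C X \<and> q \<cdot>\<^bsub>C\<^esub> j = Idn C Y \<and>
        q \<cdot>\<^bsub>C\<^esub> i = Zer C X Y \<and> p \<cdot>\<^bsub>C\<^esub> j = Zer C Y X \<and>
        Add C (i \<cdot>\<^bsub>C\<^esub> p) (j \<cdot>\<^bsub>C\<^esub> q) = Idn C Z)"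

locale additive_category = preadditive_category +
  assumes ex_zero_object: "\<exists>Z. zero_object C Z"
    and ex_biproduct: "\<lbrakk>X \<in> Ob C; Y \<in> Ob C\<rbrakk> \<Longrightarrow> \<exists>Z. biproduct C X Y Z"


section \<open>Triangulated categories and exact functors\<close>

text \<open>The shift is an automorphism, with \<open>ShO\<close> and \<open>ShA\<close> its action on objects and arrows.
  An element \<open>(f, g, h)\<close> of \<open>Dist\<close> is a distinguished triangle
  \<open>X \<rightarrow> Y \<rightarrow> Z \<rightarrow> X[1]\<close>.\<close>

record ('o, 'a) tri_cat = "('o, 'a) preadd_cat" +
  ShO :: "'o \<Rightarrow> 'o"
  ShA :: "'a \<Rightarrow> 'a"
  Dist :: "('a \<times> 'a \<times> 'a) set"

locale triangulated_category = additive_category T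
  for T :: "('o, 'a, 'm) tri_cat_scheme" (structure) +
  assumes ShO_bij: "bij_betw (ShO T) (Ob T) (Ob T)"
    and ShA_bij: "\<lbrakk>X \<in> Ob T; Y \<in> Ob T\<rbrakk> \<Longrightarrow>
                    bij_betw (ShA T) (Hom T X Y) (Hom T (ShO T X) (ShO T Y))"
    and ShA_Idn: "X \<in> Ob T \<Longrightarrow> ShA T (Idn T X) = Idn T (ShO T X)"
    and ShA_Cmp: "\<lbrakk>f \<in> Hom T X Y; g \<in> Hom T Y Z\<rbrakk> \<Longrightarrow> ShA T (g \<cdot> f) = ShA T g \<cdot> ShA T f"
    and ShA_Add: "\<lbrakk>f \<in> Hom T X Y; g \<in> Hom T X Y\<rbrakk> \<Longrightarrow> ShA T (Add T f g) = Add T (ShA T f) (ShA T g)"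
    and Dist_typed: "(f, g, h) \<in> Dist T \<Longrightarrow>
          \<exists>X Y Z. f \<in> Hom T X Y \<and> g \<in> Hom T Y Z \<and> h \<in> Hom T Z (ShO T X)"
    and TR1_iso: "\<lbrakk>(f, g, h) \<in> Dist T;
                   f \<in> Hom T X Y; g \<in> Hom T Y Z; h \<in> Hom T Z (ShO T X);
                   f' \<in> Hom T X' Y'; g' \<in> Hom T Y' Z'; h' \<in> Hom T Z' (ShO T X');
                   u \<in> Hom T X X'; v \<in> Hom T Y Y'; w \<in> Hom T Z Z';
                   iso_arr T u; iso_arr T v; iso_arr T w;
                   v \<cdot> f = f' \<cdot> u; w \<cdot> g = g' \<cdot> v; ShA T u \<cdot> h = h' \<cdot> w\<rbrakk>
                  \<Longrightarrow> (f', g', h') \<in> Dist T"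
    and TR1_Idn: "\<lbrakk>X \<in> Ob T; zero_object T Z\<rbrakk> \<Longrightarrow>
                    (Idn T X, Zer T X Z, Zer T Z (ShO T X)) \<in> Dist T"
    and TR1_cone: "f \<in> Arr T \<Longrightarrow> \<exists>g h. (f, g, h) \<in> Dist T"
    and TR2: "\<lbrakk>f \<in> Hom T X Y; g \<in> Hom T Y Z; h \<in> Hom T Z (ShO T X)\<rbrakk> \<Longrightarrow>
                (f, g, h) \<in> Dist T \<longleftrightarrow> (g, h, Neg T (ShA T f)) \<in> Dist T"
    and TR3: "\<lbrakk>(f, g, h) \<in> Dist T; (f', g', h') \<in> Dist T;
               u \<in> Hom T (Src T f) (Src T f'); v \<in> Hom T (Tgt T f) (Tgt T f'); v \<cdot> f = f' \<cdot> u\<rbrakk> \<Longrightarrow>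
                \<exists>w \<in> Hom T (Tgt T g) (Tgt T g'). w \<cdot> g = g' \<cdot> v \<and> ShA T u \<cdot> h = h' \<cdot> w"
    and TR4: "\<lbrakk>f \<in> Hom T X Y; g \<in> Hom T Y Z;
               (f, j, d) \<in> Dist T; (g, l, e) \<in> Dist T; (g \<cdot> f, m, c) \<in> Dist T\<rbrakk> \<Longrightarrow>
                \<exists>u \<in> Hom T (Tgt T j) (Tgt T m). \<exists>v \<in> Hom T (Tgt T m) (Tgt T l).
                   (u, v, ShA T j \<cdot> e) \<in> Dist T \<and>
                   u \<cdot> j = m \<cdot> g \<and> c \<cdot> u = d \<and> v \<cdot> m = l \<and> e \<cdot> v = ShA T f \<cdot> c"

definition shift :: "('o, 'a, 'm) tri_cat_scheme \<Rightarrow> int \<Rightarrow> 'o \<Rightarrow> 'o" where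
  "shift T n X = (if 0 \<le> n then (ShO T ^^ nat n) X
                  else (inv_into (Ob T) (ShO T) ^^ nat (- n)) X)"

definition exact_triangle :: "('o, 'a, 'm) tri_cat_scheme \<Rightarrow> 'o \<Rightarrow> 'o \<Rightarrow> 'o \<Rightarrow> bool" where
  "exact_triangle T X Y Z \<longleftrightarrow>
     (\<exists>f \<in> Hom T X Y. \<exists>g \<in> Hom T Y Z. \<exists>h \<in> Hom T Z (ShO T X). (f, g, h) \<in> Dist T)"

definition is_functor ::
  "('o, 'a, 'm) cat_scheme \<Rightarrow> ('p, 'b, 'n) cat_scheme \<Rightarrow> ('o \<Rightarrow> 'p) \<Rightarrow> ('a \<Rightarrow> 'b) \<Rightarrow> bool" where
  "is_functor C D Fo Fa \<longleftrightarrow>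
     (\<forall>X \<in> Ob C. Fo X \<in> Ob D \<and> Fa (Idn C X) = Idn D (Fo X)) \<and>
     (\<forall>X \<in> Ob C. \<forall>Y \<in> Ob C. \<forall>f \<in> Hom C X Y. Fa f \<in> Hom D (Fo X) (Fo Y)) \<and>
     (\<forall>X \<in> Ob C. \<forall>Y \<in> Ob C. \<forall>Z \<in> Ob C. \<forall>f \<in> Hom C X Y. \<forall>g \<in> Hom C Y Z.
        Fa (g \<cdot>\<^bsub>C\<^esub> f) = Fa g \<cdot>\<^bsub>D\<^esub> Fa f)"

definition exact_functor ::
  "('o, 'a, 'm) tri_cat_scheme \<Rightarrow> ('p, 'b, 'n) tri_cat_scheme \<Rightarrow> ('o \<Rightarrow> 'p) \<Rightarrow> ('a \<Rightarrow> 'b) \<Rightarrow> bool"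
where
  "exact_functor S T Fo Fa \<longleftrightarrow> is_functor S T Fo Fa \<and>
     (\<forall>X \<in> Ob S. \<forall>Y \<in> Ob S. \<forall>f \<in> Hom S X Y. \<forall>g \<in> Hom S X Y.
        Fa (Add S f g) = Add T (Fa f) (Fa g)) \<and>
     (\<exists>\<xi>. (\<forall>X \<in> Ob S. \<xi> X \<in> Hom T (Fo (ShO S X)) (ShO T (Fo X)) \<and> iso_arr T (\<xi> X)) \<and>
          (\<forall>X \<in> Ob S. \<forall>Y \<in> Ob S. \<forall>f \<in> Hom S X Y.
             ShA T (Fa f) \<cdot>\<^bsub>T\<^esub> \<xi> X = \<xi> Y \<cdot>\<^bsub>T\<^esub> Fa (ShA S f)) \<and>
          (\<forall>f g h. (f, g, h) \<in> Dist S \<longrightarrow>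
             (Fa f, Fa g, \<xi> (Src S f) \<cdot>\<^bsub>T\<^esub> Fa h) \<in> Dist T))"

definition fully_faithful ::
  "('o, 'a, 'm) cat_scheme \<Rightarrow> ('p, 'b, 'n) cat_scheme \<Rightarrow> ('o \<Rightarrow> 'p) \<Rightarrow> ('a \<Rightarrow> 'b) \<Rightarrow> bool" where
  "fully_faithful C D Fo Fa \<longleftrightarrow> is_functor C D Fo Fa \<and>
     (\<forall>X \<in> Ob C. \<forall>Y \<in> Ob C. bij_betw Fa (Hom C X Y) (Hom D (Fo X) (Fo Y)))"

definition essential_image ::
  "('o, 'a, 'm) cat_scheme \<Rightarrow> ('p, 'b, 'n) cat_scheme \<Rightarrow> ('o \<Rightarrow> 'p) \<Rightarrow> 'p set" where
  "essential_image C D Fo = {Y \<in> Ob D. \<exists>X \<in> Ob C. isomorphic D (Fo X) Y}"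


section \<open>Triangulated subcategories and semiorthogonal decompositions\<close>

text \<open>A full subcategory is given by its class of objects. Triangulated subcategories are taken
  to be strictly full, so that the smallest one containing a given class is an intersection.\<close>

definition full_triangulated_subcategory :: "('o, 'a, 'm) tri_cat_scheme \<Rightarrow> 'o set \<Rightarrow> bool" where
  "full_triangulated_subcategory T A \<longleftrightarrow> A \<subseteq> Ob T \<and>
     (\<exists>Z \<in> A. zero_object T Z) \<and>
     (\<forall>X \<in> A. \<forall>Y \<in> Ob T. isomorphic T X Y \<longrightarrow> Y \<in> A) \<and>
     (\<forall>X \<in> A. \<forall>n. shift T n X \<in> A) \<and>
     (\<forall>X \<in> A. \<forall>Y \<in> A. \<forall>Z \<in> Ob T. exact_triangle T X Y Z \<longrightarrow> Z \<in> A)"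

definition direct_summand_closed :: "('o, 'a, 'm) preadd_cat_scheme \<Rightarrow> 'o set \<Rightarrow> bool" where
  "direct_summand_closed C A \<longleftrightarrow>
     (\<forall>X \<in> Ob C. \<forall>Y \<in> Ob C. \<forall>Z \<in> A. biproduct C X Y Z \<longrightarrow> X \<in> A)"

definition tri_span :: "('o, 'a, 'm) tri_cat_scheme \<Rightarrow> 'o set \<Rightarrow> 'o set" where
  "tri_span T S = \<Inter> {A. full_triangulated_subcategory T A \<and> S \<subseteq> A}"

text \<open>\<open>tri_span\<close> is \<open>\<langle>\<cdot>\<rangle>\<close> for a family of subcategories;
  \<open>thick_span\<close> is \<open>\<langle>\<cdot>\<rangle>\<close> for a class of objects,
  where closure under direct summands is part of the convention.\<close>

definition thick_span :: "('o, 'a, 'm) tri_cat_scheme \<Rightarrow> 'o set \<Rightarrow> 'o set" where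
  "thick_span T S =
     \<Inter> {A. full_triangulated_subcategory T A \<and> direct_summand_closed T A \<and> S \<subseteq> A}"

definition right_orthogonal :: "('o, 'a, 'm) preadd_cat_scheme \<Rightarrow> 'o set \<Rightarrow> 'o set" where
  "right_orthogonal C A = {X \<in> Ob C. \<forall>Y \<in> A. Hom C Y X = {Zer C Y X}}"

definition semiorthogonal_decomposition ::
  "('o, 'a, 'm) tri_cat_scheme \<Rightarrow> 'o set list \<Rightarrow> bool" where
  "semiorthogonal_decomposition T As \<longleftrightarrow>
     (\<forall>A \<in> set As. full_triangulated_subcategory T A) \<and>
     (\<forall>i < length As. \<forall>j < i. \<forall>X \<in> As ! i. \<forall>Y \<in> As ! j. Hom T X Y = {Zer T X Y}) \<and>
     tri_span T (\<Union> (set As)) = Ob T"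


section \<open>Linear triangulated 2-categories\<close>

record ('o, 'a) lin_tri_cat = "('o, 'a) tri_cat" +
  Scl :: "complex \<Rightarrow> 'a \<Rightarrow> 'a"

definition complex_ring :: "complex ring" where
  "complex_ring = \<lparr>carrier = UNIV, mult = (*), one = 1, zero = 0, add = (+)\<rparr>"

text \<open>The fields \<open>mult\<close> and \<open>one\<close> of a module record play no role.\<close>

definition hom_module ::
  "('o, 'a, 'm) lin_tri_cat_scheme \<Rightarrow> 'o \<Rightarrow> 'o \<Rightarrow> (complex, 'a) module" where
  "hom_module C X Y = \<lparr>carrier = Hom C X Y, mult = Cmp C, one = Idn C X,
     zero = Zer C X Y, add = Add C, smult = Scl C\<rparr>"

locale linear_triangulated_category = triangulated_category T
  for T :: "('o, 'a, 'm) lin_tri_cat_scheme" (structure) +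
  assumes hom_module: "\<lbrakk>X \<in> Ob T; Y \<in> Ob T\<rbrakk> \<Longrightarrow> module complex_ring (hom_module T X Y)"
    and Scl_Cmp: "\<lbrakk>f \<in> Hom T X Y; g \<in> Hom T Y Z\<rbrakk> \<Longrightarrow> Scl T c g \<cdot> f = Scl T c (g \<cdot> f)"
    and Cmp_Scl: "\<lbrakk>f \<in> Hom T X Y; g \<in> Hom T Y Z\<rbrakk> \<Longrightarrow> g \<cdot> Scl T c f = Scl T c (g \<cdot> f)"
    and ShA_Scl: "f \<in> Hom T X Y \<Longrightarrow> ShA T (Scl T c f) = Scl T c (ShA T f)"

definition finite_dim_hom :: "('o, 'a, 'm) lin_tri_cat_scheme \<Rightarrow> 'o \<Rightarrow> 'o \<Rightarrow> bool" where
  "finite_dim_hom T X Y \<longleftrightarrow>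
     (\<exists>B. finite B \<and> B \<subseteq> Hom T X Y \<and>
        (\<forall>f \<in> Hom T X Y. \<exists>c. f = (\<Oplus>\<^bsub>hom_module T X Y\<^esub>b\<in>B. c b \<odot>\<^bsub>hom_module T X Y\<^esub> b)))"

text \<open>\<open>Mor K k l\<close> is the category of 1-morphisms from \<open>k\<close> to \<open>l\<close> and 2-morphisms between them;
  its composition \<open>\<cdot>\<close> is vertical composition. Horizontal composition is \<open>\<star>\<close> on 1-morphisms and
  \<open>\<diamondop>\<close> on 2-morphisms, written in the order of composition of functions.\<close>

record ('w, 'f, 't) two_cat =
  Obj :: "'w set"
  Mor :: "'w \<Rightarrow> 'w \<Rightarrow> ('f, 't) lin_tri_cat"
  One :: "'w \<Rightarrow> 'f"
  HC1 :: "'f \<Rightarrow> 'f \<Rightarrow> 'f"  (infixr "\<star>\<index>" 75)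
  HC2 :: "'t \<Rightarrow> 't \<Rightarrow> 't"  (infixr "\<diamondop>\<index>" 75)

locale linear_triangulated_2_category =
  fixes K :: "('w, 'f, 't, 'm) two_cat_scheme" (structure)
  assumes Mor_triangulated:
      "\<lbrakk>k \<in> Obj K; l \<in> Obj K\<rbrakk> \<Longrightarrow> linear_triangulated_category (Mor K k l)"
    and One_Mor: "k \<in> Obj K \<Longrightarrow> One K k \<in> Ob (Mor K k k)"
    and HC1_Mor: "\<lbrakk>k \<in> Obj K; l \<in> Obj K; m \<in> Obj K; f \<in> Ob (Mor K l m); g \<in> Ob (Mor K k l)\<rbrakk>
        \<Longrightarrow> f \<star> g \<in> Ob (Mor K k m)"
    and HC1_One: "\<lbrakk>k \<in> Obj K; l \<in> Obj K; f \<in> Ob (Mor K k l)\<rbrakk> \<Longrightarrow> f \<star> One K k = f"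
    and One_HC1: "\<lbrakk>k \<in> Obj K; l \<in> Obj K; f \<in> Ob (Mor K k l)\<rbrakk> \<Longrightarrow> One K l \<star> f = f"
    and HC1_assoc: "\<lbrakk>j \<in> Obj K; k \<in> Obj K; l \<in> Obj K; m \<in> Obj K;
          f \<in> Ob (Mor K l m); g \<in> Ob (Mor K k l); h \<in> Ob (Mor K j k)\<rbrakk>
        \<Longrightarrow> (f \<star> g) \<star> h = f \<star> (g \<star> h)"
    and HC2_Hom: "\<lbrakk>k \<in> Obj K; l \<in> Obj K; m \<in> Obj K;
          s \<in> Hom (Mor K l m) f f'; t \<in> Hom (Mor K k l) g g'\<rbrakk>
        \<Longrightarrow> s \<diamondop> t \<in> Hom (Mor K k m) (f \<star> g) (f' \<star> g')"
    and HC2_Idn: "\<lbrakk>k \<in> Obj K; l \<in> Obj K; m \<in> Obj K; f \<in> Ob (Mor K l m); g \<in> Ob (Mor K k l)\<rbrakk>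
        \<Longrightarrow> Idn (Mor K l m) f \<diamondop> Idn (Mor K k l) g = Idn (Mor K k m) (f \<star> g)"
    and interchange: "\<lbrakk>k \<in> Obj K; l \<in> Obj K; m \<in> Obj K;
          s \<in> Hom (Mor K l m) f f'; s' \<in> Hom (Mor K l m) f' f'';
          t \<in> Hom (Mor K k l) g g'; t' \<in> Hom (Mor K k l) g' g''\<rbrakk>
        \<Longrightarrow> (s' \<cdot>\<^bsub>Mor K l m\<^esub> s) \<diamondop> (t' \<cdot>\<^bsub>Mor K k l\<^esub> t) = (s' \<diamondop> t') \<cdot>\<^bsub>Mor K k m\<^esub> (s \<diamondop> t)"
    and HC2_One: "\<lbrakk>k \<in> Obj K; l \<in> Obj K; t \<in> Hom (Mor K k l) f g\<rbrakk>
        \<Longrightarrow> t \<diamondop> Idn (Mor K k k) (One K k) = t"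
    and One_HC2: "\<lbrakk>k \<in> Obj K; l \<in> Obj K; t \<in> Hom (Mor K k l) f g\<rbrakk>
        \<Longrightarrow> Idn (Mor K l l) (One K l) \<diamondop> t = t"
    and HC2_assoc: "\<lbrakk>j \<in> Obj K; k \<in> Obj K; l \<in> Obj K; m \<in> Obj K;
          r \<in> Hom (Mor K l m) f f'; s \<in> Hom (Mor K k l) g g'; t \<in> Hom (Mor K j k) h h'\<rbrakk>
        \<Longrightarrow> (r \<diamondop> s) \<diamondop> t = r \<diamondop> (s \<diamondop> t)"
    and postcompose_exact: "\<lbrakk>k \<in> Obj K; l \<in> Obj K; m \<in> Obj K; f \<in> Ob (Mor K l m)\<rbrakk>
        \<Longrightarrow> exact_functor (Mor K k l) (Mor K k m) (\<lambda>g. f \<star> g) (\<lambda>t. Idn (Mor K l m) f \<diamondop> t)"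
    and precompose_exact: "\<lbrakk>k \<in> Obj K; l \<in> Obj K; m \<in> Obj K; g \<in> Ob (Mor K k l)\<rbrakk>
        \<Longrightarrow> exact_functor (Mor K l m) (Mor K k m) (\<lambda>f. f \<star> g) (\<lambda>s. s \<diamondop> Idn (Mor K k l) g)"
    and Scl_HC2: "\<lbrakk>k \<in> Obj K; l \<in> Obj K; m \<in> Obj K;
          s \<in> Hom (Mor K l m) f f'; t \<in> Hom (Mor K k l) g g'\<rbrakk>
        \<Longrightarrow> Scl (Mor K l m) c s \<diamondop> t = Scl (Mor K k m) c (s \<diamondop> t)"
    and HC2_Scl: "\<lbrakk>k \<in> Obj K; l \<in> Obj K; m \<in> Obj K;
          s \<in> Hom (Mor K l m) f f'; t \<in> Hom (Mor K k l) g g'\<rbrakk>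
        \<Longrightarrow> s \<diamondop> Scl (Mor K k l) c t = Scl (Mor K k m) c (s \<diamondop> t)"

definition is_right_adjoint ::
  "('w, 'f, 't, 'm) two_cat_scheme \<Rightarrow> 'w \<Rightarrow> 'w \<Rightarrow> 'f \<Rightarrow> 'f \<Rightarrow> bool" where
  "is_right_adjoint K k l f g \<longleftrightarrow> f \<in> Ob (Mor K k l) \<and> g \<in> Ob (Mor K l k) \<and>
     (\<exists>\<eta> \<in> Hom (Mor K k k) (One K k) (g \<star>\<^bsub>K\<^esub> f).
      \<exists>\<epsilon> \<in> Hom (Mor K l l) (f \<star>\<^bsub>K\<^esub> g) (One K l).
        (\<epsilon> \<diamondop>\<^bsub>K\<^esub> Idn (Mor K k l) f) \<cdot>\<^bsub>Mor K k l\<^esub> (Idn (Mor K k l) f \<diamondop>\<^bsub>K\<^esub> \<eta>)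
          = Idn (Mor K k l) f \<and>
        (Idn (Mor K l k) g \<diamondop>\<^bsub>K\<^esub> \<epsilon>) \<cdot>\<^bsub>Mor K l k\<^esub> (\<eta> \<diamondop>\<^bsub>K\<^esub> Idn (Mor K l k) g)
          = Idn (Mor K l k) g)"

text \<open>\<open>f\<^sup>R \<cong> g\<close> for a 1-morphism \<open>f\<close> from \<open>k\<close> to \<open>l\<close>.\<close>

definition right_adjoint_iso ::
  "('w, 'f, 't, 'm) two_cat_scheme \<Rightarrow> 'w \<Rightarrow> 'w \<Rightarrow> 'f \<Rightarrow> 'f \<Rightarrow> bool" where
  "right_adjoint_iso K k l f g \<longleftrightarrow>
     (\<exists>f\<^sub>R. is_right_adjoint K k l f f\<^sub>R \<and> isomorphic (Mor K l k) f\<^sub>R g)"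

text \<open>The next structure makes the objects of the 2-category triangulated categories and the
  1-morphisms exact functors between them: \<open>ActO f\<close> and \<open>ActA f\<close> are the action of the
  1-morphism \<open>f\<close> on objects and arrows, and a 2-morphism \<open>t\<close> induces the natural transformation
  \<open>Nat t\<close>. A 1-morphism need not be determined by its underlying functor, nor a 2-morphism by
  its natural transformation (as for Fourier-Mukai kernels). Nothing relates shifts and triangles
  in \<open>Mor K k l\<close> to those in \<open>Cat K l\<close>.\<close>

record ('w, 'f, 't, 'o, 'a) concrete_two_cat = "('w, 'f, 't) two_cat" +
  Cat :: "'w \<Rightarrow> ('o, 'a) tri_cat"
  ActO :: "'f \<Rightarrow> 'o \<Rightarrow> 'o"
  ActA :: "'f \<Rightarrow> 'a \<Rightarrow> 'a"
  Nat :: "'t \<Rightarrow> 'o \<Rightarrow> 'a"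

locale concrete_triangulated_2_category = linear_triangulated_2_category K
  for K :: "('w, 'f, 't, 'o, 'a, 'm) concrete_two_cat_scheme" (structure) +
  assumes Cat_triangulated: "k \<in> Obj K \<Longrightarrow> triangulated_category (Cat K k)"
    and Act_exact: "\<lbrakk>k \<in> Obj K; l \<in> Obj K; f \<in> Ob (Mor K k l)\<rbrakk>
        \<Longrightarrow> exact_functor (Cat K k) (Cat K l) (ActO K f) (ActA K f)"
    and ActO_One: "\<lbrakk>k \<in> Obj K; X \<in> Ob (Cat K k)\<rbrakk> \<Longrightarrow> ActO K (One K k) X = X"
    and ActA_One: "\<lbrakk>k \<in> Obj K; a \<in> Arr (Cat K k)\<rbrakk> \<Longrightarrow> ActA K (One K k) a = a"
    and ActO_HC1: "\<lbrakk>k \<in> Obj K; l \<in> Obj K; m \<in> Obj K;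
          f \<in> Ob (Mor K l m); g \<in> Ob (Mor K k l); X \<in> Ob (Cat K k)\<rbrakk>
        \<Longrightarrow> ActO K (f \<star> g) X = ActO K f (ActO K g X)"
    and ActA_HC1: "\<lbrakk>k \<in> Obj K; l \<in> Obj K; m \<in> Obj K;
          f \<in> Ob (Mor K l m); g \<in> Ob (Mor K k l); a \<in> Arr (Cat K k)\<rbrakk>
        \<Longrightarrow> ActA K (f \<star> g) a = ActA K f (ActA K g a)"
    and Nat_Hom: "\<lbrakk>k \<in> Obj K; l \<in> Obj K; t \<in> Hom (Mor K k l) f g; X \<in> Ob (Cat K k)\<rbrakk>
        \<Longrightarrow> Nat K t X \<in> Hom (Cat K l) (ActO K f X) (ActO K g X)"
    and Nat_natural: "\<lbrakk>k \<in> Obj K; l \<in> Obj K; t \<in> Hom (Mor K k l) f g; a \<in> Hom (Cat K k) X Y\<rbrakk>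
        \<Longrightarrow> Nat K t Y \<cdot>\<^bsub>Cat K l\<^esub> ActA K f a = ActA K g a \<cdot>\<^bsub>Cat K l\<^esub> Nat K t X"
    and Nat_Idn: "\<lbrakk>k \<in> Obj K; l \<in> Obj K; f \<in> Ob (Mor K k l); X \<in> Ob (Cat K k)\<rbrakk>
        \<Longrightarrow> Nat K (Idn (Mor K k l) f) X = Idn (Cat K l) (ActO K f X)"
    and Nat_Cmp: "\<lbrakk>k \<in> Obj K; l \<in> Obj K; s \<in> Hom (Mor K k l) f g; t \<in> Hom (Mor K k l) g h;
          X \<in> Ob (Cat K k)\<rbrakk>
        \<Longrightarrow> Nat K (t \<cdot>\<^bsub>Mor K k l\<^esub> s) X = Nat K t X \<cdot>\<^bsub>Cat K l\<^esub> Nat K s X"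
    and Nat_Add: "\<lbrakk>k \<in> Obj K; l \<in> Obj K; s \<in> Hom (Mor K k l) f g; t \<in> Hom (Mor K k l) f g;
          X \<in> Ob (Cat K k)\<rbrakk>
        \<Longrightarrow> Nat K (Add (Mor K k l) s t) X = Add (Cat K l) (Nat K s X) (Nat K t X)"
    and Nat_HC2: "\<lbrakk>k \<in> Obj K; l \<in> Obj K; m \<in> Obj K;
          s \<in> Hom (Mor K l m) f f'; t \<in> Hom (Mor K k l) g g'; X \<in> Ob (Cat K k)\<rbrakk>
        \<Longrightarrow> Nat K (s \<diamondop> t) X = Nat K s (ActO K g' X) \<cdot>\<^bsub>Cat K m\<^esub> ActA K f (Nat K t X)"


section \<open>Partial categorical actions of the shifted 0-affine algebra of \<open>sl\<^sub>2\<close>\<close>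

type_synonym weight = "int \<times> int"

definition weights :: "nat \<Rightarrow> weight set" where
  "weights N = {(k1, k2). 0 \<le> k1 \<and> 0 \<le> k2 \<and> k1 + k2 = int N}"

text \<open>All pairs of integers with sum \<open>N\<close> index objects of the 2-category; the ones outside
  \<open>weights N\<close> are required to be zero.\<close>

definition all_weights :: "nat \<Rightarrow> weight set" where
  "all_weights N = {(k1, k2). k1 + k2 = int N}"

text \<open>\<open>wt_add k n\<close> is \<open>k + n\<alpha>\<close> with \<open>\<alpha> = (-1, 1)\<close>.\<close>

definition wt_add :: "weight \<Rightarrow> int \<Rightarrow> weight" where
  "wt_add k n = (fst k - n, snd k + n)"

text \<open>\<open>EE A r k\<close>, \<open>FF A s k\<close>, \<open>PsiP A k\<close>, \<dots> stand for the 1-morphisms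
  \<open>E\<^sub>r 1\<^sub>k\<close>, \<open>F\<^sub>s 1\<^sub>k\<close>, \<open>\<Psi>\<^sup>+ 1\<^sub>k\<close>, \<dots> with source \<open>k\<close>. Values of \<open>EE\<close> and \<open>FF\<close> for
  indices outside the ranges in \<open>E_range\<close> and \<open>F_range\<close> are irrelevant.\<close>

record ('f, 't, 'o, 'a) action_data = "(weight, 'f, 't, 'o, 'a) concrete_two_cat" +
  EE :: "int \<Rightarrow> weight \<Rightarrow> 'f"
  FF :: "int \<Rightarrow> weight \<Rightarrow> 'f"
  PsiP :: "weight \<Rightarrow> 'f"
  PsiP_inv :: "weight \<Rightarrow> 'f"
  PsiM :: "weight \<Rightarrow> 'f"
  PsiM_inv :: "weight \<Rightarrow> 'f"
  HP :: "weight \<Rightarrow> 'f"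
  HM :: "weight \<Rightarrow> 'f"

definition E_range :: "weight \<Rightarrow> int set" where
  "E_range k = {- fst k - 1..0}"

definition F_range :: "weight \<Rightarrow> int set" where
  "F_range k = {0..snd k + 1}"

definition int_power ::
  "('w, 'f, 't, 'm) two_cat_scheme \<Rightarrow> 'f \<Rightarrow> 'f \<Rightarrow> 'w \<Rightarrow> int \<Rightarrow> 'f" where
  "int_power K f f_inv k n =
     (if 0 \<le> n then (HC1 K f ^^ nat n) (One K k) else (HC1 K f_inv ^^ nat (- n)) (One K k))"

definition PsiP_pow :: "('f, 't, 'o, 'a, 'm) action_data_scheme \<Rightarrow> int \<Rightarrow> weight \<Rightarrow> 'f" where
  "PsiP_pow A n k = int_power A (PsiP A k) (PsiP_inv A k) k n"

definition PsiM_pow :: "('f, 't, 'o, 'a, 'm) action_data_scheme \<Rightarrow> int \<Rightarrow> weight \<Rightarrow> 'f" where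
  "PsiM_pow A n k = int_power A (PsiM A k) (PsiM_inv A k) k n"

locale partial_categorical_action = concrete_triangulated_2_category A
  for N :: nat and A :: "('f, 't, 'o, 'a, 'm) action_data_scheme" (structure) +
  assumes Obj_weights: "Obj A = all_weights N"
    and Mor_idempotent_complete:
      "\<lbrakk>k \<in> all_weights N; l \<in> all_weights N\<rbrakk> \<Longrightarrow> idempotent_complete (Mor A k l)"
    and zero_weight:
      "\<lbrakk>k \<in> all_weights N; l \<in> all_weights N; k \<notin> weights N \<or> l \<notin> weights N; f \<in> Ob (Mor A k l)\<rbrakk>
        \<Longrightarrow> zero_object (Mor A k l) f"
    and EE_Mor: "\<lbrakk>k \<in> all_weights N; r \<in> E_range k\<rbrakk> \<Longrightarrow> EE A r k \<in> Ob (Mor A k (wt_add k 1))"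
    and FF_Mor: "\<lbrakk>k \<in> all_weights N; s \<in> F_range k\<rbrakk> \<Longrightarrow> FF A s k \<in> Ob (Mor A k (wt_add k (- 1)))"
    and PsiP_Mor: "k \<in> all_weights N \<Longrightarrow> PsiP A k \<in> Ob (Mor A k k)"
    and PsiP_inv_Mor: "k \<in> all_weights N \<Longrightarrow> PsiP_inv A k \<in> Ob (Mor A k k)"
    and PsiM_Mor: "k \<in> all_weights N \<Longrightarrow> PsiM A k \<in> Ob (Mor A k k)"
    and PsiM_inv_Mor: "k \<in> all_weights N \<Longrightarrow> PsiM_inv A k \<in> Ob (Mor A k k)"
    and HP_Mor: "k \<in> all_weights N \<Longrightarrow> HP A k \<in> Ob (Mor A k k)"
    and HM_Mor: "k \<in> all_weights N \<Longrightarrow> HM A k \<in> Ob (Mor A k k)"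
    and PsiP_inverse: "k \<in> all_weights N \<Longrightarrow>
          isomorphic (Mor A k k) (PsiP A k \<star> PsiP_inv A k) (One A k) \<and>
          isomorphic (Mor A k k) (PsiP_inv A k \<star> PsiP A k) (One A k)"
    and PsiM_inverse: "k \<in> all_weights N \<Longrightarrow>
          isomorphic (Mor A k k) (PsiM A k \<star> PsiM_inv A k) (One A k) \<and>
          isomorphic (Mor A k k) (PsiM_inv A k \<star> PsiM A k) (One A k)"
    and finite_dim:
      "\<lbrakk>k \<in> all_weights N; l \<in> all_weights N; f \<in> Ob (Mor A k l); g \<in> Ob (Mor A k l)\<rbrakk>
        \<Longrightarrow> finite_dim_hom (Mor A k l) f g"
    and integrable: "k \<in> all_weights N \<Longrightarrow>
          \<exists>R. \<forall>r. \<bar>r\<bar> > R \<longrightarrow> zero_object (Mor A (wt_add k r) (wt_add k r)) (One A (wt_add k r))"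
    and EE_right_adjoint: "\<lbrakk>k \<in> weights N; r \<in> E_range k\<rbrakk> \<Longrightarrow>
          right_adjoint_iso A k (wt_add k 1) (EE A r k)
            (shift (Mor A (wt_add k 1) k) (- r - 1)
              (PsiP_pow A (r + 1) k \<star> FF A (snd k + 2) (wt_add k 1)
                 \<star> PsiP_pow A (- r - 2) (wt_add k 1)))"
    and FF_right_adjoint: "\<lbrakk>k \<in> weights N; s \<in> F_range k\<rbrakk> \<Longrightarrow>
          right_adjoint_iso A k (wt_add k (- 1)) (FF A s k)
            (shift (Mor A (wt_add k (- 1)) k) (s - 1)
              (PsiM_pow A (- s + 1) k \<star> EE A (- fst k - 2) (wt_add k (- 1))
                 \<star> PsiM_pow A (s - 2) (wt_add k (- 1))))"
    and PsiP_EE: "\<lbrakk>k \<in> weights N; r \<in> E_range k; r + 1 \<in> E_range k\<rbrakk> \<Longrightarrow>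
          isomorphic (Mor A k (wt_add k 1)) (PsiP A (wt_add k 1) \<star> EE A r k)
            (shift (Mor A k (wt_add k 1)) (- 1) (EE A (r + 1) k \<star> PsiP A k))"
    and PsiM_EE: "\<lbrakk>k \<in> weights N; r \<in> E_range k; r + 1 \<in> E_range k\<rbrakk> \<Longrightarrow>
          isomorphic (Mor A k (wt_add k 1)) (PsiM A (wt_add k 1) \<star> EE A r k)
            (shift (Mor A k (wt_add k 1)) 1 (EE A (r + 1) k \<star> PsiM A k))"
    and PsiP_FF: "\<lbrakk>k \<in> weights N; s \<in> F_range k; s - 1 \<in> F_range k\<rbrakk> \<Longrightarrow>
          isomorphic (Mor A k (wt_add k (- 1))) (PsiP A (wt_add k (- 1)) \<star> FF A s k)
            (shift (Mor A k (wt_add k (- 1))) 1 (FF A (s - 1) k \<star> PsiP A k))"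
    and PsiM_FF: "\<lbrakk>k \<in> weights N; s \<in> F_range k; s - 1 \<in> F_range k\<rbrakk> \<Longrightarrow>
          isomorphic (Mor A k (wt_add k (- 1))) (PsiM A (wt_add k (- 1)) \<star> FF A s k)
            (shift (Mor A k (wt_add k (- 1))) (- 1) (FF A (s - 1) k \<star> PsiM A k))"
    \<comment> \<open>The ranges of \<open>k\<close> are contained in those of the neighbouring weights, so all four
        1-morphisms in the next three conditions are defined.\<close>
    and EF_top: "\<lbrakk>k \<in> weights N; r \<in> E_range k; s \<in> F_range k; r + s = snd k\<rbrakk> \<Longrightarrow>
          exact_triangle (Mor A k k) (FF A s (wt_add k 1) \<star> EE A r k)
            (EE A r (wt_add k (- 1)) \<star> FF A s k) (PsiP A k)"
    and EF_bottom: "\<lbrakk>k \<in> weights N; r \<in> E_range k; s \<in> F_range k; r + s = - fst k\<rbrakk> \<Longrightarrow>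
          exact_triangle (Mor A k k) (EE A r (wt_add k (- 1)) \<star> FF A s k)
            (FF A s (wt_add k 1) \<star> EE A r k) (PsiM A k)"
    and EF_commute: "\<lbrakk>k \<in> weights N; r \<in> E_range k; s \<in> F_range k;
                      - fst k + 1 \<le> r + s; r + s \<le> snd k - 1\<rbrakk> \<Longrightarrow>
          isomorphic (Mor A k k) (FF A s (wt_add k 1) \<star> EE A r k)
            (EE A r (wt_add k (- 1)) \<star> FF A s k)"

definition P :: "nat \<Rightarrow> nat \<Rightarrow> int list set" where
  "P a b = {\<mu>. length \<mu> = b \<and> sorted_wrt (\<ge>) \<mu> \<and> set \<mu> \<subseteq> {0..int a}}"

text \<open>\<open>E_seq A N [\<mu>\<^sub>1, \<dots>, \<mu>\<^sub>n]\<close> is \<open>E\<^bsub>-\<mu>\<^sub>1\<^esub> \<cdots> E\<^bsub>-\<mu>\<^sub>n\<^esub> 1\<^bsub>(N, 0)\<^esub>\<close>; its target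
  is \<open>(N - n, n)\<close>.\<close>

fun E_seq :: "('f, 't, 'o, 'a, 'm) action_data_scheme \<Rightarrow> nat \<Rightarrow> int list \<Rightarrow> 'f" where
  "E_seq A N [] = One A (int N, 0)"
| "E_seq A N (m # \<mu>) =
     EE A (- m) (int N - int (length \<mu>), int (length \<mu>)) \<star>\<^bsub>A\<^esub> E_seq A N \<mu>"

definition Im_E :: "('f, 't, 'o, 'a, 'm) action_data_scheme \<Rightarrow> nat \<Rightarrow> nat \<Rightarrow> int list \<Rightarrow> 'o set" where
  "Im_E A N k \<mu> = thick_span (Cat A (int k, int N - int k))
     (essential_image (Cat A (int N, 0)) (Cat A (int k, int N - int k)) (ActO A (E_seq A N \<mu>)))"

definition BB :: "('f, 't, 'o, 'a, 'm) action_data_scheme \<Rightarrow> nat \<Rightarrow> nat \<Rightarrow> 'o set" where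
  "BB A N k = right_orthogonal (Cat A (int k, int N - int k))
     (tri_span (Cat A (int k, int N - int k)) (\<Union>\<mu> \<in> P k (N - k). Im_E A N k \<mu>))"

lemma finite_P: "finite (P a b)"
proof (rule finite_subset)
  show "P a b \<subseteq> {\<mu>. set \<mu> \<subseteq> {0..int a} \<and> length \<mu> = b}"
    by (auto simp: P_def)
  show "finite {\<mu>. set \<mu> \<subseteq> {0..int a} \<and> length \<mu> = b}"
    by (rule finite_lists_length_eq) simp
qed

text \<open>\<open>P a b\<close> listed in decreasing lexicographic order (the order on lists is the lexicographic
  one of \<open>List_Lexorder\<close>).\<close>

definition P_decreasing :: "nat \<Rightarrow> nat \<Rightarrow> int list list" where
  "P_decreasing a b = rev (sorted_list_of_set (P a b))"

end

theory Submission
  imports Defs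
begin

text \<open>
  Write \<open>E\<^sub>\<mu>\<close> for the composite \<open>E\<^bsub>-\<mu>\<^sub>1\<^esub> \<dots> E\<^bsub>-\<mu>\<^sub>n\<^esub> 1\<^bsub>(N, 0)\<^esub>\<close>. Everything follows from three
  properties of its left adjoint \<open>L\<^sub>\<mu>\<close>: it exists, \<open>L\<^sub>\<mu> E\<^sub>\<mu>\<close> is the identity up to shift, and \<open>L\<^sub>\<mu> E\<^sub>\<nu> =
  0\<close> for \<open>\<nu> < \<mu>\<close> (\<open>E_seq_left_adjoint\<close>). The first two make \<open>E\<^sub>\<mu>\<close> fully faithful, the third says \<open>Hom
  (E\<^sub>\<nu> X, E\<^sub>\<mu> Y) = Hom (L\<^sub>\<mu> E\<^sub>\<nu> X, Y) = 0\<close>. Since \<open>E\<^sub>\<mu>\<close> also has a right adjoint, its image is right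
  admissible, and projecting an object successively to the components leaves a remainder in the
  orthogonal \<open>\<B>\<close>; hence the components generate (\<open>semiorthogonal_decompositionI\<close>).

  For the left adjoints one reads \<open>FF_right_adjoint\<close> backwards: the right adjoint of \<open>F\<^sub>1\<close> is \<open>E\<close> up
  to \<open>\<Psi>\<^sup>-\<close> and shift, and conjugation by powers of \<open>\<Psi>\<^sup>-\<close> changes the index of \<open>E\<close> and \<open>F\<close>. With \<open>F\<^sub>s
  := (\<Psi>\<^sup>-)\<^sup>-\<^sup>s F\<^sub>0 (\<Psi>\<^sup>-)\<^sup>s\<close> for all integers \<open>s\<close>, the left adjoint of \<open>E\<^bsub>-m\<^esub> 1\<^sub>k\<close>, where \<open>k = (k\<^sub>1,
  k\<^sub>2)\<close> and \<open>m < k\<^sub>1\<close>, is \<open>(\<Psi>\<^sup>-)\<^sup>-\<^sup>1 F\<^bsub>m - k\<^sub>1\<^esub>\<close> up to shift (\<open>EE_left_adjoint\<close>). Using the left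
  adjoints instead of the right ones matters: the sums of indices that occur are then all in the
  range where \<open>E\<close> and \<open>F\<close> commute or are related by \<open>\<Psi>\<^sup>-\<close>. Indeed, let \<open>\<mu> = (m, \<mu>')\<close> and \<open>\<nu> = (n,
  \<nu>')\<close> with \<open>n \<le> m\<close>. All entries of \<open>\<nu>'\<close> lie between \<open>0\<close> and \<open>m\<close>, so \<open>F\<^bsub>m - k\<^sub>1\<^esub>\<close> commutes with every
  factor of \<open>E\<^bsub>\<nu>'\<^esub>\<close> and reaches the highest weight \<open>(N, 0)\<close>, where it vanishes. If \<open>n < m\<close> it also
  commutes with \<open>E\<^bsub>-n\<^esub>\<close>, so that \<open>L\<^sub>\<mu> E\<^sub>\<nu> = 0\<close>; if \<open>n = m\<close> the triangle \<open>EF_bottom\<close> gives \<open>F\<^bsub>m - k\<^sub>1\<^esub>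
  E\<^bsub>-m\<^esub> E\<^bsub>\<nu>'\<^esub> = \<Psi>\<^sup>- E\<^bsub>\<nu>'\<^esub>\<close>, and induction on the length applies.

  Shifts are never tracked: a left adjoint \<open>L\<close> of \<open>F\<close> with \<open>L F \<cong> T\<close> for an autoequivalence \<open>T\<close>
  already forces \<open>F\<close> to be fully faithful (\<open>fully_faithful_of_twisted_bijection\<close>). Only isomorphisms,
  adjunctions and zero objects are carried over from the categories of 1-morphisms to functors, because
  triangles of 1-morphisms need not induce triangles of objects.
\<close>

section \<open>Categories, functors and adjunctions\<close>

lemma (in category) Hom_Ob:
  assumes "f \<in> Hom C X Y"
  shows "X \<in> Ob C" "Y \<in> Ob C"
  using assms Src_Ob Tgt_Ob by (auto simp: Hom_def)

lemma (in category) iso_arrI: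
  assumes "f \<in> Hom C X Y" "g \<in> Hom C Y X" "g \<cdot> f = Idn C X" "f \<cdot> g = Idn C Y"
  shows "iso_arr C f"
  using assms by (auto simp: iso_arr_def Hom_def)

lemma (in category) iso_arrE:
  assumes "iso_arr C f" "f \<in> Hom C X Y"
  obtains g where "g \<in> Hom C Y X" "g \<cdot> f = Idn C X" "f \<cdot> g = Idn C Y"
  using assms by (auto simp: iso_arr_def Hom_def)

lemma (in category) isomorphicI:
  assumes "f \<in> Hom C X Y" "g \<in> Hom C Y X" "g \<cdot> f = Idn C X" "f \<cdot> g = Idn C Y"
  shows "isomorphic C X Y"
  using iso_arrI[OF assms] assms(1) by (auto simp: isomorphic_def)

lemma (in category) isomorphicE:
  assumes "isomorphic C X Y"
  obtains f g where "f \<in> Hom C X Y" "g \<in> Hom C Y X" "g \<cdot> f = Idn C X" "f \<cdot> g = Idn C Y"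
  using assms iso_arrE unfolding isomorphic_def by metis

lemma (in category) isomorphic_refl: "X \<in> Ob C \<Longrightarrow> isomorphic C X X"
  by (rule isomorphicI[of "Idn C X" _ _ "Idn C X"]) (auto intro: Idn_Hom Cmp_Idn)

lemma (in category) isomorphic_sym: "isomorphic C X Y \<Longrightarrow> isomorphic C Y X"
  by (metis isomorphicE isomorphicI)

lemma (in category) Cmp_cancel_inner:
  assumes "f \<in> Hom C X Y" "g \<in> Hom C Y X" "g \<cdot> f = Idn C X" "h \<in> Hom C W X"
  shows "g \<cdot> (f \<cdot> h) = h"
  using assms by (metis Cmp_assoc Idn_Cmp)

lemma (in category) inverse_Cmp:
  assumes "f \<in> Hom C X Y" "g \<in> Hom C Y X" "g \<cdot> f = Idn C X"
    and "f' \<in> Hom C Y Z" "g' \<in> Hom C Z Y" "g' \<cdot> f' = Idn C Y"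
  shows "(g \<cdot> g') \<cdot> (f' \<cdot> f) = Idn C X"
proof -
  have "(g \<cdot> g') \<cdot> (f' \<cdot> f) = g \<cdot> (g' \<cdot> (f' \<cdot> f))"
    using assms by (intro Cmp_assoc[of _ _ Z _ Y]) (auto intro: Cmp_Hom)
  also have "g' \<cdot> (f' \<cdot> f) = f"
    using assms by (intro Cmp_cancel_inner)
  finally show ?thesis using assms by simp
qed

lemma (in category) isomorphic_trans [trans]:
  assumes "isomorphic C X Y" "isomorphic C Y Z"
  shows "isomorphic C X Z"
proof -
  obtain f g where fg: "f \<in> Hom C X Y" "g \<in> Hom C Y X" "g \<cdot> f = Idn C X" "f \<cdot> g = Idn C Y"
    using assms(1) by (rule isomorphicE)
  obtain f' g' where fg': "f' \<in> Hom C Y Z" "g' \<in> Hom C Z Y" "g' \<cdot> f' = Idn C Y" "f' \<cdot> g' = Idn C Z"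
    using assms(2) by (rule isomorphicE)
  show ?thesis
    using fg fg' inverse_Cmp[of f X Y g f' Z g'] inverse_Cmp[of g' Z Y f' g X f]
    by (intro isomorphicI[of "f' \<cdot> f" _ _ "g \<cdot> g'"]) (auto intro: Cmp_Hom)
qed

lemma (in category) isomorphic_Ob:
  assumes "isomorphic C X Y"
  shows "X \<in> Ob C" "Y \<in> Ob C"
  using assms Hom_Ob by (auto simp: isomorphic_def)

lemma is_functor_Ob: "is_functor C D Fo Fa \<Longrightarrow> X \<in> Ob C \<Longrightarrow> Fo X \<in> Ob D"
  by (auto simp: is_functor_def)

lemma is_functor_Idn: "is_functor C D Fo Fa \<Longrightarrow> X \<in> Ob C \<Longrightarrow> Fa (Idn C X) = Idn D (Fo X)"
  by (auto simp: is_functor_def)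

lemma is_functor_Hom:
  "category C \<Longrightarrow> is_functor C D Fo Fa \<Longrightarrow> f \<in> Hom C X Y \<Longrightarrow> Fa f \<in> Hom D (Fo X) (Fo Y)"
  using category.Hom_Ob unfolding is_functor_def by metis

lemma is_functor_Cmp:
  "category C \<Longrightarrow> is_functor C D Fo Fa \<Longrightarrow> f \<in> Hom C X Y \<Longrightarrow> g \<in> Hom C Y Z \<Longrightarrow>
    Fa (g \<cdot>\<^bsub>C\<^esub> f) = Fa g \<cdot>\<^bsub>D\<^esub> Fa f"
  using category.Hom_Ob unfolding is_functor_def by metis

lemma is_functor_compose:
  assumes "category C" "category D" "is_functor C D Fo Fa" "is_functor D E Go Ga"
  shows "is_functor C E (\<lambda>X. Go (Fo X)) (\<lambda>f. Ga (Fa f))"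
  unfolding is_functor_def[of C E]
proof (intro conjI ballI)
  fix X Y Z f g assume f: "f \<in> Hom C X Y" and g: "g \<in> Hom C Y Z"
  show "Ga (Fa (g \<cdot>\<^bsub>C\<^esub> f)) = Ga (Fa g) \<cdot>\<^bsub>E\<^esub> Ga (Fa f)"
    using is_functor_Cmp[OF assms(1,3) f g] is_functor_Hom[OF assms(1,3) f]
      is_functor_Hom[OF assms(1,3) g] is_functor_Cmp[OF assms(2,4)] by simp
next
  fix X Y f assume f: "f \<in> Hom C X Y"
  show "Ga (Fa f) \<in> Hom E (Go (Fo X)) (Go (Fo Y))"
    using is_functor_Hom[OF assms(2,4) is_functor_Hom[OF assms(1,3) f]] .
qed (use is_functor_Ob[OF assms(3)] is_functor_Idn[OF assms(3)] is_functor_Ob[OF assms(4)]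
  is_functor_Idn[OF assms(4)] in auto)

lemma is_functor_isomorphic:
  assumes "category C" "category D" "is_functor C D Fo Fa" "isomorphic C X Y"
  shows "isomorphic D (Fo X) (Fo Y)"
proof -
  obtain f g where fg: "f \<in> Hom C X Y" "g \<in> Hom C Y X"
      "g \<cdot>\<^bsub>C\<^esub> f = Idn C X" "f \<cdot>\<^bsub>C\<^esub> g = Idn C Y"
    using category.isomorphicE[OF assms(1,4)] by metis
  note ob = category.Hom_Ob[OF assms(1) fg(1)]
  show ?thesis
  proof (rule category.isomorphicI[OF assms(2)])
    show "Fa f \<in> Hom D (Fo X) (Fo Y)" "Fa g \<in> Hom D (Fo Y) (Fo X)"
      using fg assms is_functor_Hom by metis+
    show "Fa g \<cdot>\<^bsub>D\<^esub> Fa f = Idn D (Fo X)" "Fa f \<cdot>\<^bsub>D\<^esub> Fa g = Idn D (Fo Y)"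
      using fg ob is_functor_Cmp[OF assms(1,3)] is_functor_Idn[OF assms(3)] by metis+
  qed
qed

definition nat_iso ::
  "('o, 'a, 'm) cat_scheme \<Rightarrow> ('p, 'b, 'n) cat_scheme \<Rightarrow> ('o \<Rightarrow> 'p) \<Rightarrow> ('a \<Rightarrow> 'b) \<Rightarrow>
    ('o \<Rightarrow> 'p) \<Rightarrow> ('a \<Rightarrow> 'b) \<Rightarrow> bool" where
  "nat_iso C D Fo Fa Go Ga \<longleftrightarrow> (\<exists>\<alpha>.
     (\<forall>X \<in> Ob C. \<alpha> X \<in> Hom D (Fo X) (Go X) \<and> iso_arr D (\<alpha> X)) \<and>
     (\<forall>X Y. \<forall>f \<in> Hom C X Y. \<alpha> Y \<cdot>\<^bsub>D\<^esub> Fa f = Ga f \<cdot>\<^bsub>D\<^esub> \<alpha> X))"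

definition inverse_transformations ::
  "('o, 'a, 'm) cat_scheme \<Rightarrow> ('p, 'b, 'n) cat_scheme \<Rightarrow> ('o \<Rightarrow> 'p) \<Rightarrow> ('a \<Rightarrow> 'b) \<Rightarrow>
    ('o \<Rightarrow> 'p) \<Rightarrow> ('a \<Rightarrow> 'b) \<Rightarrow> ('o \<Rightarrow> 'b) \<Rightarrow> ('o \<Rightarrow> 'b) \<Rightarrow> bool" where
  "inverse_transformations C D Fo Fa Go Ga \<alpha> \<beta> \<longleftrightarrow>
     (\<forall>X \<in> Ob C. \<alpha> X \<in> Hom D (Fo X) (Go X) \<and> \<beta> X \<in> Hom D (Go X) (Fo X) \<and>
        \<beta> X \<cdot>\<^bsub>D\<^esub> \<alpha> X = Idn D (Fo X) \<and> \<alpha> X \<cdot>\<^bsub>D\<^esub> \<beta> X = Idn D (Go X)) \<and>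
     (\<forall>X Y. \<forall>f \<in> Hom C X Y. \<alpha> Y \<cdot>\<^bsub>D\<^esub> Fa f = Ga f \<cdot>\<^bsub>D\<^esub> \<alpha> X \<and>
        \<beta> Y \<cdot>\<^bsub>D\<^esub> Ga f = Fa f \<cdot>\<^bsub>D\<^esub> \<beta> X)"

lemma inverse_transformationsD:
  assumes "inverse_transformations C D Fo Fa Go Ga \<alpha> \<beta>"
  shows "X \<in> Ob C \<Longrightarrow> \<alpha> X \<in> Hom D (Fo X) (Go X)"
    and "X \<in> Ob C \<Longrightarrow> \<beta> X \<in> Hom D (Go X) (Fo X)"
    and "X \<in> Ob C \<Longrightarrow> \<beta> X \<cdot>\<^bsub>D\<^esub> \<alpha> X = Idn D (Fo X)"
    and "X \<in> Ob C \<Longrightarrow> \<alpha> X \<cdot>\<^bsub>D\<^esub> \<beta> X = Idn D (Go X)"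
    and "f \<in> Hom C X Y \<Longrightarrow> \<alpha> Y \<cdot>\<^bsub>D\<^esub> Fa f = Ga f \<cdot>\<^bsub>D\<^esub> \<alpha> X"
    and "f \<in> Hom C X Y \<Longrightarrow> \<beta> Y \<cdot>\<^bsub>D\<^esub> Ga f = Fa f \<cdot>\<^bsub>D\<^esub> \<beta> X"
  using assms unfolding inverse_transformations_def by blast+

lemma nat_isoE:
  assumes "nat_iso C D Fo Fa Go Ga" "category C" "category D"
    and F: "is_functor C D Fo Fa" and G: "is_functor C D Go Ga"
  obtains \<alpha> \<beta> where "inverse_transformations C D Fo Fa Go Ga \<alpha> \<beta>"
proof -
  interpret D: category D by fact
  interpret C: category C by fact
  obtain \<alpha> where a: "\<And>X. X \<in> Ob C \<Longrightarrow> \<alpha> X \<in> Hom D (Fo X) (Go X)"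
      and iso: "\<And>X. X \<in> Ob C \<Longrightarrow> iso_arr D (\<alpha> X)"
      and nat: "\<And>X Y f. f \<in> Hom C X Y \<Longrightarrow> \<alpha> Y \<cdot>\<^bsub>D\<^esub> Fa f = Ga f \<cdot>\<^bsub>D\<^esub> \<alpha> X"
    using assms(1) unfolding nat_iso_def by blast
  have "\<forall>X \<in> Ob C. \<exists>b. b \<in> Hom D (Go X) (Fo X) \<and> b \<cdot>\<^bsub>D\<^esub> \<alpha> X = Idn D (Fo X)
      \<and> \<alpha> X \<cdot>\<^bsub>D\<^esub> b = Idn D (Go X)"
    using D.iso_arrE[OF iso a] by metis
  then obtain \<beta> where b: "\<And>X. X \<in> Ob C \<Longrightarrow> \<beta> X \<in> Hom D (Go X) (Fo X)"
    "\<And>X. X \<in> Ob C \<Longrightarrow> \<beta> X \<cdot>\<^bsub>D\<^esub> \<alpha> X = Idn D (Fo X)"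
    "\<And>X. X \<in> Ob C \<Longrightarrow> \<alpha> X \<cdot>\<^bsub>D\<^esub> \<beta> X = Idn D (Go X)" by metis
  have nat': "\<beta> Y \<cdot>\<^bsub>D\<^esub> Ga f = Fa f \<cdot>\<^bsub>D\<^esub> \<beta> X" if f: "f \<in> Hom C X Y" for X Y f
  proof -
    note ob = C.Hom_Ob[OF f]
    note Ff = is_functor_Hom[OF \<open>category C\<close> F f]
    note Gf = is_functor_Hom[OF \<open>category C\<close> G f]
    have "\<beta> Y \<cdot>\<^bsub>D\<^esub> Ga f = \<beta> Y \<cdot>\<^bsub>D\<^esub> (Ga f \<cdot>\<^bsub>D\<^esub> (\<alpha> X \<cdot>\<^bsub>D\<^esub> \<beta> X))"
      using ob b Gf by (simp add: D.Cmp_Idn)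
    also have "\<dots> = \<beta> Y \<cdot>\<^bsub>D\<^esub> ((\<alpha> Y \<cdot>\<^bsub>D\<^esub> Fa f) \<cdot>\<^bsub>D\<^esub> \<beta> X)"
      using ob b a Gf nat[OF f] by (metis D.Cmp_assoc)
    also have "\<dots> = \<beta> Y \<cdot>\<^bsub>D\<^esub> (\<alpha> Y \<cdot>\<^bsub>D\<^esub> (Fa f \<cdot>\<^bsub>D\<^esub> \<beta> X))"
      using ob b a Ff by (metis D.Cmp_assoc)
    also have "\<dots> = Fa f \<cdot>\<^bsub>D\<^esub> \<beta> X"
      using ob b a Ff by (intro D.Cmp_cancel_inner) (auto intro: D.Cmp_Hom)
    finally show ?thesis .
  qed
  have "inverse_transformations C D Fo Fa Go Ga \<alpha> \<beta>"
    unfolding inverse_transformations_def using a b nat nat' by simp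
  then show thesis by (rule that)
qed

lemma nat_iso_faithful:
  assumes "category C" "category D" and F: "is_functor C D Fo Fa" and G: "is_functor D C Go Ga"
    and iso: "nat_iso C C (\<lambda>X. Go (Fo X)) (\<lambda>f. Ga (Fa f)) (\<lambda>X. X) (\<lambda>f. f)"
    and f: "f \<in> Hom C X Y" and g: "g \<in> Hom C X Y" and eq: "Fa f = Fa g"
  shows "f = g"
proof -
  interpret C: category C by fact
  obtain \<alpha> where a: "\<And>X. X \<in> Ob C \<Longrightarrow> \<alpha> X \<in> Hom C (Go (Fo X)) X"
      and aiso: "\<And>X. X \<in> Ob C \<Longrightarrow> iso_arr C (\<alpha> X)"
      and nat: "\<And>X Y f. f \<in> Hom C X Y \<Longrightarrow> \<alpha> Y \<cdot>\<^bsub>C\<^esub> Ga (Fa f) = f \<cdot>\<^bsub>C\<^esub> \<alpha> X"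
    using iso unfolding nat_iso_def by blast
  have X: "X \<in> Ob C" using C.Hom_Ob f by auto
  obtain b where b: "b \<in> Hom C X (Go (Fo X))" "\<alpha> X \<cdot>\<^bsub>C\<^esub> b = Idn C X"
    using C.iso_arrE[OF aiso[OF X] a[OF X]] by metis
  have "f \<cdot>\<^bsub>C\<^esub> \<alpha> X = g \<cdot>\<^bsub>C\<^esub> \<alpha> X" using nat f g eq by metis
  then show ?thesis
    using C.Cmp_assoc[OF b(1) a[OF X] f] C.Cmp_assoc[OF b(1) a[OF X] g] b C.Cmp_Idn f g by metis
qed

text \<open>Both functors are faithful by the previous lemma. A preimage of \<open>t : F X \<rightarrow> F Y\<close> is \<open>G t\<close> transported
  along \<open>G F \<cong> 1\<close>: its image under \<open>G F\<close> is \<open>G t\<close>, and \<open>G\<close> is faithful.\<close>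

lemma fully_faithful_of_equivalence:
  assumes "category C" "category D" and F: "is_functor C D Fo Fa" and G: "is_functor D C Go Ga"
    and GF: "nat_iso C C (\<lambda>X. Go (Fo X)) (\<lambda>f. Ga (Fa f)) (\<lambda>X. X) (\<lambda>f. f)"
    and FG: "nat_iso D D (\<lambda>X. Fo (Go X)) (\<lambda>f. Fa (Ga f)) (\<lambda>X. X) (\<lambda>f. f)"
  shows "fully_faithful C D Fo Fa"
proof -
  interpret C: category C by fact
  interpret D: category D by fact
  note FH = is_functor_Hom[OF \<open>category C\<close> F] and GH = is_functor_Hom[OF \<open>category D\<close> G]
  have GFf: "is_functor C C (\<lambda>X. Go (Fo X)) (\<lambda>f. Ga (Fa f))"
    using is_functor_compose[OF assms(1,2) F G] .
  have Idf: "is_functor C C (\<lambda>X. X) (\<lambda>f. f)" unfolding is_functor_def by simp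
  obtain \<alpha> \<beta> where
    "inverse_transformations C C (\<lambda>X. Go (Fo X)) (\<lambda>f. Ga (Fa f)) (\<lambda>X. X) (\<lambda>f. f) \<alpha> \<beta>"
    using nat_isoE[OF GF \<open>category C\<close> \<open>category C\<close> GFf Idf] by blast
  note a = inverse_transformationsD(1)[OF this] and b = inverse_transformationsD(2)[OF this]
    and ba = inverse_transformationsD(3)[OF this] and ab = inverse_transformationsD(4)[OF this]
    and nat = inverse_transformationsD(5)[OF this] and nat' = inverse_transformationsD(6)[OF this]
  have "bij_betw Fa (Hom C X Y) (Hom D (Fo X) (Fo Y))" if X: "X \<in> Ob C" and Y: "Y \<in> Ob C" for X Y
  proof (rule bij_betwI')
    fix f g assume "f \<in> Hom C X Y" "g \<in> Hom C X Y"
    then show "(Fa f = Fa g) = (f = g)"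
      using nat_iso_faithful[OF \<open>category C\<close> \<open>category D\<close> F G GF] by metis
  next
    fix f assume "f \<in> Hom C X Y"
    then show "Fa f \<in> Hom D (Fo X) (Fo Y)" by (rule FH)
  next
    fix t assume t: "t \<in> Hom D (Fo X) (Fo Y)"
    define h where "h = \<alpha> Y \<cdot>\<^bsub>C\<^esub> (Ga t \<cdot>\<^bsub>C\<^esub> \<beta> X)"
    have Gt: "Ga t \<in> Hom C (Go (Fo X)) (Go (Fo Y))" using t by (rule GH)
    have Gtb: "Ga t \<cdot>\<^bsub>C\<^esub> \<beta> X \<in> Hom C X (Go (Fo Y))" using C.Cmp_Hom[OF b[OF X] Gt] .
    have h: "h \<in> Hom C X Y" unfolding h_def using C.Cmp_Hom[OF Gtb a[OF Y]] .
    have GFh: "Ga (Fa h) \<in> Hom C (Go (Fo X)) (Go (Fo Y))" using GH[OF FH[OF h]] .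
    have "Ga (Fa h) \<cdot>\<^bsub>C\<^esub> \<beta> X = Ga t \<cdot>\<^bsub>C\<^esub> \<beta> X"
      using nat'[OF h] C.Cmp_cancel_inner[OF a[OF Y] b[OF Y] ba[OF Y] Gtb] unfolding h_def by simp
    then have "Ga (Fa h) = Ga t"
      using C.Cmp_assoc[OF a[OF X] b[OF X] GFh] C.Cmp_assoc[OF a[OF X] b[OF X] Gt] ba[OF X]
        C.Cmp_Idn GFh Gt by metis
    then have "Fa h = t"
      using nat_iso_faithful[OF \<open>category D\<close> \<open>category C\<close> G F FG FH[OF h] t] by blast
    then show "\<exists>f\<in>Hom C X Y. t = Fa f" using h by blast
  qed
  then show ?thesis using F by (simp add: fully_faithful_def)
qed

text \<open>Adjunctions are recorded as natural bijections of Hom sets, so that they compose by composing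
  bijections, and an equivalence is adjoint to any of its quasi-inverses without correcting the
  unit.\<close>

definition adjunction_bijection ::
  "('o, 'a, 'm) cat_scheme \<Rightarrow> ('p, 'b, 'n) cat_scheme \<Rightarrow> ('o \<Rightarrow> 'p) \<Rightarrow> ('a \<Rightarrow> 'b) \<Rightarrow>
    ('p \<Rightarrow> 'o) \<Rightarrow> ('b \<Rightarrow> 'a) \<Rightarrow> ('o \<Rightarrow> 'p \<Rightarrow> 'b \<Rightarrow> 'a) \<Rightarrow> bool" where
  "adjunction_bijection C D Lo La Ro Ra \<phi> \<longleftrightarrow>
     (\<forall>X \<in> Ob C. \<forall>Y \<in> Ob D. bij_betw (\<phi> X Y) (Hom D (Lo X) Y) (Hom C X (Ro Y))) \<and>
     (\<forall>X X' Y. \<forall>f \<in> Hom C X' X. \<forall>t \<in> Hom D (Lo X) Y.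
        \<phi> X' Y (t \<cdot>\<^bsub>D\<^esub> La f) = \<phi> X Y t \<cdot>\<^bsub>C\<^esub> f) \<and>
     (\<forall>X Y Y'. X \<in> Ob C \<longrightarrow> (\<forall>g \<in> Hom D Y Y'. \<forall>t \<in> Hom D (Lo X) Y.
        \<phi> X Y' (g \<cdot>\<^bsub>D\<^esub> t) = Ra g \<cdot>\<^bsub>C\<^esub> \<phi> X Y t))"

definition hom_adjunction ::
  "('o, 'a, 'm) cat_scheme \<Rightarrow> ('p, 'b, 'n) cat_scheme \<Rightarrow> ('o \<Rightarrow> 'p) \<Rightarrow> ('a \<Rightarrow> 'b) \<Rightarrow>
    ('p \<Rightarrow> 'o) \<Rightarrow> ('b \<Rightarrow> 'a) \<Rightarrow> bool" where
  "hom_adjunction C D Lo La Ro Ra \<longleftrightarrow> (\<exists>\<phi>. adjunction_bijection C D Lo La Ro Ra \<phi>)"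

lemma hom_adjunctionI:
  assumes "\<And>X Y. X \<in> Ob C \<Longrightarrow> Y \<in> Ob D \<Longrightarrow> bij_betw (\<phi> X Y) (Hom D (Lo X) Y) (Hom C X (Ro Y))"
    and "\<And>X X' Y f t. f \<in> Hom C X' X \<Longrightarrow> t \<in> Hom D (Lo X) Y \<Longrightarrow>
      \<phi> X' Y (t \<cdot>\<^bsub>D\<^esub> La f) = \<phi> X Y t \<cdot>\<^bsub>C\<^esub> f"
    and "\<And>X Y Y' g t. X \<in> Ob C \<Longrightarrow> g \<in> Hom D Y Y' \<Longrightarrow> t \<in> Hom D (Lo X) Y \<Longrightarrow>
      \<phi> X Y' (g \<cdot>\<^bsub>D\<^esub> t) = Ra g \<cdot>\<^bsub>C\<^esub> \<phi> X Y t"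
  shows "hom_adjunction C D Lo La Ro Ra"
  unfolding hom_adjunction_def adjunction_bijection_def using assms by (intro exI[of _ \<phi>]) blast

lemma adjunction_bijectionD:
  assumes "adjunction_bijection C D Lo La Ro Ra \<phi>"
  shows "X \<in> Ob C \<Longrightarrow> Y \<in> Ob D \<Longrightarrow> bij_betw (\<phi> X Y) (Hom D (Lo X) Y) (Hom C X (Ro Y))"
    and "f \<in> Hom C X' X \<Longrightarrow> t \<in> Hom D (Lo X) Y \<Longrightarrow>
      \<phi> X' Y (t \<cdot>\<^bsub>D\<^esub> La f) = \<phi> X Y t \<cdot>\<^bsub>C\<^esub> f"
    and "X \<in> Ob C \<Longrightarrow> g \<in> Hom D Y Y' \<Longrightarrow> t \<in> Hom D (Lo X) Y \<Longrightarrow>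
      \<phi> X Y' (g \<cdot>\<^bsub>D\<^esub> t) = Ra g \<cdot>\<^bsub>C\<^esub> \<phi> X Y t"
  using assms unfolding adjunction_bijection_def by blast+

lemma hom_adjunction_cong:
  assumes adj: "hom_adjunction C D Lo La Ro Ra" and "category C" "category D"
    and "\<And>X. X \<in> Ob C \<Longrightarrow> Lo' X = Lo X" "\<And>f. f \<in> Arr C \<Longrightarrow> La' f = La f"
    and "\<And>Y. Y \<in> Ob D \<Longrightarrow> Ro' Y = Ro Y" "\<And>g. g \<in> Arr D \<Longrightarrow> Ra' g = Ra g"
  shows "hom_adjunction C D Lo' La' Ro' Ra'"
proof -
  from adj obtain \<phi> where "adjunction_bijection C D Lo La Ro Ra \<phi>"
    unfolding hom_adjunction_def by blast
  note p = adjunction_bijectionD[OF this]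
  have arr: "\<And>f X Y. f \<in> Hom C X Y \<Longrightarrow> f \<in> Arr C" "\<And>f X Y. f \<in> Hom D X Y \<Longrightarrow> f \<in> Arr D"
    by (auto simp: Hom_def)
  show ?thesis
  proof (rule hom_adjunctionI[where \<phi>=\<phi>])
    fix X Y assume "X \<in> Ob C" "Y \<in> Ob D"
    then show "bij_betw (\<phi> X Y) (Hom D (Lo' X) Y) (Hom C X (Ro' Y))" using p(1) assms(4,6) by simp
  next
    fix X X' Y f t assume f: "f \<in> Hom C X' X" and t: "t \<in> Hom D (Lo' X) Y"
    have "t \<in> Hom D (Lo X) Y" using t assms(4) category.Hom_Ob[OF assms(2) f] by metis
    then show "\<phi> X' Y (t \<cdot>\<^bsub>D\<^esub> La' f) = \<phi> X Y t \<cdot>\<^bsub>C\<^esub> f" using p(2) f assms(5) arr by metis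
  next
    fix X Y Y' g t assume X: "X \<in> Ob C" and g: "g \<in> Hom D Y Y'" and t: "t \<in> Hom D (Lo' X) Y"
    have "t \<in> Hom D (Lo X) Y" using t assms(4) X by metis
    then show "\<phi> X Y' (g \<cdot>\<^bsub>D\<^esub> t) = Ra' g \<cdot>\<^bsub>C\<^esub> \<phi> X Y t" using p(3) X g assms(7) arr by metis
  qed
qed

lemma hom_adjunction_compose:
  assumes "category C" "category D" "category E"
    and L: "is_functor C D Lo La" and R': "is_functor E D Ro' Ra'"
    and adj: "hom_adjunction C D Lo La Ro Ra" and adj': "hom_adjunction D E Lo' La' Ro' Ra'"
  shows "hom_adjunction C E (\<lambda>X. Lo' (Lo X)) (\<lambda>f. La' (La f)) (\<lambda>Y. Ro (Ro' Y)) (\<lambda>g. Ra (Ra' g))"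
proof -
  from adj obtain \<phi> where "adjunction_bijection C D Lo La Ro Ra \<phi>"
    unfolding hom_adjunction_def by blast
  note p = adjunction_bijectionD[OF this]
  from adj' obtain \<psi> where "adjunction_bijection D E Lo' La' Ro' Ra' \<psi>"
    unfolding hom_adjunction_def by blast
  note q = adjunction_bijectionD[OF this]
  have qH: "\<psi> X Y t \<in> Hom D X (Ro' Y)" if "X \<in> Ob D" "t \<in> Hom E (Lo' X) Y" for X Y t
    using that q(1) category.Hom_Ob[OF assms(3)] bij_betwE by metis
  show ?thesis
  proof (rule hom_adjunctionI[where \<phi>="\<lambda>X Y t. \<phi> X (Ro' Y) (\<psi> (Lo X) Y t)"])
    fix X Y assume X: "X \<in> Ob C" and Y: "Y \<in> Ob E"
    show "bij_betw (\<lambda>t. \<phi> X (Ro' Y) (\<psi> (Lo X) Y t)) (Hom E (Lo' (Lo X)) Y) (Hom C X (Ro (Ro' Y)))"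
      using bij_betw_trans[OF q(1)[OF is_functor_Ob[OF L X] Y] p(1)[OF X is_functor_Ob[OF R' Y]]]
      by (simp add: comp_def)
  next
    fix X X' Y f t assume f: "f \<in> Hom C X' X" and t: "t \<in> Hom E (Lo' (Lo X)) Y"
    have Lf: "La f \<in> Hom D (Lo X') (Lo X)" using is_functor_Hom[OF assms(1) L f] .
    have "Lo X \<in> Ob D" using category.Hom_Ob[OF assms(2) Lf] by simp
    then show "\<phi> X' (Ro' Y) (\<psi> (Lo X') Y (t \<cdot>\<^bsub>E\<^esub> La' (La f))) =
        \<phi> X (Ro' Y) (\<psi> (Lo X) Y t) \<cdot>\<^bsub>C\<^esub> f"
      using q(2)[OF Lf t] p(2)[OF f qH[OF _ t]] by simp
  next
    fix X Y Y' g t assume X: "X \<in> Ob C" and g: "g \<in> Hom E Y Y'" and t: "t \<in> Hom E (Lo' (Lo X)) Y"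
    have LX: "Lo X \<in> Ob D" using is_functor_Ob[OF L X] .
    show "\<phi> X (Ro' Y') (\<psi> (Lo X) Y' (g \<cdot>\<^bsub>E\<^esub> t)) = Ra (Ra' g) \<cdot>\<^bsub>C\<^esub> \<phi> X (Ro' Y) (\<psi> (Lo X) Y t)"
      using q(3)[OF LX g t] p(3)[OF X is_functor_Hom[OF assms(3) R' g] qH[OF LX t]] by simp
  qed
qed

lemma hom_adjunction_nat_iso_right:
  assumes "category C" "category D"
    and R: "is_functor D C Ro Ra" and R': "is_functor D C Ro' Ra'"
    and adj: "hom_adjunction C D Lo La Ro Ra" and iso: "nat_iso D C Ro Ra Ro' Ra'"
    and L: "is_functor C D Lo La"
  shows "hom_adjunction C D Lo La Ro' Ra'"
proof -
  interpret C: category C by fact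
  interpret D: category D by fact
  from adj obtain \<phi> where "adjunction_bijection C D Lo La Ro Ra \<phi>"
    unfolding hom_adjunction_def by blast
  note p = adjunction_bijectionD[OF this]
  obtain \<alpha> \<beta> where
    "inverse_transformations D C Ro Ra Ro' Ra' \<alpha> \<beta>"
    using nat_isoE[OF iso assms(2,1) R R'] by blast
  note a = inverse_transformationsD(1)[OF this] and b = inverse_transformationsD(2)[OF this]
    and ba = inverse_transformationsD(3)[OF this] and ab = inverse_transformationsD(4)[OF this]
    and nat = inverse_transformationsD(5)[OF this] and nat' = inverse_transformationsD(6)[OF this]
  have pH: "\<phi> X Y t \<in> Hom C X (Ro Y)" if "X \<in> Ob C" "t \<in> Hom D (Lo X) Y" for X Y t
    using that p(1) D.Hom_Ob bij_betwE by metis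
  show ?thesis
  proof (rule hom_adjunctionI[where \<phi>="\<lambda>X Y t. \<alpha> Y \<cdot>\<^bsub>C\<^esub> \<phi> X Y t"])
    fix X Y assume X: "X \<in> Ob C" and Y: "Y \<in> Ob D"
    have "bij_betw (\<lambda>s. \<alpha> Y \<cdot>\<^bsub>C\<^esub> s) (Hom C X (Ro Y)) (Hom C X (Ro' Y))"
      by (rule bij_betw_byWitness[where f'="\<lambda>s. \<beta> Y \<cdot>\<^bsub>C\<^esub> s"])
        (use C.Cmp_cancel_inner[OF a[OF Y] b[OF Y] ba[OF Y]]
          C.Cmp_cancel_inner[OF b[OF Y] a[OF Y] ab[OF Y]] a[OF Y] b[OF Y] in \<open>auto intro: C.Cmp_Hom\<close>)
    then show "bij_betw (\<lambda>t. \<alpha> Y \<cdot>\<^bsub>C\<^esub> \<phi> X Y t) (Hom D (Lo X) Y) (Hom C X (Ro' Y))"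
      using bij_betw_trans[OF p(1)[OF X Y]] by (auto simp: comp_def)
  next
    fix X X' Y f t assume f: "f \<in> Hom C X' X" and t: "t \<in> Hom D (Lo X) Y"
    show "\<alpha> Y \<cdot>\<^bsub>C\<^esub> \<phi> X' Y (t \<cdot>\<^bsub>D\<^esub> La f) = (\<alpha> Y \<cdot>\<^bsub>C\<^esub> \<phi> X Y t) \<cdot>\<^bsub>C\<^esub> f"
      using p(2)[OF f t] C.Cmp_assoc[OF f pH[OF _ t] a] C.Hom_Ob[OF f] D.Hom_Ob[OF t] by simp
  next
    fix X Y Y' g t assume X: "X \<in> Ob C" and g: "g \<in> Hom D Y Y'" and t: "t \<in> Hom D (Lo X) Y"
    note ob = D.Hom_Ob[OF g]
    note Rg = is_functor_Hom[OF assms(2) R g] and Rg' = is_functor_Hom[OF assms(2) R' g]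
    show "\<alpha> Y' \<cdot>\<^bsub>C\<^esub> \<phi> X Y' (g \<cdot>\<^bsub>D\<^esub> t) = Ra' g \<cdot>\<^bsub>C\<^esub> (\<alpha> Y \<cdot>\<^bsub>C\<^esub> \<phi> X Y t)"
      using p(3)[OF X g t] C.Cmp_assoc[OF pH[OF X t] Rg a[OF ob(2)]] nat[OF g]
        C.Cmp_assoc[OF pH[OF X t] a[OF ob(1)] Rg'] by simp
  qed
qed

text \<open>Fullness and faithfulness of \<open>G\<close> suffice: \<open>Hom (F X, Y) \<cong> Hom (G F X, G Y) \<cong> Hom (X, G Y)\<close>, for any
  choice of the isomorphisms \<open>G F \<cong> 1\<close> and \<open>F G \<cong> 1\<close>.\<close>

lemma hom_adjunction_of_equivalence:
  assumes "category C" "category D" and F: "is_functor C D Fo Fa" and G: "is_functor D C Go Ga"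
    and GF: "nat_iso C C (\<lambda>X. Go (Fo X)) (\<lambda>f. Ga (Fa f)) (\<lambda>X. X) (\<lambda>f. f)"
    and FG: "nat_iso D D (\<lambda>X. Fo (Go X)) (\<lambda>f. Fa (Ga f)) (\<lambda>X. X) (\<lambda>f. f)"
  shows "hom_adjunction C D Fo Fa Go Ga"
proof -
  interpret C: category C by fact
  interpret D: category D by fact
  note GH = is_functor_Hom[OF \<open>category D\<close> G]
  have ff: "fully_faithful D C Go Ga"
    using fully_faithful_of_equivalence[OF assms(2,1) G F FG GF] .
  have GFf: "is_functor C C (\<lambda>X. Go (Fo X)) (\<lambda>f. Ga (Fa f))"
    using is_functor_compose[OF assms(1,2) F G] .
  have Idf: "is_functor C C (\<lambda>X. X) (\<lambda>f. f)" unfolding is_functor_def by simp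
  obtain \<alpha> \<beta> where
    "inverse_transformations C C (\<lambda>X. Go (Fo X)) (\<lambda>f. Ga (Fa f)) (\<lambda>X. X) (\<lambda>f. f) \<alpha> \<beta>"
    using nat_isoE[OF GF \<open>category C\<close> \<open>category C\<close> GFf Idf] by blast
  note a = inverse_transformationsD(1)[OF this] and b = inverse_transformationsD(2)[OF this]
    and ba = inverse_transformationsD(3)[OF this] and ab = inverse_transformationsD(4)[OF this]
    and nat = inverse_transformationsD(5)[OF this] and nat' = inverse_transformationsD(6)[OF this]
  show ?thesis
  proof (rule hom_adjunctionI[where \<phi>="\<lambda>X Y t. Ga t \<cdot>\<^bsub>C\<^esub> \<beta> X"])
    fix X Y assume X: "X \<in> Ob C" and Y: "Y \<in> Ob D"
    have "bij_betw (\<lambda>s. s \<cdot>\<^bsub>C\<^esub> \<beta> X) (Hom C (Go (Fo X)) (Go Y)) (Hom C X (Go Y))"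
    proof (rule bij_betw_byWitness[where f'="\<lambda>s. s \<cdot>\<^bsub>C\<^esub> \<alpha> X"])
      show "\<forall>s\<in>Hom C (Go (Fo X)) (Go Y). (s \<cdot>\<^bsub>C\<^esub> \<beta> X) \<cdot>\<^bsub>C\<^esub> \<alpha> X = s"
        using C.Cmp_assoc[OF a[OF X] b[OF X]] ba[OF X] C.Cmp_Idn by simp
      show "\<forall>s\<in>Hom C X (Go Y). (s \<cdot>\<^bsub>C\<^esub> \<alpha> X) \<cdot>\<^bsub>C\<^esub> \<beta> X = s"
        using C.Cmp_assoc[OF b[OF X] a[OF X]] ab[OF X] C.Cmp_Idn by simp
    qed (use a[OF X] b[OF X] in \<open>auto intro: C.Cmp_Hom\<close>)
    moreover have "bij_betw Ga (Hom D (Fo X) Y) (Hom C (Go (Fo X)) (Go Y))"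
      using ff is_functor_Ob[OF F X] Y by (simp add: fully_faithful_def)
    ultimately show "bij_betw (\<lambda>t. Ga t \<cdot>\<^bsub>C\<^esub> \<beta> X) (Hom D (Fo X) Y) (Hom C X (Go Y))"
      using bij_betw_trans by (fastforce simp: comp_def)
  next
    fix X X' Y f t assume f: "f \<in> Hom C X' X" and t: "t \<in> Hom D (Fo X) Y"
    note ob = C.Hom_Ob[OF f]
    note Ff = is_functor_Hom[OF assms(1) F f]
    show "Ga (t \<cdot>\<^bsub>D\<^esub> Fa f) \<cdot>\<^bsub>C\<^esub> \<beta> X' = (Ga t \<cdot>\<^bsub>C\<^esub> \<beta> X) \<cdot>\<^bsub>C\<^esub> f"
      using is_functor_Cmp[OF assms(2) G Ff t] nat'[OF f] C.Cmp_assoc[OF b[OF ob(1)] GH[OF Ff] GH[OF t]]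
        C.Cmp_assoc[OF f b[OF ob(2)] GH[OF t]] by simp
  next
    fix X Y Y' g t assume X: "X \<in> Ob C" and g: "g \<in> Hom D Y Y'" and t: "t \<in> Hom D (Fo X) Y"
    show "Ga (g \<cdot>\<^bsub>D\<^esub> t) \<cdot>\<^bsub>C\<^esub> \<beta> X = Ga g \<cdot>\<^bsub>C\<^esub> (Ga t \<cdot>\<^bsub>C\<^esub> \<beta> X)"
      using is_functor_Cmp[OF assms(2) G t g] C.Cmp_assoc[OF b[OF X] GH[OF t] GH[OF g]] by simp
  qed
qed

text \<open>Such a \<open>\<theta>\<close> comes from an adjunction \<open>L\<close>, \<open>F\<close> with \<open>L F \<cong> T\<close>. Let \<open>\<epsilon>\<close> correspond to the
  identities under \<open>\<theta>\<close>, so that \<open>F h = \<theta> (h \<epsilon>)\<close>; the functor \<open>F\<close> is fully faithful as soon as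
  \<open>\<epsilon> : T \<rightarrow> 1\<close> is invertible. The comultiplication of the comonad \<open>T\<close> is the image under the full
  functor \<open>T\<close> of a section \<open>d\<close> of \<open>\<epsilon>\<close>, and the idempotent \<open>d \<epsilon>\<close> is the image under \<open>T\<close> of some
  endomorphism \<open>x\<close>. Naturality of \<open>\<epsilon>\<close> gives \<open>x = \<epsilon> (T x) d = \<epsilon> d \<epsilon> d = 1\<close>, whence \<open>d \<epsilon> = 1\<close>.\<close>

lemma fully_faithful_of_twisted_bijection:
  assumes "category C" "category D" and F: "is_functor C D Fo Fa" and T: "fully_faithful C C To Ta"
    and bij: "\<And>X Y. X \<in> Ob C \<Longrightarrow> Y \<in> Ob C \<Longrightarrow>
      bij_betw (\<theta> X Y) (Hom C (To X) Y) (Hom D (Fo X) (Fo Y))"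
    and nat1: "\<And>X X' Y f t. f \<in> Hom C X' X \<Longrightarrow> t \<in> Hom C (To X) Y \<Longrightarrow>
      \<theta> X' Y (t \<cdot>\<^bsub>C\<^esub> Ta f) = \<theta> X Y t \<cdot>\<^bsub>D\<^esub> Fa f"
    and nat2: "\<And>X Y Y' g t. X \<in> Ob C \<Longrightarrow> g \<in> Hom C Y Y' \<Longrightarrow> t \<in> Hom C (To X) Y \<Longrightarrow>
      \<theta> X Y' (g \<cdot>\<^bsub>C\<^esub> t) = Fa g \<cdot>\<^bsub>D\<^esub> \<theta> X Y t"
  shows "fully_faithful C D Fo Fa"
proof -
  interpret C: category C by fact
  interpret D: category D by fact
  note FO = is_functor_Ob[OF F] and FH = is_functor_Hom[OF \<open>category C\<close> F]
    and FC = is_functor_Cmp[OF \<open>category C\<close> F] and FI = is_functor_Idn[OF F]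
  have Tf: "is_functor C C To Ta" and Tbij: "\<And>X Y. X \<in> Ob C \<Longrightarrow> Y \<in> Ob C \<Longrightarrow>
      bij_betw Ta (Hom C X Y) (Hom C (To X) (To Y))"
    using T by (auto simp: fully_faithful_def)
  note TO = is_functor_Ob[OF Tf] and TH = is_functor_Hom[OF \<open>category C\<close> Tf]
    and TC = is_functor_Cmp[OF \<open>category C\<close> Tf] and TI = is_functor_Idn[OF Tf]
  have inj: "s = t" if "s \<in> Hom C (To X) Y" "t \<in> Hom C (To X) Y" "\<theta> X Y s = \<theta> X Y t" "X \<in> Ob C"
    for s t X Y
    using bij[of X Y] that C.Hom_Ob(2)[of s] by (metis bij_betw_inv_into_left)
  have Tinj: "s = t" if "s \<in> Hom C X Y" "t \<in> Hom C X Y" "Ta s = Ta t" for s t X Y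
    using Tbij[of X Y] that C.Hom_Ob[of s] by (metis bij_betw_inv_into_left)
  have surj: "\<exists>t \<in> Hom C (To X) Y. \<theta> X Y t = s" if "s \<in> Hom D (Fo X) (Fo Y)" "X \<in> Ob C" "Y \<in> Ob C"
    for s X Y using bij[of X Y] that unfolding bij_betw_def by (metis (no_types, lifting) imageE)
  have Tsurj: "\<exists>t \<in> Hom C X Y. Ta t = s" if "s \<in> Hom C (To X) (To Y)" "X \<in> Ob C" "Y \<in> Ob C"
    for s X Y using Tbij[of X Y] that unfolding bij_betw_def by (metis (no_types, lifting) imageE)
  define c where "c X = \<theta> X (To X) (Idn C (To X))" for X
  have c: "c X \<in> Hom D (Fo X) (Fo (To X))" if "X \<in> Ob C" for X
    unfolding c_def using bij[OF that TO[OF that]] C.Idn_Hom TO[OF that] bij_betwE by metis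
  have th: "\<theta> X Y t = Fa t \<cdot>\<^bsub>D\<^esub> c X" if "X \<in> Ob C" "t \<in> Hom C (To X) Y" for X Y t
    using nat2[OF that(1,2) C.Idn_Hom] C.Cmp_Idn[OF that(2)] TO[OF that(1)] by (simp add: c_def)
  have c_nat: "c Y \<cdot>\<^bsub>D\<^esub> Fa h = Fa (Ta h) \<cdot>\<^bsub>D\<^esub> c X" if h: "h \<in> Hom C X Y" for X Y h
  proof -
    note ob = C.Hom_Ob[OF h]
    have "c Y \<cdot>\<^bsub>D\<^esub> Fa h = \<theta> X (To Y) (Idn C (To Y) \<cdot>\<^bsub>C\<^esub> Ta h)"
      unfolding c_def using nat1[OF h C.Idn_Hom[OF TO[OF ob(2)]]] by simp
    also have "\<dots> = \<theta> X (To Y) (Ta h)" using C.Idn_Cmp[OF TH[OF h]] by simp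
    finally show ?thesis using th[OF ob(1) TH[OF h]] by simp
  qed
  have "\<forall>X. X \<in> Ob C \<longrightarrow> (\<exists>e. e \<in> Hom C (To X) X \<and> \<theta> X X e = Idn D (Fo X))"
    using surj FO D.Idn_Hom by metis
  then obtain \<epsilon> where e: "\<And>X. X \<in> Ob C \<Longrightarrow> \<epsilon> X \<in> Hom C (To X) X"
    and th_e: "\<And>X. X \<in> Ob C \<Longrightarrow> \<theta> X X (\<epsilon> X) = Idn D (Fo X)" by metis
  have F_th: "Fa h = \<theta> X Y (h \<cdot>\<^bsub>C\<^esub> \<epsilon> X)" if h: "h \<in> Hom C X Y" for X Y h
    using nat2[OF _ h e] th_e C.Hom_Ob[OF h] D.Cmp_Idn[OF FH[OF h]] by simp
  have e_nat: "\<epsilon> Y \<cdot>\<^bsub>C\<^esub> Ta h = h \<cdot>\<^bsub>C\<^esub> \<epsilon> X" if h: "h \<in> Hom C X Y" for X Y h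
  proof -
    note ob = C.Hom_Ob[OF h]
    have "\<theta> X Y (\<epsilon> Y \<cdot>\<^bsub>C\<^esub> Ta h) = Fa h"
      using nat1[OF h e] th_e ob D.Idn_Cmp[OF FH[OF h]] by simp
    then have "\<theta> X Y (\<epsilon> Y \<cdot>\<^bsub>C\<^esub> Ta h) = \<theta> X Y (h \<cdot>\<^bsub>C\<^esub> \<epsilon> X)" using F_th[OF h] by simp
    then show ?thesis
      using inj C.Cmp_Hom[OF TH[OF h] e] C.Cmp_Hom[OF e h] ob by blast
  qed
  have inv: "\<exists>d \<in> Hom C X (To X). \<epsilon> X \<cdot>\<^bsub>C\<^esub> d = Idn C X \<and> d \<cdot>\<^bsub>C\<^esub> \<epsilon> X = Idn C (To X)"
    if X: "X \<in> Ob C" for X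
  proof -
    note TX = TO[OF X] and TTX = TO[OF TO[OF X]]
    obtain \<delta> where \<delta>: "\<delta> \<in> Hom C (To X) (To (To X))" "\<theta> X (To (To X)) \<delta> = c (To X) \<cdot>\<^bsub>D\<^esub> c X"
      using surj[OF D.Cmp_Hom[OF c[OF X] c[OF TX]] X TTX] by blast
    have Te: "Ta (\<epsilon> X) \<in> Hom C (To (To X)) (To X)" using TH[OF e[OF X]] .
    have "\<theta> X (To X) (Ta (\<epsilon> X) \<cdot>\<^bsub>C\<^esub> \<delta>) = Fa (Ta (\<epsilon> X)) \<cdot>\<^bsub>D\<^esub> (c (To X) \<cdot>\<^bsub>D\<^esub> c X)"
      using nat2[OF X Te \<delta>(1)] \<delta>(2) by simp
    also have "\<dots> = (Fa (Ta (\<epsilon> X)) \<cdot>\<^bsub>D\<^esub> c (To X)) \<cdot>\<^bsub>D\<^esub> c X"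
      using D.Cmp_assoc[OF c[OF X] c[OF TX] FH[OF Te]] by simp
    also have "\<dots> = (c X \<cdot>\<^bsub>D\<^esub> Fa (\<epsilon> X)) \<cdot>\<^bsub>D\<^esub> c X" using c_nat[OF e[OF X]] by simp
    also have "\<dots> = c X \<cdot>\<^bsub>D\<^esub> (Fa (\<epsilon> X) \<cdot>\<^bsub>D\<^esub> c X)"
      using D.Cmp_assoc[OF c[OF X] FH[OF e[OF X]] c[OF X]] .
    also have "\<dots> = c X" using th[OF X e[OF X]] th_e[OF X] D.Cmp_Idn[OF c[OF X]] by simp
    finally have "\<theta> X (To X) (Ta (\<epsilon> X) \<cdot>\<^bsub>C\<^esub> \<delta>) = \<theta> X (To X) (Idn C (To X))"
      by (simp add: c_def)
    then have Ted: "Ta (\<epsilon> X) \<cdot>\<^bsub>C\<^esub> \<delta> = Idn C (To X)"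
      using inj C.Cmp_Hom[OF \<delta>(1) Te] C.Idn_Hom[OF TX] X by blast
    obtain d where d: "d \<in> Hom C X (To X)" "Ta d = \<delta>" using Tsurj[OF \<delta>(1) X TX] by blast
    have ed: "\<epsilon> X \<cdot>\<^bsub>C\<^esub> d = Idn C X"
      using Tinj[OF C.Cmp_Hom[OF d(1) e[OF X]] C.Idn_Hom[OF X]] TC[OF d(1) e[OF X]] TI[OF X] d(2) Ted
      by simp
    obtain x where x: "x \<in> Hom C X X" "Ta x = d \<cdot>\<^bsub>C\<^esub> \<epsilon> X"
      using Tsurj[OF C.Cmp_Hom[OF e[OF X] d(1)] X X] by blast
    have "x = x \<cdot>\<^bsub>C\<^esub> (\<epsilon> X \<cdot>\<^bsub>C\<^esub> d)" using ed C.Cmp_Idn[OF x(1)] by simp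
    also have "\<dots> = (\<epsilon> X \<cdot>\<^bsub>C\<^esub> Ta x) \<cdot>\<^bsub>C\<^esub> d"
      using C.Cmp_assoc[OF d(1) e[OF X] x(1)] e_nat[OF x(1)] by simp
    also have "\<dots> = (\<epsilon> X \<cdot>\<^bsub>C\<^esub> (d \<cdot>\<^bsub>C\<^esub> \<epsilon> X)) \<cdot>\<^bsub>C\<^esub> d" using x(2) by simp
    also have "\<epsilon> X \<cdot>\<^bsub>C\<^esub> (d \<cdot>\<^bsub>C\<^esub> \<epsilon> X) = \<epsilon> X"
      using C.Cmp_cancel_inner[OF d(1) e[OF X] ed e[OF X]] .
    finally have "x = Idn C X" using ed by simp
    then show ?thesis using d(1) ed x(2) TI[OF X] by auto
  qed
  have "bij_betw Fa (Hom C X Y) (Hom D (Fo X) (Fo Y))" if X: "X \<in> Ob C" and Y: "Y \<in> Ob C" for X Y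
  proof -
    obtain d where d: "d \<in> Hom C X (To X)" "\<epsilon> X \<cdot>\<^bsub>C\<^esub> d = Idn C X" "d \<cdot>\<^bsub>C\<^esub> \<epsilon> X = Idn C (To X)"
      using inv[OF X] by blast
    have "bij_betw (\<lambda>h. h \<cdot>\<^bsub>C\<^esub> \<epsilon> X) (Hom C X Y) (Hom C (To X) Y)"
    proof (rule bij_betw_byWitness[where f'="\<lambda>h. h \<cdot>\<^bsub>C\<^esub> d"])
      show "\<forall>h\<in>Hom C X Y. (h \<cdot>\<^bsub>C\<^esub> \<epsilon> X) \<cdot>\<^bsub>C\<^esub> d = h"
        using C.Cmp_assoc[OF d(1) e[OF X]] d(2) C.Cmp_Idn by simp
      show "\<forall>h\<in>Hom C (To X) Y. (h \<cdot>\<^bsub>C\<^esub> d) \<cdot>\<^bsub>C\<^esub> \<epsilon> X = h"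
        using C.Cmp_assoc[OF e[OF X] d(1)] d(3) C.Cmp_Idn by simp
    qed (use d(1) e[OF X] in \<open>auto intro: C.Cmp_Hom\<close>)
    from bij_betw_trans[OF this bij[OF X Y]]
    have "bij_betw (\<lambda>h. \<theta> X Y (h \<cdot>\<^bsub>C\<^esub> \<epsilon> X)) (Hom C X Y) (Hom D (Fo X) (Fo Y))"
      by (simp add: comp_def)
    then show ?thesis using F_th by (simp cong: bij_betw_cong)
  qed
  then show ?thesis using F by (simp add: fully_faithful_def)
qed

lemma fully_faithful_of_left_adjoint:
  assumes "category C" "category D" and F: "is_functor C D Fo Fa" and L: "is_functor D C Lo La"
    and adj: "hom_adjunction D C Lo La Fo Fa" and T: "fully_faithful C C To Ta"
    and iso: "nat_iso C C (\<lambda>X. Lo (Fo X)) (\<lambda>f. La (Fa f)) To Ta"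
  shows "fully_faithful C D Fo Fa"
proof -
  interpret C: category C by fact
  interpret D: category D by fact
  have Tf: "is_functor C C To Ta" using T by (simp add: fully_faithful_def)
  have LF: "is_functor C C (\<lambda>X. Lo (Fo X)) (\<lambda>f. La (Fa f))"
    using is_functor_compose[OF assms(1,2) F L] .
  from adj obtain \<phi> where "adjunction_bijection D C Lo La Fo Fa \<phi>"
    unfolding hom_adjunction_def by blast
  note p = adjunction_bijectionD[OF this]
  obtain \<alpha> \<beta> where
    "inverse_transformations C C (\<lambda>X. Lo (Fo X)) (\<lambda>f. La (Fa f)) To Ta \<alpha> \<beta>"
    using nat_isoE[OF iso assms(1,1) LF Tf] by blast
  note a = inverse_transformationsD(1)[OF this] and b = inverse_transformationsD(2)[OF this]
    and ba = inverse_transformationsD(3)[OF this] and ab = inverse_transformationsD(4)[OF this]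
    and nat = inverse_transformationsD(5)[OF this] and nat' = inverse_transformationsD(6)[OF this]
  note FH = is_functor_Hom[OF \<open>category C\<close> F] and FO = is_functor_Ob[OF F]
  show ?thesis
  proof (rule fully_faithful_of_twisted_bijection[OF assms(1,2) F T,
        where \<theta>="\<lambda>X Y t. \<phi> (Fo X) Y (t \<cdot>\<^bsub>C\<^esub> \<alpha> X)"])
    fix X Y assume X: "X \<in> Ob C" and Y: "Y \<in> Ob C"
    have "bij_betw (\<lambda>h. h \<cdot>\<^bsub>C\<^esub> \<alpha> X) (Hom C (To X) Y) (Hom C (Lo (Fo X)) Y)"
    proof (rule bij_betw_byWitness[where f'="\<lambda>h. h \<cdot>\<^bsub>C\<^esub> \<beta> X"])
      show "\<forall>h\<in>Hom C (To X) Y. (h \<cdot>\<^bsub>C\<^esub> \<alpha> X) \<cdot>\<^bsub>C\<^esub> \<beta> X = h"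
        using C.Cmp_assoc[OF b[OF X] a[OF X]] ab[OF X] C.Cmp_Idn by simp
      show "\<forall>h\<in>Hom C (Lo (Fo X)) Y. (h \<cdot>\<^bsub>C\<^esub> \<beta> X) \<cdot>\<^bsub>C\<^esub> \<alpha> X = h"
        using C.Cmp_assoc[OF a[OF X] b[OF X]] ba[OF X] C.Cmp_Idn by simp
    qed (use a[OF X] b[OF X] in \<open>auto intro: C.Cmp_Hom\<close>)
    from bij_betw_trans[OF this p(1)[OF FO[OF X] Y]]
    show "bij_betw (\<lambda>t. \<phi> (Fo X) Y (t \<cdot>\<^bsub>C\<^esub> \<alpha> X)) (Hom C (To X) Y) (Hom D (Fo X) (Fo Y))"
      by (simp add: comp_def)
  next
    fix X X' Y f t assume f: "f \<in> Hom C X' X" and t: "t \<in> Hom C (To X) Y"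
    note ob = C.Hom_Ob[OF f]
    note Tff = is_functor_Hom[OF assms(1) Tf f] and LFf = is_functor_Hom[OF assms(1) LF f]
    have "(t \<cdot>\<^bsub>C\<^esub> Ta f) \<cdot>\<^bsub>C\<^esub> \<alpha> X' = (t \<cdot>\<^bsub>C\<^esub> \<alpha> X) \<cdot>\<^bsub>C\<^esub> La (Fa f)"
      using C.Cmp_assoc[OF a[OF ob(1)] Tff t] C.Cmp_assoc[OF LFf a[OF ob(2)] t] nat[OF f] by simp
    then show "\<phi> (Fo X') Y ((t \<cdot>\<^bsub>C\<^esub> Ta f) \<cdot>\<^bsub>C\<^esub> \<alpha> X') = \<phi> (Fo X) Y (t \<cdot>\<^bsub>C\<^esub> \<alpha> X) \<cdot>\<^bsub>D\<^esub> Fa f"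
      using p(2)[OF FH[OF f] C.Cmp_Hom[OF a[OF ob(2)] t]] by simp
  next
    fix X Y Y' g t assume X: "X \<in> Ob C" and g: "g \<in> Hom C Y Y'" and t: "t \<in> Hom C (To X) Y"
    show "\<phi> (Fo X) Y' ((g \<cdot>\<^bsub>C\<^esub> t) \<cdot>\<^bsub>C\<^esub> \<alpha> X) = Fa g \<cdot>\<^bsub>D\<^esub> \<phi> (Fo X) Y (t \<cdot>\<^bsub>C\<^esub> \<alpha> X)"
      using p(3)[OF FO[OF X] g C.Cmp_Hom[OF a[OF X] t]] C.Cmp_assoc[OF a[OF X] t g] by simp
  qed
qed

section \<open>Triangulated categories\<close>

context preadditive_category
begin

lemma Zer_Hom: "X \<in> Ob C \<Longrightarrow> Y \<in> Ob C \<Longrightarrow> Zer C X Y \<in> Hom C X Y"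
  using comm_group.axioms(2)[OF hom_comm_group] group.is_monoid monoid.one_closed
  by (fastforce simp: hom_group_def)

lemma Zer_unique:
  assumes "f \<in> Hom C X Y" "Add C f f = f"
  shows "f = Zer C X Y"
proof -
  interpret G: comm_group "hom_group C X Y" using hom_comm_group Hom_Ob[OF assms(1)] .
  show ?thesis using G.l_cancel_one[of f f] assms by (simp add: hom_group_def)
qed

lemma Add_Zer: "X \<in> Ob C \<Longrightarrow> Y \<in> Ob C \<Longrightarrow> Add C (Zer C X Y) (Zer C X Y) = Zer C X Y"
proof -
  assume ob: "X \<in> Ob C" "Y \<in> Ob C"
  interpret G: comm_group "hom_group C X Y" using hom_comm_group ob .
  show ?thesis using G.l_one[OF G.one_closed] by (simp add: hom_group_def)
qed

lemma Cmp_Zer: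
  assumes g: "g \<in> Hom C Y Z" and X: "X \<in> Ob C"
  shows "g \<cdot> Zer C X Y = Zer C X Z"
proof (rule Zer_unique)
  note Y = Hom_Ob(1)[OF g]
  show "g \<cdot> Zer C X Y \<in> Hom C X Z" using Cmp_Hom[OF Zer_Hom[OF X Y] g] .
  show "Add C (g \<cdot> Zer C X Y) (g \<cdot> Zer C X Y) = g \<cdot> Zer C X Y"
    using Add_Cmp[OF Zer_Hom[OF X Y] Zer_Hom[OF X Y] g] Add_Zer[OF X Y] by simp
qed

lemma Zer_Cmp:
  assumes f: "f \<in> Hom C X Y" and Z: "Z \<in> Ob C"
  shows "Zer C Y Z \<cdot> f = Zer C X Z"
proof (rule Zer_unique)
  note Y = Hom_Ob(2)[OF f]
  show "Zer C Y Z \<cdot> f \<in> Hom C X Z" using Cmp_Hom[OF f Zer_Hom[OF Y Z]] .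
  show "Add C (Zer C Y Z \<cdot> f) (Zer C Y Z \<cdot> f) = Zer C Y Z \<cdot> f"
    using Cmp_Add[OF f Zer_Hom[OF Y Z] Zer_Hom[OF Y Z]] Add_Zer[OF Y Z] by simp
qed

lemma zero_object_Ob: "zero_object C Z \<Longrightarrow> Z \<in> Ob C"
  by (simp add: zero_object_def)

lemma Hom_zero_object:
  assumes "zero_object C Z"
  shows "f \<in> Hom C X Z \<Longrightarrow> f = Zer C X Z" "f \<in> Hom C Z X \<Longrightarrow> f = Zer C Z X"
proof -
  show "f = Zer C X Z" if "f \<in> Hom C X Z"
    using that assms Zer_Hom Hom_Ob[OF that] unfolding zero_object_def by blast
  show "f = Zer C Z X" if "f \<in> Hom C Z X"
    using that assms Zer_Hom Hom_Ob[OF that] unfolding zero_object_def by blast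
qed

lemma zero_object_iff: "zero_object C Z \<longleftrightarrow> Z \<in> Ob C \<and> Idn C Z = Zer C Z Z"
proof
  assume "zero_object C Z"
  then show "Z \<in> Ob C \<and> Idn C Z = Zer C Z Z"
    using Hom_zero_object Idn_Hom zero_object_Ob by blast
next
  assume Z: "Z \<in> Ob C \<and> Idn C Z = Zer C Z Z"
  have "f = Zer C X Z" if f: "f \<in> Hom C X Z" for f X
    using Idn_Cmp[OF f] Zer_Cmp[OF f] Z by simp
  moreover have "f = Zer C Z X" if f: "f \<in> Hom C Z X" for f X
    using Cmp_Idn[OF f] Cmp_Zer[OF f] Z by simp
  ultimately show "zero_object C Z"
    unfolding zero_object_def using Zer_Hom Z by (metis (no_types))
qed

lemma zero_object_isomorphic:
  assumes "zero_object C X" "isomorphic C X Y"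
  shows "zero_object C Y"
proof -
  obtain f g where fg: "f \<in> Hom C X Y" "g \<in> Hom C Y X" "f \<cdot> g = Idn C Y"
    using isomorphicE[OF assms(2)] by metis
  then have "Idn C Y = Zer C Y Y"
    using Hom_zero_object(2)[OF assms(1) fg(1)] Zer_Cmp[OF fg(2)] Hom_Ob[OF fg(1)] by simp
  then show ?thesis using zero_object_iff Hom_Ob[OF fg(1)] by simp
qed

lemma isomorphic_zero_objects:
  assumes "zero_object C X" "zero_object C Y"
  shows "isomorphic C X Y"
proof (rule isomorphicI)
  note ob = zero_object_Ob[OF assms(1)] zero_object_Ob[OF assms(2)]
  show "Zer C X Y \<in> Hom C X Y" "Zer C Y X \<in> Hom C Y X" using Zer_Hom ob by auto
  show "Zer C Y X \<cdot> Zer C X Y = Idn C X" "Zer C X Y \<cdot> Zer C Y X = Idn C Y"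
    using Cmp_Zer[OF Zer_Hom] ob assms by (simp_all add: zero_object_iff)
qed

lemma Neg_Hom: "f \<in> Hom C X Y \<Longrightarrow> Neg C f \<in> Hom C X Y"
  and Add_Neg: "f \<in> Hom C X Y \<Longrightarrow> Add C f (Neg C f) = Zer C X Y"
  and Neg_Neg: "f \<in> Hom C X Y \<Longrightarrow> Neg C (Neg C f) = f"
proof -
  assume f: "f \<in> Hom C X Y"
  interpret G: comm_group "hom_group C X Y" using hom_comm_group Hom_Ob[OF f] .
  have st: "Neg C g = inv\<^bsub>hom_group C X Y\<^esub> g" if "g \<in> Hom C X Y" for g
    using that by (simp add: Neg_def Hom_def)
  have c: "f \<in> carrier (hom_group C X Y)" using f by (simp add: hom_group_def)
  show n: "Neg C f \<in> Hom C X Y" using G.inv_closed[OF c] st[OF f] by (simp add: hom_group_def)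
  show "Add C f (Neg C f) = Zer C X Y" using G.r_inv[OF c] st[OF f] by (simp add: hom_group_def)
  show "Neg C (Neg C f) = f" using G.inv_inv[OF c] st[OF f] st[OF n] by simp
qed

lemma Neg_unique:
  assumes "f \<in> Hom C X Y" "g \<in> Hom C X Y" "Add C f g = Zer C X Y"
  shows "g = Neg C f"
proof -
  interpret G: comm_group "hom_group C X Y" using hom_comm_group Hom_Ob[OF assms(1)] .
  have "g = inv\<^bsub>hom_group C X Y\<^esub> f"
    using G.inv_equality[of g f] G.m_comm[of g f] assms by (simp add: hom_group_def)
  then show ?thesis using assms(1) by (simp add: Neg_def Hom_def)
qed

lemma Neg_Zer: "X \<in> Ob C \<Longrightarrow> Y \<in> Ob C \<Longrightarrow> Neg C (Zer C X Y) = Zer C X Y"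
  using Neg_unique[OF Zer_Hom Zer_Hom Add_Zer, of X Y] by simp

lemma Cmp_Neg:
  assumes f: "f \<in> Hom C X Y" and g: "g \<in> Hom C Y Z"
  shows "g \<cdot> Neg C f = Neg C (g \<cdot> f)"
proof (rule Neg_unique[OF Cmp_Hom[OF f g] Cmp_Hom[OF Neg_Hom[OF f] g]])
  show "Add C (g \<cdot> f) (g \<cdot> Neg C f) = Zer C X Z"
    using Add_Cmp[OF f Neg_Hom[OF f] g] Add_Neg[OF f] Cmp_Zer[OF g] Hom_Ob[OF f] by simp
qed

lemma Neg_Cmp:
  assumes f: "f \<in> Hom C X Y" and g: "g \<in> Hom C Y Z"
  shows "Neg C g \<cdot> f = Neg C (g \<cdot> f)"
proof (rule Neg_unique[OF Cmp_Hom[OF f g] Cmp_Hom[OF f Neg_Hom[OF g]]])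
  show "Add C (g \<cdot> f) (Neg C g \<cdot> f) = Zer C X Z"
    using Cmp_Add[OF f g Neg_Hom[OF g]] Add_Neg[OF g] Zer_Cmp[OF f] Hom_Ob[OF g] by simp
qed

lemma orthogonalI:
  assumes "X \<in> Ob C" "Y \<in> Ob C" "\<And>f. f \<in> Hom C X Y \<Longrightarrow> f = Zer C X Y"
  shows "Hom C X Y = {Zer C X Y}"
  using assms Zer_Hom by blast

lemma orthogonal_isomorphic_left:
  assumes "Hom C X Y = {Zer C X Y}" "isomorphic C X X'"
  shows "Hom C X' Y = {Zer C X' Y}"
proof -
  obtain f g where fg: "f \<in> Hom C X X'" "g \<in> Hom C X' X" "f \<cdot> g = Idn C X'"
    using isomorphicE[OF assms(2)] by metis
  have Y: "Y \<in> Ob C" using assms(1) Hom_Ob(2)[of "Zer C X Y" X Y] by simp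
  show ?thesis
  proof (rule orthogonalI)
    fix t assume t: "t \<in> Hom C X' Y"
    have "t \<cdot> f = Zer C X Y" using assms(1) Cmp_Hom[OF fg(1) t] by simp
    then have "t \<cdot> (f \<cdot> g) = Zer C X Y \<cdot> g" using Cmp_assoc[OF fg(2,1) t] by simp
    then show "t = Zer C X' Y" using fg(3) Cmp_Idn[OF t] Zer_Cmp[OF fg(2) Y] by simp
  qed (use Hom_Ob[OF fg(1)] Y in auto)
qed

lemma orthogonal_isomorphic_right:
  assumes "Hom C X Y = {Zer C X Y}" "isomorphic C Y Y'"
  shows "Hom C X Y' = {Zer C X Y'}"
proof -
  obtain f g where fg: "f \<in> Hom C Y Y'" "g \<in> Hom C Y' Y" "f \<cdot> g = Idn C Y'"
    using isomorphicE[OF assms(2)] by metis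
  have X: "X \<in> Ob C" using assms(1) Hom_Ob(1)[of "Zer C X Y" X Y] by simp
  show ?thesis
  proof (rule orthogonalI)
    fix t assume t: "t \<in> Hom C X Y'"
    have "g \<cdot> t = Zer C X Y" using assms(1) Cmp_Hom[OF t fg(2)] by simp
    then have "(f \<cdot> g) \<cdot> t = f \<cdot> Zer C X Y" using Cmp_assoc[OF t fg(2,1)] by simp
    then show "t = Zer C X Y'" using fg(3) Idn_Cmp[OF t] Cmp_Zer[OF fg(1) X] by simp
  qed (use Hom_Ob[OF fg(1)] X in auto)
qed

lemma orthogonal_summand_left:
  assumes "biproduct C X Y Z" "X \<in> Ob C" "Hom C Z W = {Zer C Z W}"
  shows "Hom C X W = {Zer C X W}"
proof -
  obtain i p where ip: "i \<in> Hom C X Z" "p \<in> Hom C Z X" "p \<cdot> i = Idn C X"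
    using assms(1) unfolding biproduct_def by blast
  have W: "W \<in> Ob C" using assms(3) Hom_Ob(2)[of "Zer C Z W" Z W] by simp
  show ?thesis
  proof (rule orthogonalI)
    fix t assume t: "t \<in> Hom C X W"
    have "t \<cdot> p = Zer C Z W" using assms(3) Cmp_Hom[OF ip(2) t] by simp
    then have "t \<cdot> (p \<cdot> i) = Zer C Z W \<cdot> i" using Cmp_assoc[OF ip(1,2) t] by simp
    then show "t = Zer C X W" using ip(3) Cmp_Idn[OF t] Zer_Cmp[OF ip(1) W] by simp
  qed (use assms W in auto)
qed

lemma orthogonal_summand_right:
  assumes "biproduct C X Y Z" "X \<in> Ob C" "Hom C W Z = {Zer C W Z}"
  shows "Hom C W X = {Zer C W X}"
proof -
  obtain i p where ip: "i \<in> Hom C X Z" "p \<in> Hom C Z X" "p \<cdot> i = Idn C X"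
    using assms(1) unfolding biproduct_def by blast
  have W: "W \<in> Ob C" using assms(3) Hom_Ob(1)[of "Zer C W Z" W Z] by simp
  show ?thesis
  proof (rule orthogonalI)
    fix t assume t: "t \<in> Hom C W X"
    have "i \<cdot> t = Zer C W Z" using assms(3) Cmp_Hom[OF t ip(1)] by simp
    then have "(p \<cdot> i) \<cdot> t = p \<cdot> Zer C W Z" using Cmp_assoc[OF t ip(1,2)] by simp
    then show "t = Zer C W X" using ip(3) Idn_Cmp[OF t] Cmp_Zer[OF ip(2) W] by simp
  qed (use assms W in auto)
qed

lemma zero_object_orthogonal:
  assumes "zero_object C Z" "X \<in> Ob C"
  shows "Hom C Z X = {Zer C Z X}" "Hom C X Z = {Zer C X Z}"
  using orthogonalI[OF zero_object_Ob[OF assms(1)] assms(2) Hom_zero_object(2)[OF assms(1)]]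
    orthogonalI[OF assms(2) zero_object_Ob[OF assms(1)] Hom_zero_object(1)[OF assms(1)]] by auto

end

definition dist_triangle ::
  "('o, 'a, 'm) tri_cat_scheme \<Rightarrow> 'o \<Rightarrow> 'o \<Rightarrow> 'o \<Rightarrow> 'a \<Rightarrow> 'a \<Rightarrow> 'a \<Rightarrow> bool" where
  "dist_triangle T X Y Z f g h \<longleftrightarrow> (f, g, h) \<in> Dist T \<and>
     f \<in> Hom T X Y \<and> g \<in> Hom T Y Z \<and> h \<in> Hom T Z (ShO T X)"

lemma exact_triangle_iff: "exact_triangle T X Y Z \<longleftrightarrow> (\<exists>f g h. dist_triangle T X Y Z f g h)"
  by (auto simp: exact_triangle_def dist_triangle_def)

abbreviation unshift :: "('o, 'a, 'm) tri_cat_scheme \<Rightarrow> 'o \<Rightarrow> 'o" where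
  "unshift T \<equiv> inv_into (Ob T) (ShO T)"

context triangulated_category
begin

lemma ShO_Ob: "X \<in> Ob T \<Longrightarrow> ShO T X \<in> Ob T"
  using bij_betwE[OF ShO_bij] by simp

lemma unshift_Ob: "X \<in> Ob T \<Longrightarrow> unshift T X \<in> Ob T"
  and ShO_unshift: "X \<in> Ob T \<Longrightarrow> ShO T (unshift T X) = X"
  and unshift_ShO: "X \<in> Ob T \<Longrightarrow> unshift T (ShO T X) = X"
  using bij_betwE[OF bij_betw_inv_into[OF ShO_bij]] bij_betw_inv_into_right[OF ShO_bij]
    bij_betw_inv_into_left[OF ShO_bij] by blast+

lemma ShA_Hom: "f \<in> Hom T X Y \<Longrightarrow> ShA T f \<in> Hom T (ShO T X) (ShO T Y)"
  using bij_betwE[OF ShA_bij[OF Hom_Ob]] by simp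

lemma ShA_full:
  assumes "g \<in> Hom T (ShO T X) (ShO T Y)" "X \<in> Ob T" "Y \<in> Ob T"
  obtains f where "f \<in> Hom T X Y" "ShA T f = g"
  using ShA_bij[OF assms(2,3)] assms(1) unfolding bij_betw_def by (metis imageE)

lemma ShA_faithful:
  assumes "f \<in> Hom T X Y" "g \<in> Hom T X Y" "ShA T f = ShA T g"
  shows "f = g"
  using ShA_bij[OF Hom_Ob[OF assms(1)]] assms unfolding bij_betw_def by (meson inj_onD)

lemma ShA_Zer:
  assumes "X \<in> Ob T" "Y \<in> Ob T"
  shows "ShA T (Zer T X Y) = Zer T (ShO T X) (ShO T Y)"
  using Zer_unique[OF ShA_Hom[OF Zer_Hom[OF assms]]] ShA_Add[OF Zer_Hom[OF assms] Zer_Hom[OF assms]]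
    Add_Zer[OF assms] by simp

lemma ShO_isomorphic:
  assumes "isomorphic T X Y"
  shows "isomorphic T (ShO T X) (ShO T Y)"
proof -
  obtain f g where fg: "f \<in> Hom T X Y" "g \<in> Hom T Y X" "g \<cdot> f = Idn T X" "f \<cdot> g = Idn T Y"
    using isomorphicE[OF assms] by metis
  show ?thesis
    using ShA_Hom[OF fg(1)] ShA_Hom[OF fg(2)] ShA_Cmp[OF fg(1,2)] ShA_Cmp[OF fg(2,1)] fg(3,4)
      ShA_Idn Hom_Ob[OF fg(1)] by (intro isomorphicI[of "ShA T f" _ _ "ShA T g"]) simp_all
qed

lemma isomorphic_unshift:
  assumes "isomorphic T X Y"
  shows "isomorphic T (unshift T X) (unshift T Y)"
proof -
  note ob = isomorphic_Ob[OF assms]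
  note uob = unshift_Ob[OF ob(1)] unshift_Ob[OF ob(2)]
  obtain f g where fg: "f \<in> Hom T X Y" "g \<in> Hom T Y X" "g \<cdot> f = Idn T X" "f \<cdot> g = Idn T Y"
    using isomorphicE[OF assms] by metis
  have f1: "f \<in> Hom T (ShO T (unshift T X)) (ShO T (unshift T Y))"
    and g1: "g \<in> Hom T (ShO T (unshift T Y)) (ShO T (unshift T X))"
    using fg(1,2) ShO_unshift ob by simp_all
  obtain f' where f': "f' \<in> Hom T (unshift T X) (unshift T Y)" "ShA T f' = f"
    using ShA_full[OF f1 uob] by blast
  obtain g' where g': "g' \<in> Hom T (unshift T Y) (unshift T X)" "ShA T g' = g"
    using ShA_full[OF g1 uob(2,1)] by blast
  show ?thesis
  proof (rule isomorphicI[OF f'(1) g'(1)])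
    show "g' \<cdot> f' = Idn T (unshift T X)"
      using ShA_faithful[OF Cmp_Hom[OF f'(1) g'(1)] Idn_Hom[OF uob(1)]] ShA_Cmp[OF f'(1) g'(1)]
        ShA_Idn[OF uob(1)] f'(2) g'(2) fg(3) ShO_unshift[OF ob(1)] by simp
    show "f' \<cdot> g' = Idn T (unshift T Y)"
      using ShA_faithful[OF Cmp_Hom[OF g'(1) f'(1)] Idn_Hom[OF uob(2)]] ShA_Cmp[OF g'(1) f'(1)]
        ShA_Idn[OF uob(2)] f'(2) g'(2) fg(4) ShO_unshift[OF ob(2)] by simp
  qed
qed

lemma ShO_zero_object: "zero_object T Z \<Longrightarrow> zero_object T (ShO T Z)"
  using ShA_Zer[of Z Z] ShA_Idn[of Z] ShO_Ob[of Z] by (simp add: zero_object_iff)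

lemma zero_object_ShO_iff:
  assumes "X \<in> Ob T"
  shows "zero_object T (ShO T X) \<longleftrightarrow> zero_object T X"
proof
  assume "zero_object T (ShO T X)"
  then have "ShA T (Idn T X) = ShA T (Zer T X X)"
    using ShA_Idn ShA_Zer assms by (simp add: zero_object_iff)
  then show "zero_object T X"
    using ShA_faithful[OF Idn_Hom Zer_Hom] assms by (simp add: zero_object_iff)
qed (rule ShO_zero_object)

lemma shift_in:
  assumes "\<And>X. X \<in> A \<Longrightarrow> ShO T X \<in> A" "\<And>X. X \<in> A \<Longrightarrow> unshift T X \<in> A" "X \<in> A"
  shows "shift T n X \<in> A"
proof -
  have "(ShO T ^^ m) X \<in> A" for m by (induction m) (auto simp: assms)
  moreover have "(unshift T ^^ m) X \<in> A" for m by (induction m) (auto simp: assms)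
  ultimately show ?thesis by (simp add: shift_def)
qed

lemma shift_1: "shift T 1 X = ShO T X"
  by (simp add: shift_def)

lemma shift_minus_1: "shift T (- 1) X = unshift T X"
  by (simp add: shift_def)

lemma triangle_rotate:
  assumes "dist_triangle T X Y Z f g h"
  shows "dist_triangle T Y Z (ShO T X) g h (Neg T (ShA T f))"
proof -
  have f: "f \<in> Hom T X Y" and g: "g \<in> Hom T Y Z" and h: "h \<in> Hom T Z (ShO T X)"
    using assms by (auto simp: dist_triangle_def)
  show ?thesis
    unfolding dist_triangle_def using TR2[OF f g h] g h Neg_Hom[OF ShA_Hom[OF f]] assms
    by (simp add: dist_triangle_def)
qed

lemma triangle_unrotate:
  assumes tri: "dist_triangle T X Y Z f g h"
  obtains h' where "dist_triangle T (unshift T Z) X Y h' f g" "ShA T h' = Neg T h"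
proof -
  have f: "f \<in> Hom T X Y" and g: "g \<in> Hom T Y Z" and h: "h \<in> Hom T Z (ShO T X)"
    using tri by (auto simp: dist_triangle_def)
  note X = Hom_Ob(1)[OF f] and Z = Hom_Ob(1)[OF h]
  have "Neg T h \<in> Hom T (ShO T (unshift T Z)) (ShO T X)"
    using Neg_Hom[OF h] ShO_unshift[OF Z] by simp
  then obtain h' where h': "h' \<in> Hom T (unshift T Z) X" "ShA T h' = Neg T h"
    using ShA_full[OF _ unshift_Ob[OF Z] X] by blast
  have "(h', f, g) \<in> Dist T"
    using TR2[OF h'(1) f] g ShO_unshift[OF Z] h'(2) Neg_Neg[OF h] tri by (simp add: dist_triangle_def)
  then show thesis
    using that h' f g ShO_unshift[OF Z] by (simp add: dist_triangle_def)
qed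

lemma triangle_Cmp_Zer:
  assumes "dist_triangle T X Y Z f g h"
  shows "g \<cdot> f = Zer T X Z"
proof -
  have D: "(f, g, h) \<in> Dist T" and f: "f \<in> Hom T X Y" and g: "g \<in> Hom T Y Z"
    using assms by (auto simp: dist_triangle_def)
  have X: "X \<in> Ob T" using Hom_Ob[OF f] by simp
  obtain Z0 where Z0: "zero_object T Z0" using ex_zero_object by blast
  note OZ0 = zero_object_Ob[OF Z0]
  have src: "Src T (Idn T X) = X" "Tgt T (Idn T X) = X" "Src T f = X" "Tgt T f = Y" "Tgt T g = Z"
    "Tgt T (Zer T X Z0) = Z0"
    using f g Idn_Hom[OF X] Zer_Hom[OF X OZ0] by (auto simp: Hom_def)
  have "\<exists>w \<in> Hom T Z0 Z. w \<cdot> Zer T X Z0 = g \<cdot> f"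
    using TR3[OF TR1_Idn[OF X Z0] D, of "Idn T X" f] src Idn_Hom[OF X] f by metis
  then show ?thesis using Cmp_Zer X by metis
qed

text \<open>Exactness of \<open>Hom (-, W)\<close> at the middle term: \<open>t\<close> and \<open>X \<rightarrow> 0\<close> are the first two components of a
  map to the triangle \<open>0 \<rightarrow> W \<rightarrow> W \<rightarrow> 0\<close>.\<close>

lemma triangle_extend:
  assumes "dist_triangle T X Y Z f g h" "t \<in> Hom T Y W" "t \<cdot> f = Zer T X W"
  obtains t' where "t' \<in> Hom T Z W" "t' \<cdot> g = t"
proof -
  have D: "(f, g, h) \<in> Dist T" and f: "f \<in> Hom T X Y" and g: "g \<in> Hom T Y Z"
    using assms by (auto simp: dist_triangle_def)
  note X = Hom_Ob(1)[OF f] and W = Hom_Ob(2)[OF assms(2)]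
  obtain Z0 where Z0: "zero_object T Z0" using ex_zero_object by blast
  note OZ0 = zero_object_Ob[OF Z0]
  have "(Idn T W, Zer T W (ShO T Z0), Zer T (ShO T Z0) (ShO T W)) \<in> Dist T"
    using TR1_Idn[OF W ShO_zero_object[OF Z0]] .
  moreover have "Neg T (ShA T (Zer T Z0 W)) = Zer T (ShO T Z0) (ShO T W)"
    using ShA_Zer Neg_Zer OZ0 W ShO_Ob by simp
  ultimately have D': "(Zer T Z0 W, Idn T W, Zer T W (ShO T Z0)) \<in> Dist T"
    using TR2[OF Zer_Hom[OF OZ0 W] Idn_Hom[OF W] Zer_Hom[OF W ShO_Ob[OF OZ0]]] by simp
  have src: "Src T f = X" "Tgt T f = Y" "Tgt T g = Z" "Src T (Zer T Z0 W) = Z0"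
      "Tgt T (Zer T Z0 W) = W" "Tgt T (Idn T W) = W"
    using f g Idn_Hom[OF W] Zer_Hom[OF OZ0 W] by (auto simp: Hom_def)
  have "t \<cdot> f = Zer T Z0 W \<cdot> Zer T X Z0" using Cmp_Zer[OF Zer_Hom[OF OZ0 W] X] assms(3) by simp
  then have "\<exists>w \<in> Hom T Z W. w \<cdot> g = Idn T W \<cdot> t"
    using TR3[OF D D', of "Zer T X Z0" t] src Zer_Hom[OF X OZ0] assms(2) by metis
  then show thesis using that Idn_Cmp[OF assms(2)] by metis
qed

text \<open>Exactness of \<open>Hom (W, -)\<close> at the middle term. The map to be found is the first component of a
  map from \<open>W \<rightarrow> W \<rightarrow> 0\<close>, but \<open>TR3\<close> supplies third components; both triangles are rotated once.\<close>

lemma triangle_lift: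
  assumes tri: "dist_triangle T X Y Z f g h" and t: "t \<in> Hom T W Y" and "g \<cdot> t = Zer T W Z"
  obtains t' where "t' \<in> Hom T W X" "f \<cdot> t' = t"
proof -
  have f: "f \<in> Hom T X Y" and g: "g \<in> Hom T Y Z" and h: "h \<in> Hom T Z (ShO T X)"
    using tri by (auto simp: dist_triangle_def)
  note X = Hom_Ob(1)[OF f] and W = Hom_Ob(1)[OF t] and Z = Hom_Ob(1)[OF h]
  obtain Z0 where Z0: "zero_object T Z0" using ex_zero_object by blast
  note OZ0 = zero_object_Ob[OF Z0]
  have W1: "ShO T W \<in> Ob T" using ShO_Ob[OF W] .
  have "dist_triangle T W W Z0 (Idn T W) (Zer T W Z0) (Zer T Z0 (ShO T W))"
    unfolding dist_triangle_def using TR1_Idn[OF W Z0] Idn_Hom[OF W] Zer_Hom OZ0 W W1 by simp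
  then have D: "(Zer T W Z0, Zer T Z0 (ShO T W), Neg T (ShA T (Idn T W))) \<in> Dist T"
    using triangle_rotate unfolding dist_triangle_def by metis
  have D': "(g, h, Neg T (ShA T f)) \<in> Dist T"
    using triangle_rotate[OF tri] by (simp add: dist_triangle_def)
  have src: "Src T g = Y" "Tgt T g = Z" "Src T (Zer T W Z0) = W" "Tgt T (Zer T W Z0) = Z0"
      "Tgt T (Zer T Z0 (ShO T W)) = ShO T W" "Tgt T h = ShO T X"
    using g h Zer_Hom[OF W OZ0] Zer_Hom[OF OZ0 W1] by (auto simp: Hom_def)
  have "Zer T Z0 Z \<cdot> Zer T W Z0 = g \<cdot> t" using Zer_Cmp[OF Zer_Hom[OF W OZ0] Z] assms(3) by simp
  then obtain w where w: "w \<in> Hom T (ShO T W) (ShO T X)"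
      "ShA T t \<cdot> Neg T (ShA T (Idn T W)) = Neg T (ShA T f) \<cdot> w"
    using TR3[OF D D', of t "Zer T Z0 Z"] src Zer_Hom[OF OZ0 Z] t by metis
  obtain t' where t': "t' \<in> Hom T W X" "ShA T t' = w" using ShA_full[OF w(1) W X] by blast
  have "ShA T t \<cdot> Neg T (ShA T (Idn T W)) = Neg T (ShA T t)"
    using Cmp_Neg[OF ShA_Hom[OF Idn_Hom[OF W]] ShA_Hom[OF t]] ShA_Cmp[OF Idn_Hom[OF W] t]
      Cmp_Idn[OF t] by simp
  moreover have "Neg T (ShA T f) \<cdot> w = Neg T (ShA T (f \<cdot> t'))"
    using Neg_Cmp[OF w(1) ShA_Hom[OF f]] ShA_Cmp[OF t'(1) f] t'(2) by simp
  ultimately have "Neg T (Neg T (ShA T t)) = Neg T (Neg T (ShA T (f \<cdot> t')))" using w(2) by simp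
  then have "ShA T t = ShA T (f \<cdot> t')"
    using Neg_Neg[OF ShA_Hom[OF t]] Neg_Neg[OF ShA_Hom[OF Cmp_Hom[OF t'(1) f]]] by simp
  then have "f \<cdot> t' = t" using ShA_faithful[OF t Cmp_Hom[OF t'(1) f]] by simp
  then show thesis using that t' by blast
qed

lemma orthogonal_triangle_left:
  assumes "exact_triangle T X Y Z" and YW: "Hom T Y W = {Zer T Y W}"
    and XW: "Hom T (ShO T X) W = {Zer T (ShO T X) W}"
  shows "Hom T Z W = {Zer T Z W}"
proof -
  obtain f g h where tri: "dist_triangle T X Y Z f g h"
    using assms(1) exact_triangle_iff by metis
  then have g: "g \<in> Hom T Y Z" and h: "h \<in> Hom T Z (ShO T X)"
    by (auto simp: dist_triangle_def)
  have W: "W \<in> Ob T" using YW Hom_Ob(2)[of "Zer T Y W" Y W] by simp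
  show ?thesis
  proof (rule orthogonalI)
    fix t assume t: "t \<in> Hom T Z W"
    have "t \<cdot> g = Zer T Y W" using YW Cmp_Hom[OF g t] by simp
    then obtain t' where "t' \<in> Hom T (ShO T X) W" "t' \<cdot> h = t"
      using triangle_extend[OF triangle_rotate[OF tri] t] by blast
    then show "t = Zer T Z W" using XW Zer_Cmp[OF h W] by auto
  qed (use Hom_Ob[OF g] W in auto)
qed

lemma orthogonal_triangle_right:
  assumes "exact_triangle T X Y Z" and WY: "Hom T W Y = {Zer T W Y}"
    and WX: "Hom T W (ShO T X) = {Zer T W (ShO T X)}"
  shows "Hom T W Z = {Zer T W Z}"
proof -
  obtain f g h where tri: "dist_triangle T X Y Z f g h"
    using assms(1) exact_triangle_iff by metis
  then have g: "g \<in> Hom T Y Z" and h: "h \<in> Hom T Z (ShO T X)"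
    by (auto simp: dist_triangle_def)
  have W: "W \<in> Ob T" using WY Hom_Ob(1)[of "Zer T W Y" W Y] by simp
  show ?thesis
  proof (rule orthogonalI)
    fix t assume t: "t \<in> Hom T W Z"
    have "h \<cdot> t = Zer T W (ShO T X)" using WX Cmp_Hom[OF t h] by simp
    then obtain t' where "t' \<in> Hom T W Y" "g \<cdot> t' = t"
      using triangle_lift[OF triangle_rotate[OF tri] t] by blast
    then show "t = Zer T W Z" using WY Cmp_Zer[OF g W] by auto
  qed (use Hom_Ob[OF g] W in auto)
qed

lemma isomorphic_of_triangle_zero:
  assumes "exact_triangle T X Y Z" "zero_object T X"
  shows "isomorphic T Y Z"
proof -
  obtain f g h where tri: "dist_triangle T X Y Z f g h"
    using assms(1) exact_triangle_iff by metis
  then have f: "f \<in> Hom T X Y" and g: "g \<in> Hom T Y Z" and h: "h \<in> Hom T Z (ShO T X)"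
    by (auto simp: dist_triangle_def)
  note X = Hom_Ob(1)[OF f] and Y = Hom_Ob(2)[OF f] and Z = Hom_Ob(1)[OF h]
  have "Idn T Y \<cdot> f = Zer T X Y" using Idn_Cmp[OF f] Hom_zero_object(2)[OF assms(2) f] by simp
  then obtain l where l: "l \<in> Hom T Z Y" "l \<cdot> g = Idn T Y"
    using triangle_extend[OF tri Idn_Hom[OF Y]] by blast
  have "h \<cdot> Idn T Z = Zer T Z (ShO T X)"
    using Cmp_Idn[OF h] Hom_zero_object(1)[OF ShO_zero_object[OF assms(2)] h] by simp
  then obtain r where r: "r \<in> Hom T Z Y" "g \<cdot> r = Idn T Z"
    using triangle_lift[OF triangle_rotate[OF tri] Idn_Hom[OF Z]] by blast
  have "l = r" using Cmp_assoc[OF r(1) g l(1)] l r Cmp_Idn Idn_Cmp by metis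
  then show ?thesis using isomorphicI[OF g l(1)] l r by simp
qed

subsection \<open>Orthogonal subcategories and spans\<close>

definition left_orthogonal :: "'o set \<Rightarrow> 'o set" where
  "left_orthogonal B = {X \<in> Ob T. \<forall>Y \<in> B. Hom T X Y = {Zer T X Y}}"

lemma orthogonal_ShO_iff:
  assumes X: "X \<in> Ob T" and Y: "Y \<in> Ob T"
  shows "Hom T (ShO T X) (ShO T Y) = {Zer T (ShO T X) (ShO T Y)} \<longleftrightarrow> Hom T X Y = {Zer T X Y}"
proof
  assume *: "Hom T (ShO T X) (ShO T Y) = {Zer T (ShO T X) (ShO T Y)}"
  show "Hom T X Y = {Zer T X Y}"
  proof (rule orthogonalI[OF X Y])
    fix f assume f: "f \<in> Hom T X Y"
    show "f = Zer T X Y"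
      using ShA_faithful[OF f Zer_Hom[OF X Y]] ShA_Hom[OF f] * ShA_Zer[OF X Y] by auto
  qed
next
  assume *: "Hom T X Y = {Zer T X Y}"
  show "Hom T (ShO T X) (ShO T Y) = {Zer T (ShO T X) (ShO T Y)}"
  proof (rule orthogonalI)
    fix g assume g: "g \<in> Hom T (ShO T X) (ShO T Y)"
    obtain f where "f \<in> Hom T X Y" "ShA T f = g" using ShA_full[OF g X Y] by blast
    then show "g = Zer T (ShO T X) (ShO T Y)" using * ShA_Zer[OF X Y] by auto
  qed (use X Y ShO_Ob in auto)
qed

lemma orthogonal_unshift_iff:
  assumes "X \<in> Ob T" "Y \<in> Ob T"
  shows "Hom T X (unshift T Y) = {Zer T X (unshift T Y)} \<longleftrightarrow>
      Hom T (ShO T X) Y = {Zer T (ShO T X) Y}"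
    and "Hom T (unshift T X) Y = {Zer T (unshift T X) Y} \<longleftrightarrow>
      Hom T X (ShO T Y) = {Zer T X (ShO T Y)}"
  using orthogonal_ShO_iff[OF assms(1) unshift_Ob[OF assms(2)]] ShO_unshift[OF assms(2)]
    orthogonal_ShO_iff[OF unshift_Ob[OF assms(1)] assms(2)] ShO_unshift[OF assms(1)] by simp_all

lemma full_triangulated_subcategoryI:
  assumes "A \<subseteq> Ob T" "\<And>Z. zero_object T Z \<Longrightarrow> Z \<in> A"
    and "\<And>X Y. X \<in> A \<Longrightarrow> isomorphic T X Y \<Longrightarrow> Y \<in> A"
    and "\<And>X. X \<in> A \<Longrightarrow> ShO T X \<in> A" "\<And>X. X \<in> A \<Longrightarrow> unshift T X \<in> A"
    and "\<And>X Y Z. X \<in> A \<Longrightarrow> Y \<in> A \<Longrightarrow> Z \<in> Ob T \<Longrightarrow> exact_triangle T X Y Z \<Longrightarrow> Z \<in> A"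
  shows "full_triangulated_subcategory T A"
  unfolding full_triangulated_subcategory_def
  using assms(1-3,6) ex_zero_object shift_in[of A, OF assms(4,5)] by blast

lemma full_triangulated_subcategoryD:
  assumes "full_triangulated_subcategory T A"
  shows "A \<subseteq> Ob T" "zero_object T Z \<Longrightarrow> Z \<in> A"
    and "X \<in> A \<Longrightarrow> isomorphic T X Y \<Longrightarrow> Y \<in> A"
    and "X \<in> A \<Longrightarrow> ShO T X \<in> A" "X \<in> A \<Longrightarrow> unshift T X \<in> A"
    and "X \<in> A \<Longrightarrow> Y \<in> A \<Longrightarrow> exact_triangle T X Y Z \<Longrightarrow> Z \<in> A"
proof -
  note A = assms[unfolded full_triangulated_subcategory_def]
  show "A \<subseteq> Ob T" using A by blast
  show iso: "Y \<in> A" if "X \<in> A" "isomorphic T X Y" for X Y using A that isomorphic_Ob by blast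
  show "Z \<in> A" if "zero_object T Z" using A that isomorphic_zero_objects iso by blast
  show "X \<in> A \<Longrightarrow> ShO T X \<in> A" "X \<in> A \<Longrightarrow> unshift T X \<in> A"
    using A shift_1 shift_minus_1 by metis+
  show "X \<in> A \<Longrightarrow> Y \<in> A \<Longrightarrow> exact_triangle T X Y Z \<Longrightarrow> Z \<in> A"
    using A Hom_Ob(2) unfolding exact_triangle_def by (metis (no_types, lifting))
qed

lemma full_triangulated_subcategory_middle:
  assumes A: "full_triangulated_subcategory T A" and "X \<in> A" "Z \<in> A" "exact_triangle T X Y Z"
  shows "Y \<in> A"
  using assms(2-4) triangle_unrotate full_triangulated_subcategoryD(5,6)[OF A]
  by (metis exact_triangle_iff)

lemma left_orthogonal_thick:
  assumes B: "B \<subseteq> Ob T" and "\<And>Y. Y \<in> B \<Longrightarrow> ShO T Y \<in> B" and "\<And>Y. Y \<in> B \<Longrightarrow> unshift T Y \<in> B"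
  shows "full_triangulated_subcategory T (left_orthogonal B)"
    and "direct_summand_closed T (left_orthogonal B)"
proof -
  have Sh: "ShO T X \<in> left_orthogonal B" if "X \<in> left_orthogonal B" for X
    unfolding left_orthogonal_def
  proof (intro CollectI conjI ballI)
    fix Y assume Y: "Y \<in> B"
    show "Hom T (ShO T X) Y = {Zer T (ShO T X) Y}"
      using orthogonal_unshift_iff(1)[of X Y] that assms(3)[OF Y] Y B
      by (simp only: left_orthogonal_def mem_Collect_eq) blast
  qed (use that ShO_Ob in \<open>simp add: left_orthogonal_def\<close>)
  show "full_triangulated_subcategory T (left_orthogonal B)"
  proof (rule full_triangulated_subcategoryI)
    fix X assume X: "X \<in> left_orthogonal B"
    show "ShO T X \<in> left_orthogonal B" using Sh[OF X] .
    show "unshift T X \<in> left_orthogonal B"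
      unfolding left_orthogonal_def
    proof (intro CollectI conjI ballI)
      fix Y assume Y: "Y \<in> B"
      show "Hom T (unshift T X) Y = {Zer T (unshift T X) Y}"
        using orthogonal_unshift_iff(2)[of X Y] X assms(2)[OF Y] Y B
        by (simp only: left_orthogonal_def mem_Collect_eq) blast
    qed (use X unshift_Ob in \<open>simp add: left_orthogonal_def\<close>)
  next
    fix X Y Z assume X: "X \<in> left_orthogonal B" and "Y \<in> left_orthogonal B" "Z \<in> Ob T"
      and "exact_triangle T X Y Z"
    then show "Z \<in> left_orthogonal B"
      using orthogonal_triangle_left Sh[OF X] unfolding left_orthogonal_def by simp
  next
    fix X Y assume X: "X \<in> left_orthogonal B" and iso: "isomorphic T X Y"
    show "Y \<in> left_orthogonal B"
      unfolding left_orthogonal_def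
    proof (intro CollectI conjI ballI)
      fix W assume "W \<in> B"
      then have "Hom T X W = {Zer T X W}" using X by (simp add: left_orthogonal_def)
      then show "Hom T Y W = {Zer T Y W}" using orthogonal_isomorphic_left iso by blast
    qed (use isomorphic_Ob[OF iso] in simp)
  next
    fix Z assume "zero_object T Z"
    then show "Z \<in> left_orthogonal B"
      using zero_object_orthogonal(1) zero_object_Ob B unfolding left_orthogonal_def by auto
  qed (auto simp: left_orthogonal_def)
  show "direct_summand_closed T (left_orthogonal B)"
    unfolding direct_summand_closed_def left_orthogonal_def using orthogonal_summand_left by auto
qed

lemma right_orthogonal_thick:
  assumes A: "A \<subseteq> Ob T" and "\<And>Y. Y \<in> A \<Longrightarrow> ShO T Y \<in> A" and "\<And>Y. Y \<in> A \<Longrightarrow> unshift T Y \<in> A"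
  shows "full_triangulated_subcategory T (right_orthogonal T A)"
    and "direct_summand_closed T (right_orthogonal T A)"
proof -
  have Sh: "ShO T X \<in> right_orthogonal T A" if "X \<in> right_orthogonal T A" for X
    unfolding right_orthogonal_def
  proof (intro CollectI conjI ballI)
    fix Y assume Y: "Y \<in> A"
    show "Hom T Y (ShO T X) = {Zer T Y (ShO T X)}"
      using orthogonal_unshift_iff(2)[of Y X] that assms(3)[OF Y] Y A
      by (simp only: right_orthogonal_def mem_Collect_eq) blast
  qed (use that ShO_Ob in \<open>simp add: right_orthogonal_def\<close>)
  show "full_triangulated_subcategory T (right_orthogonal T A)"
  proof (rule full_triangulated_subcategoryI)
    fix X assume X: "X \<in> right_orthogonal T A"
    show "ShO T X \<in> right_orthogonal T A" using Sh[OF X] .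
    show "unshift T X \<in> right_orthogonal T A"
      unfolding right_orthogonal_def
    proof (intro CollectI conjI ballI)
      fix Y assume Y: "Y \<in> A"
      show "Hom T Y (unshift T X) = {Zer T Y (unshift T X)}"
        using orthogonal_unshift_iff(1)[of Y X] X assms(2)[OF Y] Y A
        by (simp only: right_orthogonal_def mem_Collect_eq) blast
    qed (use X unshift_Ob in \<open>simp add: right_orthogonal_def\<close>)
  next
    fix X Y Z assume X: "X \<in> right_orthogonal T A" and "Y \<in> right_orthogonal T A" "Z \<in> Ob T"
      and "exact_triangle T X Y Z"
    then show "Z \<in> right_orthogonal T A"
      using orthogonal_triangle_right Sh[OF X] unfolding right_orthogonal_def by simp
  next
    fix X Y assume X: "X \<in> right_orthogonal T A" and iso: "isomorphic T X Y"
    show "Y \<in> right_orthogonal T A"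
      unfolding right_orthogonal_def
    proof (intro CollectI conjI ballI)
      fix W assume "W \<in> A"
      then have "Hom T W X = {Zer T W X}" using X by (simp add: right_orthogonal_def)
      then show "Hom T W Y = {Zer T W Y}" using orthogonal_isomorphic_right iso by blast
    qed (use isomorphic_Ob[OF iso] in simp)
  next
    fix Z assume "zero_object T Z"
    then show "Z \<in> right_orthogonal T A"
      using zero_object_orthogonal(2) zero_object_Ob A unfolding right_orthogonal_def by auto
  qed (auto simp: right_orthogonal_def)
  show "direct_summand_closed T (right_orthogonal T A)"
    unfolding direct_summand_closed_def right_orthogonal_def using orthogonal_summand_right by auto
qed

lemma full_triangulated_subcategory_Ob:
  "full_triangulated_subcategory T (Ob T)" "direct_summand_closed T (Ob T)"
proof -
  show "full_triangulated_subcategory T (Ob T)"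
    using zero_object_Ob isomorphic_Ob ShO_Ob unshift_Ob
    by (intro full_triangulated_subcategoryI) auto
qed (auto simp: direct_summand_closed_def)

lemma full_triangulated_subcategory_Inter:
  assumes "\<A> \<noteq> {}" "\<And>A. A \<in> \<A> \<Longrightarrow> full_triangulated_subcategory T A"
  shows "full_triangulated_subcategory T (\<Inter> \<A>)"
proof (rule full_triangulated_subcategoryI)
  show "\<Inter> \<A> \<subseteq> Ob T" using assms full_triangulated_subcategoryD(1) by blast
qed (use full_triangulated_subcategoryD(2-6)[OF assms(2)] in \<open>blast+\<close>)

lemma tri_span:
  assumes "S \<subseteq> Ob T"
  shows "full_triangulated_subcategory T (tri_span T S)" "S \<subseteq> tri_span T S"
    and "full_triangulated_subcategory T A \<Longrightarrow> S \<subseteq> A \<Longrightarrow> tri_span T S \<subseteq> A"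
  unfolding tri_span_def using assms full_triangulated_subcategory_Ob
  by (auto intro!: full_triangulated_subcategory_Inter)

lemma thick_span:
  assumes "S \<subseteq> Ob T"
  shows "full_triangulated_subcategory T (thick_span T S)" "S \<subseteq> thick_span T S"
    and "full_triangulated_subcategory T A \<Longrightarrow> direct_summand_closed T A \<Longrightarrow> S \<subseteq> A \<Longrightarrow>
      thick_span T S \<subseteq> A"
  unfolding thick_span_def using assms full_triangulated_subcategory_Ob
  by (auto intro!: full_triangulated_subcategory_Inter)

text \<open>The left orthogonal of the right orthogonal of a shift-closed class is thick and contains the
  class, hence also its spans.\<close>

lemma right_orthogonal_span:
  assumes S: "S \<subseteq> Ob T" "\<And>X. X \<in> S \<Longrightarrow> ShO T X \<in> S" "\<And>X. X \<in> S \<Longrightarrow> unshift T X \<in> S"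
  shows "right_orthogonal T (thick_span T S) = right_orthogonal T S"
    and "right_orthogonal T (tri_span T S) = right_orthogonal T S"
proof -
  let ?R = "right_orthogonal T S"
  note R = full_triangulated_subcategoryD[OF right_orthogonal_thick(1)[OF S]]
  note L = left_orthogonal_thick[OF R(1) R(4) R(5)]
  have SL: "S \<subseteq> left_orthogonal ?R"
    using S(1) by (auto simp: left_orthogonal_def right_orthogonal_def)
  have *: "right_orthogonal T A = ?R" if "S \<subseteq> A" "A \<subseteq> left_orthogonal ?R" for A
    using that by (auto simp: right_orthogonal_def left_orthogonal_def)
  show "right_orthogonal T (thick_span T S) = ?R" "right_orthogonal T (tri_span T S) = ?R"
    using thick_span[OF S(1)] tri_span[OF S(1)] L SL by (blast intro!: *)+
qed

text \<open>Orthogonality of generating classes passes to the thick spans, one argument at a time, because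
  orthogonals of shift-closed classes are thick.\<close>

lemma thick_span_orthogonal:
  assumes S: "S \<subseteq> Ob T" "\<And>X. X \<in> S \<Longrightarrow> ShO T X \<in> S" "\<And>X. X \<in> S \<Longrightarrow> unshift T X \<in> S"
    and S': "S' \<subseteq> Ob T" and orth: "\<And>X Y. X \<in> S \<Longrightarrow> Y \<in> S' \<Longrightarrow> Hom T X Y = {Zer T X Y}"
    and X: "X \<in> thick_span T S" and Y: "Y \<in> thick_span T S'"
  shows "Hom T X Y = {Zer T X Y}"
proof -
  have "S' \<subseteq> right_orthogonal T S" using S' orth by (auto simp: right_orthogonal_def)
  then have "thick_span T S' \<subseteq> right_orthogonal T (thick_span T S)"
    using thick_span(3)[OF S'] right_orthogonal_thick[OF S] right_orthogonal_span(1)[OF S] by blast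
  then show ?thesis using X Y by (auto simp: right_orthogonal_def)
qed

definition right_admissible :: "'o set \<Rightarrow> bool" where
  "right_admissible A \<longleftrightarrow>
     (\<forall>X \<in> Ob T. \<exists>Y \<in> A. \<exists>Z \<in> right_orthogonal T A. exact_triangle T Y X Z)"

text \<open>Projecting \<open>X\<close> successively to the components, starting from the rightmost one, ends with \<open>X'\<close>
  in the common right orthogonal. The last part is the invariant behind this; applied to a component
  already treated, as \<open>W\<close>, it shows that the later steps preserve the orthogonality to it. The middle
  part recovers \<open>X\<close> from \<open>X'\<close> and the components.\<close>

lemma semiorthogonal_projection:
  assumes "\<And>A. A \<in> set As \<Longrightarrow> full_triangulated_subcategory T A \<and> right_admissible A"
    and "\<forall>i < length As. \<forall>j < i. \<forall>X \<in> As ! i. \<forall>Y \<in> As ! j. Hom T X Y = {Zer T X Y}"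
    and "X \<in> Ob T"
  shows "\<exists>X' \<in> right_orthogonal T (\<Union> (set As)).
    (\<forall>D. full_triangulated_subcategory T D \<longrightarrow> X' \<in> D \<longrightarrow> \<Union> (set As) \<subseteq> D \<longrightarrow> X \<in> D) \<and>
    (\<forall>W. full_triangulated_subcategory T W \<longrightarrow>
       \<Union> (set As) \<subseteq> right_orthogonal T W \<longrightarrow> X \<in> right_orthogonal T W \<longrightarrow> X' \<in> right_orthogonal T W)"
  using assms
proof (induction As arbitrary: X rule: rev_induct)
  case Nil
  then show ?case by (auto simp: right_orthogonal_def)
next
  case (snoc A As)
  have A: "full_triangulated_subcategory T A" "right_admissible A" using snoc.prems(1) by auto
  obtain a X1 where a: "a \<in> A" and X1: "X1 \<in> right_orthogonal T A" and tri: "exact_triangle T a X X1"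
    using A(2) snoc.prems(3) unfolding right_admissible_def by blast
  have AAs: "\<Union> (set As) \<subseteq> right_orthogonal T A"
  proof
    fix Y assume "Y \<in> \<Union> (set As)"
    then obtain j where j: "j < length As" "Y \<in> As ! j" by (auto simp: in_set_conv_nth)
    have "full_triangulated_subcategory T (As ! j)" using snoc.prems(1) j(1) by simp
    then have "Y \<in> Ob T" using full_triangulated_subcategoryD(1) j(2) by blast
    then show "Y \<in> right_orthogonal T A"
      using snoc.prems(2)[rule_format, of "length As" j _ Y] j
      unfolding right_orthogonal_def by (simp add: nth_append)
  qed
  have IHp: "\<forall>i < length As. \<forall>j < i. \<forall>X \<in> As ! i. \<forall>Y \<in> As ! j. Hom T X Y = {Zer T X Y}"
  proof (intro allI impI ballI)
    fix i j X Y assume ij: "i < length As" "j < i" "X \<in> As ! i" "Y \<in> As ! j"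
    then show "Hom T X Y = {Zer T X Y}"
      using snoc.prems(2)[rule_format, of i j X Y] by (simp add: nth_append)
  qed
  have X1T: "X1 \<in> Ob T" using X1 by (simp add: right_orthogonal_def)
  obtain X' where X': "X' \<in> right_orthogonal T (\<Union> (set As))"
      "\<And>D. full_triangulated_subcategory T D \<Longrightarrow> X' \<in> D \<Longrightarrow> \<Union> (set As) \<subseteq> D \<Longrightarrow> X1 \<in> D"
      "\<And>W. full_triangulated_subcategory T W \<Longrightarrow>
        \<Union> (set As) \<subseteq> right_orthogonal T W \<Longrightarrow> X1 \<in> right_orthogonal T W \<Longrightarrow> X' \<in> right_orthogonal T W"
    using snoc.IH[OF _ IHp X1T] snoc.prems(1) by (metis Un_iff set_append)
  show ?case
  proof (rule bexI[of _ X'], intro conjI allI impI)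
    fix D assume D: "full_triangulated_subcategory T D" "X' \<in> D" "\<Union> (set (As @ [A])) \<subseteq> D"
    then show "X \<in> D"
      using X'(2)[OF D(1,2)] full_triangulated_subcategory_middle[OF D(1) _ _ tri] a by auto
  next
    fix W assume W: "full_triangulated_subcategory T W"
      "\<Union> (set (As @ [A])) \<subseteq> right_orthogonal T W" "X \<in> right_orthogonal T W"
    note WD = full_triangulated_subcategoryD[OF W(1)]
    have "full_triangulated_subcategory T (right_orthogonal T W)"
      using right_orthogonal_thick(1)[OF WD(1) WD(4) WD(5)] .
    moreover have "a \<in> right_orthogonal T W" using W(2) a by auto
    ultimately have "X1 \<in> right_orthogonal T W"
      using full_triangulated_subcategoryD(6) tri W(3) by blast
    then show "X' \<in> right_orthogonal T W" using X'(3)[OF W(1)] W(2) by auto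
  next
    have "X' \<in> right_orthogonal T A" using X'(3)[OF A(1) AAs X1] .
    then show "X' \<in> right_orthogonal T (\<Union> (set (As @ [A])))"
      using X'(1) by (auto simp: right_orthogonal_def)
  qed
qed

lemma semiorthogonal_decompositionI:
  assumes As: "\<And>A. A \<in> set As \<Longrightarrow> full_triangulated_subcategory T A \<and> right_admissible A"
    and orth: "\<forall>i < length As. \<forall>j < i. \<forall>X \<in> As ! i. \<forall>Y \<in> As ! j. Hom T X Y = {Zer T X Y}"
  shows "semiorthogonal_decomposition T
    (right_orthogonal T (tri_span T (\<Union> (set As))) # As)"
proof -
  let ?S = "\<Union> (set As)"
  let ?B = "right_orthogonal T (tri_span T ?S)"
  have S: "?S \<subseteq> Ob T" "\<And>X. X \<in> ?S \<Longrightarrow> ShO T X \<in> ?S" "\<And>X. X \<in> ?S \<Longrightarrow> unshift T X \<in> ?S"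
    using As full_triangulated_subcategoryD(1,4,5) by blast+
  have B: "?B = right_orthogonal T ?S" using right_orthogonal_span(2)[OF S] .
  have Bt: "full_triangulated_subcategory T ?B" unfolding B using right_orthogonal_thick(1)[OF S] .
  have BS: "\<Union> (set (?B # As)) \<subseteq> Ob T" using S(1) full_triangulated_subcategoryD(1)[OF Bt] by auto
  have gen: "X \<in> tri_span T (\<Union> (set (?B # As)))" if X: "X \<in> Ob T" for X
  proof -
    obtain X' where "X' \<in> ?B"
        "\<And>D. full_triangulated_subcategory T D \<Longrightarrow> X' \<in> D \<Longrightarrow> ?S \<subseteq> D \<Longrightarrow> X \<in> D"
      using semiorthogonal_projection[OF As orth X] unfolding B by blast
    then show ?thesis using tri_span(1,2)[OF BS] by auto
  qed
  show ?thesis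
    unfolding semiorthogonal_decomposition_def
  proof (intro conjI allI impI ballI)
    fix A assume "A \<in> set (?B # As)"
    then show "full_triangulated_subcategory T A" using As Bt by auto
  next
    fix i j X Y assume ij: "i < length (?B # As)" "j < i" "X \<in> (?B # As) ! i" "Y \<in> (?B # As) ! j"
    then obtain i' where i': "i = Suc i'" by (cases i) auto
    show "Hom T X Y = {Zer T X Y}"
    proof (cases j)
      case 0
      then have "Y \<in> right_orthogonal T ?S" "X \<in> ?S" using ij i' B by auto
      then show ?thesis unfolding right_orthogonal_def by blast
    next
      case (Suc j')
      then show ?thesis using ij i' orth by simp
    qed
  next
    show "tri_span T (\<Union> (set (?B # As))) = Ob T"
      using gen tri_span(3)[OF BS full_triangulated_subcategory_Ob(1) BS] by blast
  qed
qed

end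

section \<open>Exact functors and admissible images\<close>

lemma exact_functorD:
  assumes "exact_functor S T Fo Fa"
  shows "is_functor S T Fo Fa"
    and "X \<in> Ob S \<Longrightarrow> Y \<in> Ob S \<Longrightarrow> f \<in> Hom S X Y \<Longrightarrow> g \<in> Hom S X Y \<Longrightarrow>
      Fa (Add S f g) = Add T (Fa f) (Fa g)"
  using assms unfolding exact_functor_def by blast+

lemma exact_functor_Zer:
  assumes "triangulated_category S" "triangulated_category T" and F: "exact_functor S T Fo Fa"
    and "X \<in> Ob S" "Y \<in> Ob S"
  shows "Fa (Zer S X Y) = Zer T (Fo X) (Fo Y)"
proof -
  interpret S: triangulated_category S by fact
  interpret T: triangulated_category T by fact
  note Z = S.Zer_Hom[OF assms(4,5)]
  show ?thesis
    using T.Zer_unique[OF is_functor_Hom[OF S.category_axioms exact_functorD(1)[OF F] Z]]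
      exact_functorD(2)[OF F assms(4,5) Z Z] S.Add_Zer[OF assms(4,5)] by simp
qed

lemma exact_functor_zero_object:
  assumes "triangulated_category S" "triangulated_category T" and F: "exact_functor S T Fo Fa"
    and Z: "zero_object S Z"
  shows "zero_object T (Fo Z)"
proof -
  interpret S: triangulated_category S by fact
  interpret T: triangulated_category T by fact
  have "Fa (Idn S Z) = Fa (Zer S Z Z)" "Z \<in> Ob S" using Z by (simp_all add: S.zero_object_iff)
  then show ?thesis
    using exact_functor_Zer[OF assms(1-3)] is_functor_Idn[OF exact_functorD(1)[OF F]]
      is_functor_Ob[OF exact_functorD(1)[OF F]] by (simp add: T.zero_object_iff)
qed

lemma exact_functor_ShO:
  assumes "exact_functor S T Fo Fa" "X \<in> Ob S"
  shows "isomorphic T (Fo (ShO S X)) (ShO T (Fo X))"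
  using assms unfolding exact_functor_def isomorphic_def by blast

lemma exact_functor_triangle:
  assumes "triangulated_category S" "triangulated_category T" and F: "exact_functor S T Fo Fa"
    and tri: "exact_triangle S X Y Z"
  shows "exact_triangle T (Fo X) (Fo Y) (Fo Z)"
proof -
  interpret S: triangulated_category S by fact
  interpret T: triangulated_category T by fact
  obtain \<xi> where xi: "\<And>X. X \<in> Ob S \<Longrightarrow> \<xi> X \<in> Hom T (Fo (ShO S X)) (ShO T (Fo X))"
      and D: "\<And>f g h. (f, g, h) \<in> Dist S \<Longrightarrow> (Fa f, Fa g, \<xi> (Src S f) \<cdot>\<^bsub>T\<^esub> Fa h) \<in> Dist T"
    using F unfolding exact_functor_def by blast
  obtain f g h where fgh: "(f, g, h) \<in> Dist S" "f \<in> Hom S X Y" "g \<in> Hom S Y Z"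
      "h \<in> Hom S Z (ShO S X)"
    using tri unfolding exact_triangle_def by blast
  note FH = is_functor_Hom[OF S.category_axioms exact_functorD(1)[OF F]]
  have src: "Src S f = X" using fgh(2) by (simp add: Hom_def)
  have "\<xi> X \<cdot>\<^bsub>T\<^esub> Fa h \<in> Hom T (Fo Z) (ShO T (Fo X))"
    using T.Cmp_Hom[OF FH[OF fgh(4)] xi] S.Hom_Ob[OF fgh(2)] by simp
  then show ?thesis
    unfolding exact_triangle_def using D[OF fgh(1)] FH[OF fgh(2)] FH[OF fgh(3)] src by metis
qed

lemma essential_image_shift_closed:
  assumes "triangulated_category S" "triangulated_category T" and F: "exact_functor S T Fo Fa"
  shows "Y \<in> essential_image S T Fo \<Longrightarrow> ShO T Y \<in> essential_image S T Fo"
    and "Y \<in> essential_image S T Fo \<Longrightarrow> unshift T Y \<in> essential_image S T Fo"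
proof -
  interpret S: triangulated_category S by fact
  interpret T: triangulated_category T by fact
  assume "Y \<in> essential_image S T Fo"
  then obtain X where X: "X \<in> Ob S" and iso: "isomorphic T (Fo X) Y" and Y: "Y \<in> Ob T"
    by (auto simp: essential_image_def)
  have "isomorphic T (Fo (ShO S X)) (ShO T Y)"
    using T.isomorphic_trans[OF exact_functor_ShO[OF F X] T.ShO_isomorphic[OF iso]] .
  then show "ShO T Y \<in> essential_image S T Fo"
    using S.ShO_Ob[OF X] T.ShO_Ob[OF Y] by (auto simp: essential_image_def)
  note uX = S.unshift_Ob[OF X]
  have FuX: "Fo (unshift S X) \<in> Ob T" using is_functor_Ob[OF exact_functorD(1)[OF F] uX] .
  have "isomorphic T (Fo X) (ShO T (Fo (unshift S X)))"
    using exact_functor_ShO[OF F uX] S.ShO_unshift[OF X] by simp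
  then have "isomorphic T (unshift T Y) (Fo (unshift S X))"
    using T.isomorphic_unshift[OF T.isomorphic_trans[OF T.isomorphic_sym[OF iso]]]
      T.unshift_ShO[OF FuX] by metis
  then show "unshift T Y \<in> essential_image S T Fo"
    using uX T.unshift_Ob[OF Y] T.isomorphic_sym unfolding essential_image_def by blast
qed

text \<open>The triangle on the counit \<open>F R X \<rightarrow> X\<close> projects \<open>X\<close> to the image: composition with the
  counit is bijective on maps from objects \<open>F Y\<close>, so its cone receives no maps from the image.\<close>

lemma right_admissible_image:
  assumes "triangulated_category S" "triangulated_category T" and F: "exact_functor S T Fo Fa"
    and ff: "fully_faithful S T Fo Fa" and R: "is_functor T S Ro Ra"
    and adj: "hom_adjunction S T Fo Fa Ro Ra"
  shows "triangulated_category.right_admissible T (thick_span T (essential_image S T Fo))"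
proof -
  interpret S: triangulated_category S by fact
  interpret T: triangulated_category T by fact
  let ?E = "essential_image S T Fo"
  note Ff = exact_functorD(1)[OF F]
  note FO = is_functor_Ob[OF Ff] and FH = is_functor_Hom[OF S.category_axioms Ff]
  have E: "?E \<subseteq> Ob T" by (auto simp: essential_image_def)
  note Esh = essential_image_shift_closed[OF assms(1-3)]
  from adj obtain \<phi> where "adjunction_bijection S T Fo Fa Ro Ra \<phi>"
    unfolding hom_adjunction_def by blast
  note p = adjunction_bijectionD[OF this]
  show ?thesis
    unfolding T.right_admissible_def
  proof
    fix X assume X: "X \<in> Ob T"
    have RX: "Ro X \<in> Ob S" using is_functor_Ob[OF R X] .
    obtain \<epsilon> where e: "\<epsilon> \<in> Hom T (Fo (Ro X)) X" "\<phi> (Ro X) X \<epsilon> = Idn S (Ro X)"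
      using p(1)[OF RX X] S.Idn_Hom[OF RX] unfolding bij_betw_def by (metis (no_types) imageE)
    have pe: "\<phi> Y X (\<epsilon> \<cdot>\<^bsub>T\<^esub> Fa k) = k" if k: "k \<in> Hom S Y (Ro X)" for Y k
      using p(2)[OF k e(1)] e(2) S.Idn_Cmp[OF k] by simp
    obtain g h where D: "(\<epsilon>, g, h) \<in> Dist T" using T.TR1_cone[of \<epsilon>] e(1) unfolding Hom_def by blast
    obtain X0 X1 C where ty: "\<epsilon> \<in> Hom T X0 X1" "g \<in> Hom T X1 C" "h \<in> Hom T C (ShO T X0)"
      using T.Dist_typed[OF D] by blast
    then have "X0 = Fo (Ro X)" "X1 = X" using e(1) by (simp_all add: Hom_def)
    then have tri: "dist_triangle T (Fo (Ro X)) X C \<epsilon> g h"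
      using ty D by (simp add: dist_triangle_def)
    then have g: "g \<in> Hom T X C" and h: "h \<in> Hom T C (ShO T (Fo (Ro X)))"
      by (auto simp: dist_triangle_def)
    note C = T.Hom_Ob(2)[OF g]
    have eh: "Neg T (ShA T \<epsilon>) \<cdot>\<^bsub>T\<^esub> h = Zer T C (ShO T X)"
      using T.triangle_Cmp_Zer[OF T.triangle_rotate[OF T.triangle_rotate[OF tri]]] .
    have eh0: "ShA T \<epsilon> \<cdot>\<^bsub>T\<^esub> h = Zer T C (ShO T X)"
    proof -
      have eh1: "ShA T \<epsilon> \<cdot>\<^bsub>T\<^esub> h \<in> Hom T C (ShO T X)" using T.Cmp_Hom[OF h T.ShA_Hom[OF e(1)]] .
      have "Neg T (ShA T \<epsilon> \<cdot>\<^bsub>T\<^esub> h) = Zer T C (ShO T X)"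
        using eh T.Neg_Cmp[OF h T.ShA_Hom[OF e(1)]] by simp
      then show ?thesis using T.Neg_Neg[OF eh1] T.Neg_Zer[OF C T.ShO_Ob[OF X]] by simp
    qed
    have orthF: "t = Zer T (ShO T (Fo Y)) C" if Y: "Y \<in> Ob S" and t: "t \<in> Hom T (ShO T (Fo Y)) C"
      for Y t
    proof -
      note FY = FO[OF Y] and FRX = FO[OF RX]
      have ht: "h \<cdot>\<^bsub>T\<^esub> t \<in> Hom T (ShO T (Fo Y)) (ShO T (Fo (Ro X)))" using T.Cmp_Hom[OF t h] .
      obtain s where s: "s \<in> Hom T (Fo Y) (Fo (Ro X))" "ShA T s = h \<cdot>\<^bsub>T\<^esub> t"
        using T.ShA_full[OF ht FY FRX] by blast
      obtain k where k: "k \<in> Hom S Y (Ro X)" "Fa k = s"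
        using ff Y RX s(1) unfolding fully_faithful_def bij_betw_def by (metis (no_types) imageE)
      have "ShA T (\<epsilon> \<cdot>\<^bsub>T\<^esub> s) = (ShA T \<epsilon> \<cdot>\<^bsub>T\<^esub> h) \<cdot>\<^bsub>T\<^esub> t"
        using T.ShA_Cmp[OF s(1) e(1)] s(2) T.Cmp_assoc[OF t h T.ShA_Hom[OF e(1)]] by simp
      also have "\<dots> = ShA T (Zer T (Fo Y) X)"
        using eh0 T.Zer_Cmp[OF t T.ShO_Ob[OF X]] T.ShA_Zer[OF FY X] by simp
      finally have "\<epsilon> \<cdot>\<^bsub>T\<^esub> s = Zer T (Fo Y) X"
        using T.ShA_faithful[OF T.Cmp_Hom[OF s(1) e(1)] T.Zer_Hom[OF FY X]] by simp
      moreover have "\<epsilon> \<cdot>\<^bsub>T\<^esub> Fa (Zer S Y (Ro X)) = Zer T (Fo Y) X"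
        using exact_functor_Zer[OF assms(1-3) Y RX] T.Cmp_Zer[OF e(1) FY] by simp
      ultimately have "k = Zer S Y (Ro X)"
        using pe[OF k(1)] pe[OF S.Zer_Hom[OF Y RX]] k(2) by simp
      then have "h \<cdot>\<^bsub>T\<^esub> t = Zer T (ShO T (Fo Y)) (ShO T (Fo (Ro X)))"
        using k(2) s(2) exact_functor_Zer[OF assms(1-3) Y RX] T.ShA_Zer[OF FY FRX] by simp
      then obtain r where r: "r \<in> Hom T (ShO T (Fo Y)) X" "g \<cdot>\<^bsub>T\<^esub> r = t"
        using T.triangle_lift[OF T.triangle_rotate[OF tri] t] by blast
      let ?Y = "ShO S Y"
      note ShY = S.ShO_Ob[OF Y]
      obtain a b where ab: "a \<in> Hom T (Fo ?Y) (ShO T (Fo Y))" "b \<in> Hom T (ShO T (Fo Y)) (Fo ?Y)"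
          "a \<cdot>\<^bsub>T\<^esub> b = Idn T (ShO T (Fo Y))"
        using T.isomorphicE[OF exact_functor_ShO[OF F Y]] by metis
      note ra = T.Cmp_Hom[OF ab(1) r(1)]
      have pra: "\<phi> ?Y X (r \<cdot>\<^bsub>T\<^esub> a) \<in> Hom S ?Y (Ro X)"
        using bij_betwE[OF p(1)[OF ShY X]] ra by blast
      define k' where "k' = \<phi> ?Y X (r \<cdot>\<^bsub>T\<^esub> a)"
      have k'h: "\<epsilon> \<cdot>\<^bsub>T\<^esub> Fa k' \<in> Hom T (Fo ?Y) X"
        using T.Cmp_Hom[OF FH e(1)] pra unfolding k'_def by blast
      have "\<phi> ?Y X (\<epsilon> \<cdot>\<^bsub>T\<^esub> Fa k') = \<phi> ?Y X (r \<cdot>\<^bsub>T\<^esub> a)" using pe pra unfolding k'_def by blast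
      then have "r \<cdot>\<^bsub>T\<^esub> a = \<epsilon> \<cdot>\<^bsub>T\<^esub> Fa k'"
        using p(1)[OF ShY X] ra k'h unfolding bij_betw_def by (metis (no_types) inj_onD)
      moreover have Fk': "Fa k' \<in> Hom T (Fo ?Y) (Fo (Ro X))" using FH pra unfolding k'_def by blast
      ultimately have "g \<cdot>\<^bsub>T\<^esub> (r \<cdot>\<^bsub>T\<^esub> a) = Zer T (Fo ?Y) C"
        using T.Cmp_assoc[OF Fk' e(1) g] T.triangle_Cmp_Zer[OF tri] T.Zer_Cmp[OF Fk' C] by simp
      then have "t \<cdot>\<^bsub>T\<^esub> a = Zer T (Fo ?Y) C" using T.Cmp_assoc[OF ab(1) r(1) g] r(2) by simp
      then have "t \<cdot>\<^bsub>T\<^esub> (a \<cdot>\<^bsub>T\<^esub> b) = Zer T (ShO T (Fo Y)) C"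
        using T.Cmp_assoc[OF ab(2,1) t] T.Zer_Cmp[OF ab(2) C] by simp
      then show ?thesis using ab(3) T.Cmp_Idn[OF t] by simp
    qed
    have "C \<in> right_orthogonal T ?E"
      unfolding right_orthogonal_def
    proof (intro CollectI conjI ballI C)
      fix W assume "W \<in> ?E"
      then obtain Y where Y: "Y \<in> Ob S" "isomorphic T (Fo Y) W"
        by (auto simp: essential_image_def)
      note uY = S.unshift_Ob[OF Y(1)]
      \<comment> \<open>\<open>orthF\<close> treats the objects \<open>(F Y)[1]\<close>, and up to isomorphism these are the whole image\<close>
      have "isomorphic T (ShO T (Fo (unshift S Y))) (Fo Y)"
        using T.isomorphic_sym[OF exact_functor_ShO[OF F uY]] S.ShO_unshift[OF Y(1)] by simp
      moreover have "Hom T (ShO T (Fo (unshift S Y))) C = {Zer T (ShO T (Fo (unshift S Y))) C}"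
        using T.orthogonalI[OF T.ShO_Ob[OF FO[OF uY]] C orthF[OF uY]] by blast
      ultimately show "Hom T W C = {Zer T W C}"
        using T.orthogonal_isomorphic_left T.isomorphic_trans[OF _ Y(2)] by blast
    qed
    then have "C \<in> right_orthogonal T (thick_span T ?E)"
      using T.right_orthogonal_span(1)[OF E] Esh by blast
    moreover have "Fo (Ro X) \<in> thick_span T ?E"
      using T.thick_span(2)[OF E] FO[OF RX] T.isomorphic_refl[OF FO[OF RX]] RX
      by (auto simp: essential_image_def)
    moreover have "exact_triangle T (Fo (Ro X)) X C" using tri unfolding exact_triangle_iff by blast
    ultimately show "\<exists>Y\<in>thick_span T ?E. \<exists>Z\<in>right_orthogonal T (thick_span T ?E). exact_triangle T Y X Z"
      by blast
  qed
qed

section \<open>Objects up to shift\<close>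

text \<open>Isomorphism up to an unspecified shift. The generated equivalence relation needs no
  bookkeeping of exponents, and it is evidently preserved by exact functors.\<close>

inductive shift_equiv :: "('o, 'a, 'm) tri_cat_scheme \<Rightarrow> 'o \<Rightarrow> 'o \<Rightarrow> bool" for T where
  shift_equiv_iso: "isomorphic T X Y \<Longrightarrow> shift_equiv T X Y"
| shift_equiv_ShO: "X \<in> Ob T \<Longrightarrow> shift_equiv T X (ShO T X)"
| shift_equiv_sym: "shift_equiv T X Y \<Longrightarrow> shift_equiv T Y X"
| shift_equiv_trans: "shift_equiv T X Y \<Longrightarrow> shift_equiv T Y Z \<Longrightarrow> shift_equiv T X Z"

declare shift_equiv_trans [trans]

context triangulated_category
begin

lemma shift_equiv_Ob: "shift_equiv T X Y \<Longrightarrow> X \<in> Ob T \<and> Y \<in> Ob T"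
proof (induction rule: shift_equiv.induct)
  case (shift_equiv_iso X Y)
  then show ?case using isomorphic_Ob by blast
qed (simp_all add: ShO_Ob)

lemma shift_equiv_refl: "X \<in> Ob T \<Longrightarrow> shift_equiv T X X"
  by (simp add: isomorphic_refl shift_equiv_iso)

lemma shift_equiv_zero_object: "shift_equiv T X Y \<Longrightarrow> zero_object T X \<longleftrightarrow> zero_object T Y"
proof (induction rule: shift_equiv.induct)
  case (shift_equiv_iso X Y)
  then show ?case using zero_object_isomorphic[of X Y] zero_object_isomorphic[of Y X] isomorphic_sym by blast
qed (simp_all add: zero_object_ShO_iff)

lemma shift_equiv_unshift: "X \<in> Ob T \<Longrightarrow> shift_equiv T X (unshift T X)"
  using shift_equiv_sym[OF shift_equiv_ShO[OF unshift_Ob]] ShO_unshift by metis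

lemma shift_equiv_shift:
  assumes "X \<in> Ob T"
  shows "shift_equiv T X (shift T n X)"
proof -
  have "shift T n X \<in> {Y. shift_equiv T X Y}"
  proof (rule shift_in)
    fix Y assume "Y \<in> {Y. shift_equiv T X Y}"
    then have XY: "shift_equiv T X Y" by simp
    then have Y: "Y \<in> Ob T" using shift_equiv_Ob by blast
    show "ShO T Y \<in> {Y. shift_equiv T X Y}"
      using shift_equiv_trans[OF XY shift_equiv_ShO[OF Y]] by simp
    show "unshift T Y \<in> {Y. shift_equiv T X Y}"
      using shift_equiv_trans[OF XY shift_equiv_unshift[OF Y]] by simp
  qed (simp add: assms shift_equiv_refl)
  then show ?thesis by simp
qed

lemma isomorphic_shift_equiv:
  "isomorphic T X (shift T n Y) \<Longrightarrow> Y \<in> Ob T \<Longrightarrow> shift_equiv T X Y"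
  using shift_equiv_trans[OF shift_equiv_iso shift_equiv_sym[OF shift_equiv_shift]] .

end

lemma exact_functor_shift_equiv:
  assumes "triangulated_category S" "triangulated_category T" and F: "exact_functor S T Fo Fa"
    and "shift_equiv S X Y"
  shows "shift_equiv T (Fo X) (Fo Y)"
  using assms(4)
proof (induction rule: shift_equiv.induct)
  case (shift_equiv_iso X Y)
  interpret S: triangulated_category S by fact
  interpret T: triangulated_category T by fact
  show ?case
    using shift_equiv.shift_equiv_iso[OF is_functor_isomorphic[OF S.category_axioms T.category_axioms
      exact_functorD(1)[OF F] shift_equiv_iso]] .
next
  case (shift_equiv_ShO X)
  interpret T: triangulated_category T by fact
  have "shift_equiv T (ShO T (Fo X)) (Fo (ShO S X))"
    using shift_equiv.shift_equiv_iso[OF T.isomorphic_sym[OF exact_functor_ShO[OF F shift_equiv_ShO]]] .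
  with shift_equiv.shift_equiv_ShO[OF is_functor_Ob[OF exact_functorD(1)[OF F] shift_equiv_ShO]]
  show ?case by (rule shift_equiv_trans)
next
  case (shift_equiv_sym X Y)
  from shift_equiv_sym(2) show ?case by (rule shift_equiv.shift_equiv_sym)
next
  case (shift_equiv_trans X Y Z)
  from shift_equiv_trans(3,4) show ?case by (rule shift_equiv.shift_equiv_trans)
qed

section \<open>1-morphisms up to shift\<close>

definition inverse_pair :: "('w, 'f, 't, 'm) two_cat_scheme \<Rightarrow> 'w \<Rightarrow> 'f \<Rightarrow> 'f \<Rightarrow> bool" where
  "inverse_pair K k u v \<longleftrightarrow> u \<in> Ob (Mor K k k) \<and> v \<in> Ob (Mor K k k) \<and>
     isomorphic (Mor K k k) (u \<star>\<^bsub>K\<^esub> v) (One K k) \<and> isomorphic (Mor K k k) (v \<star>\<^bsub>K\<^esub> u) (One K k)"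

lemma inverse_pair_sym: "inverse_pair K k u v \<Longrightarrow> inverse_pair K k v u"
  by (auto simp: inverse_pair_def)

context linear_triangulated_2_category
begin

lemma Mor_tri: "k \<in> Obj K \<Longrightarrow> l \<in> Obj K \<Longrightarrow> triangulated_category (Mor K k l)"
  using Mor_triangulated linear_triangulated_category_def by blast

lemma Mor_cat: "k \<in> Obj K \<Longrightarrow> l \<in> Obj K \<Longrightarrow> category (Mor K k l)"
  using Mor_tri triangulated_category.axioms(1) additive_category.axioms(1)
    preadditive_category.axioms(1) by blast

abbreviation iso_mor :: "'w \<Rightarrow> 'w \<Rightarrow> 'f \<Rightarrow> 'f \<Rightarrow> bool" where
  "iso_mor k l \<equiv> isomorphic (Mor K k l)"

abbreviation mor :: "'w \<Rightarrow> 'w \<Rightarrow> 'f set" where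
  "mor k l \<equiv> Ob (Mor K k l)"

abbreviation zero_mor :: "'w \<Rightarrow> 'w \<Rightarrow> 'f \<Rightarrow> bool" where
  "zero_mor k l \<equiv> zero_object (Mor K k l)"

abbreviation eqv :: "'w \<Rightarrow> 'w \<Rightarrow> 'f \<Rightarrow> 'f \<Rightarrow> bool" where
  "eqv k l \<equiv> shift_equiv (Mor K k l)"

lemma iso_Mor:
  assumes "k \<in> Obj K" "l \<in> Obj K" "iso_mor k l f g"
  shows "f \<in> mor k l" "g \<in> mor k l"
  using category.isomorphic_Ob[OF Mor_cat[OF assms(1,2)] assms(3)] by auto

lemma eqv_Mor:
  assumes "k \<in> Obj K" "l \<in> Obj K" "eqv k l f g"
  shows "f \<in> mor k l" "g \<in> mor k l"
  using triangulated_category.shift_equiv_Ob[OF Mor_tri[OF assms(1,2)] assms(3)] by auto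

lemma iso_mor_refl: "k \<in> Obj K \<Longrightarrow> l \<in> Obj K \<Longrightarrow> f \<in> mor k l \<Longrightarrow> iso_mor k l f f"
  using category.isomorphic_refl[OF Mor_cat] .

lemma HC1_isomorphic:
  assumes k: "k \<in> Obj K" and l: "l \<in> Obj K" and m: "m \<in> Obj K"
    and f: "iso_mor l m f f'" and g: "iso_mor k l g g'"
  shows "iso_mor k m (f \<star> g) (f' \<star> g')"
proof -
  note f' = iso_Mor[OF l m f] and g' = iso_Mor[OF k l g]
  have "iso_mor k m (f \<star> g) (f \<star> g')"
    using is_functor_isomorphic[OF Mor_cat[OF k l] Mor_cat[OF k m]
        exact_functorD(1)[OF postcompose_exact[OF k l m f'(1)]] g] .
  moreover have "iso_mor k m (f \<star> g') (f' \<star> g')"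
    using is_functor_isomorphic[OF Mor_cat[OF l m] Mor_cat[OF k m]
        exact_functorD(1)[OF precompose_exact[OF k l m g'(2)]] f] .
  ultimately show ?thesis using category.isomorphic_trans[OF Mor_cat[OF k m]] by blast
qed

lemma HC1_shift_equiv:
  assumes k: "k \<in> Obj K" and l: "l \<in> Obj K" and m: "m \<in> Obj K"
    and f: "eqv l m f f'" and g: "eqv k l g g'"
  shows "eqv k m (f \<star> g) (f' \<star> g')"
proof -
  note f' = eqv_Mor[OF l m f] and g' = eqv_Mor[OF k l g]
  have "eqv k m (f \<star> g) (f \<star> g')"
    using exact_functor_shift_equiv[OF Mor_tri[OF k l] Mor_tri[OF k m]
        postcompose_exact[OF k l m f'(1)] g] .
  also have "eqv k m (f \<star> g') (f' \<star> g')"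
    using exact_functor_shift_equiv[OF Mor_tri[OF l m] Mor_tri[OF k m]
        precompose_exact[OF k l m g'(2)] f] .
  finally show ?thesis .
qed

lemma eqv_refl: "k \<in> Obj K \<Longrightarrow> l \<in> Obj K \<Longrightarrow> f \<in> mor k l \<Longrightarrow> eqv k l f f"
  using triangulated_category.shift_equiv_refl[OF Mor_tri] .

lemma HC1_shift_equiv_left:
  assumes "k \<in> Obj K" "l \<in> Obj K" "m \<in> Obj K" "eqv l m f f'" "g \<in> mor k l"
  shows "eqv k m (f \<star> g) (f' \<star> g)"
  using HC1_shift_equiv[OF assms(1-4) eqv_refl[OF assms(1,2,5)]] .

lemma HC1_shift_equiv_right:
  assumes "k \<in> Obj K" "l \<in> Obj K" "m \<in> Obj K" "f \<in> mor l m" "eqv k l g g'"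
  shows "eqv k m (f \<star> g) (f \<star> g')"
  using HC1_shift_equiv[OF assms(1-3) eqv_refl[OF assms(2,3,4)] assms(5)] .

lemma HC1_zero_object:
  assumes k: "k \<in> Obj K" and l: "l \<in> Obj K" and m: "m \<in> Obj K"
  shows "zero_mor l m f \<Longrightarrow> g \<in> mor k l \<Longrightarrow> zero_mor k m (f \<star> g)"
    and "f \<in> mor l m \<Longrightarrow> zero_mor k l g \<Longrightarrow> zero_mor k m (f \<star> g)"
  using exact_functor_zero_object[OF Mor_tri[OF l m] Mor_tri[OF k m] precompose_exact[OF k l m]]
    exact_functor_zero_object[OF Mor_tri[OF k l] Mor_tri[OF k m] postcompose_exact[OF k l m]]
  by blast+

lemma eqv_zero_object:
  assumes "k \<in> Obj K" "l \<in> Obj K" "eqv k l f g"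
  shows "zero_mor k l f \<longleftrightarrow> zero_mor k l g"
  using triangulated_category.shift_equiv_zero_object[OF Mor_tri[OF assms(1,2)] assms(3)] .

lemma ShO_HC1_isomorphic:
  assumes k: "k \<in> Obj K" and l: "l \<in> Obj K" and m: "m \<in> Obj K"
    and f: "f \<in> mor l m" and g: "g \<in> mor k l"
  shows "iso_mor k m (ShO (Mor K l m) f \<star> g) (ShO (Mor K k m) (f \<star> g))"
    and "iso_mor k m (f \<star> ShO (Mor K k l) g) (ShO (Mor K k m) (f \<star> g))"
  using exact_functor_ShO[OF precompose_exact[OF k l m g] f]
    exact_functor_ShO[OF postcompose_exact[OF k l m f] g] by auto

lemma inverse_pair_cancel:
  assumes k: "k \<in> Obj K" and l: "l \<in> Obj K" and uv: "inverse_pair K l u v"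
    and f: "f \<in> mor k l"
  shows "iso_mor k l (u \<star> (v \<star> f)) f"
proof -
  have "iso_mor k l ((u \<star> v) \<star> f) (One K l \<star> f)"
    using HC1_isomorphic[OF k l l _ iso_mor_refl[OF k l f]] uv
    by (simp add: inverse_pair_def)
  then show ?thesis using HC1_assoc[OF k l l l _ _ f] uv One_HC1[OF k l f]
    by (simp add: inverse_pair_def)
qed

lemma inverse_pair_HC1:
  assumes k: "k \<in> Obj K" and uv: "inverse_pair K k u v" and uv': "inverse_pair K k u' v'"
  shows "inverse_pair K k (u \<star> u') (v' \<star> v)"
proof -
  have ob: "u \<in> mor k k" "v \<in> mor k k" "u' \<in> mor k k" "v' \<in> mor k k"
    using uv uv' by (auto simp: inverse_pair_def)
  note H = HC1_Mor[OF k k k]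
  have *: "iso_mor k k ((a \<star> b) \<star> (b' \<star> a')) (One K k)"
    if "inverse_pair K k a a'" "inverse_pair K k b b'" for a b a' b'
  proof -
    have ob: "a \<in> mor k k" "a' \<in> mor k k" "b \<in> mor k k" "b' \<in> mor k k"
      and aa: "iso_mor k k (a \<star> a') (One K k)"
      using that by (auto simp: inverse_pair_def)
    have "iso_mor k k (a \<star> (b \<star> (b' \<star> a'))) (a \<star> a')"
      using HC1_isomorphic[OF k k k iso_mor_refl[OF k k ob(1)]
          inverse_pair_cancel[OF k k that(2) ob(2)]] .
    then show ?thesis
      using HC1_assoc[OF k k k k ob(1) ob(3) H[OF ob(4,2)]]
        category.isomorphic_trans[OF Mor_cat[OF k k] _ aa] by simp
  qed
  show ?thesis
    unfolding inverse_pair_def using *[OF uv uv'] *[OF inverse_pair_sym[OF uv'] inverse_pair_sym[OF uv]]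
      H ob by blast
qed

lemma inverse_pair_One: "k \<in> Obj K \<Longrightarrow> inverse_pair K k (One K k) (One K k)"
  using One_HC1[OF _ _ One_Mor] category.isomorphic_refl[OF Mor_cat One_Mor] One_Mor
  by (simp add: inverse_pair_def)

lemma inverse_pair_ShO_One:
  assumes k: "k \<in> Obj K"
  shows "inverse_pair K k (ShO (Mor K k k) (One K k)) (unshift (Mor K k k) (One K k))"
proof -
  interpret M: triangulated_category "Mor K k k" using Mor_tri[OF k k] .
  note One = One_Mor[OF k]
  note uOne = M.unshift_Ob[OF One] and sOne = M.ShO_Ob[OF One]
  show ?thesis
    unfolding inverse_pair_def
    using ShO_HC1_isomorphic(1)[OF k k k One uOne] ShO_HC1_isomorphic(2)[OF k k k uOne One]
      One_HC1[OF k k uOne] HC1_One[OF k k uOne] M.ShO_unshift[OF One] uOne sOne by simp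
qed

text \<open>Shifts of 1-morphisms bear no relation to shifts of objects, but they can be realised by
  composition with a shift of the identity, which is invertible and hence acts by an equivalence.\<close>

lemma shift_equiv_factor:
  assumes k: "k \<in> Obj K" and l: "l \<in> Obj K" and "eqv k l f g"
  shows "\<exists>u v. inverse_pair K l u v \<and> eqv l l (One K l) u \<and>
    eqv l l (One K l) v \<and> iso_mor k l f (u \<star> g)"
  using assms(3)
proof (induction rule: shift_equiv.induct)
  case (shift_equiv_iso f g)
  then show ?case
    using inverse_pair_One[OF l] eqv_refl[OF l l One_Mor[OF l]] One_HC1[OF k l]
      iso_Mor(2)[OF k l shift_equiv_iso] by metis
next
  case (shift_equiv_ShO f)
  interpret M: triangulated_category "Mor K l l" using Mor_tri[OF l l] .
  interpret MM: triangulated_category "Mor K k l" using Mor_tri[OF k l] .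
  let ?s = "ShO (Mor K l l) (One K l)" and ?u = "unshift (Mor K l l) (One K l)"
  note One = One_Mor[OF l] and us = inverse_pair_sym[OF inverse_pair_ShO_One[OF l]]
  have u: "?u \<in> mor l l" using M.unshift_Ob[OF One] .
  have "iso_mor k l (?u \<star> ShO (Mor K k l) f) (?u \<star> (?s \<star> f))"
    using HC1_isomorphic[OF k l l M.isomorphic_refl[OF u]
        MM.isomorphic_sym[OF ShO_HC1_isomorphic(1)[OF k l l One shift_equiv_ShO]]]
      One_HC1[OF k l shift_equiv_ShO] by simp
  also have "iso_mor k l (?u \<star> (?s \<star> f)) f"
    using inverse_pair_cancel[OF k l us shift_equiv_ShO] .
  finally have "iso_mor k l f (?u \<star> ShO (Mor K k l) f)" by (rule MM.isomorphic_sym)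
  then show ?case
    using us shift_equiv.shift_equiv_ShO[OF One] M.shift_equiv_unshift[OF One] by blast
next
  case (shift_equiv_sym f g)
  interpret MM: triangulated_category "Mor K k l" using Mor_tri[OF k l] .
  interpret M: triangulated_category "Mor K l l" using Mor_tri[OF l l] .
  obtain u v where uv: "inverse_pair K l u v" "eqv l l (One K l) u"
      "eqv l l (One K l) v" and iso: "iso_mor k l f (u \<star> g)"
    using shift_equiv_sym.IH by blast
  have v: "v \<in> mor l l" using uv(1) by (simp add: inverse_pair_def)
  have g: "g \<in> mor k l" using MM.shift_equiv_Ob[OF shift_equiv_sym.hyps] by simp
  have "iso_mor k l (v \<star> f) (v \<star> (u \<star> g))"
    using HC1_isomorphic[OF k l l M.isomorphic_refl[OF v] iso] .
  also have "iso_mor k l (v \<star> (u \<star> g)) g"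
    using inverse_pair_cancel[OF k l inverse_pair_sym[OF uv(1)] g] .
  finally have "iso_mor k l g (v \<star> f)" by (rule MM.isomorphic_sym)
  then show ?case using inverse_pair_sym[OF uv(1)] uv(2,3) by blast
next
  case (shift_equiv_trans f g h)
  interpret MM: triangulated_category "Mor K k l" using Mor_tri[OF k l] .
  interpret M: triangulated_category "Mor K l l" using Mor_tri[OF l l] .
  obtain u v where uv: "inverse_pair K l u v" "eqv l l (One K l) u"
      "eqv l l (One K l) v" and iso: "iso_mor k l f (u \<star> g)"
    using shift_equiv_trans.IH(1) by blast
  obtain u' v' where uv': "inverse_pair K l u' v'" "eqv l l (One K l) u'"
      "eqv l l (One K l) v'" and iso': "iso_mor k l g (u' \<star> h)"
    using shift_equiv_trans.IH(2) by blast
  have u: "u \<in> mor l l" "u' \<in> mor l l" using uv(1) uv'(1) by (simp_all add: inverse_pair_def)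
  have h: "h \<in> mor k l" using MM.shift_equiv_Ob[OF shift_equiv_trans.hyps(2)] by simp
  have "iso_mor k l f (u \<star> (u' \<star> h))"
    using MM.isomorphic_trans[OF iso HC1_isomorphic[OF k l l M.isomorphic_refl[OF u(1)] iso']] .
  then have "iso_mor k l f ((u \<star> u') \<star> h)" using HC1_assoc[OF k l l l u h] by simp
  moreover have "eqv l l (One K l) (u \<star> u')" "eqv l l (One K l) (v' \<star> v)"
    using HC1_shift_equiv[OF l l l uv(2) uv'(2)] HC1_shift_equiv[OF l l l uv'(3) uv(3)]
      One_HC1[OF l l One_Mor[OF l]] by simp_all
  ultimately show ?case using inverse_pair_HC1[OF l uv(1) uv'(1)] by blast
qed

text \<open>The definition of an integral power distinguishes signs; up to isomorphism it is uniform.\<close>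

lemma int_power_step:
  assumes k: "k \<in> Obj K" and uv: "inverse_pair K k u v"
  shows "int_power K u v k n \<in> mor k k"
    and "iso_mor k k (u \<star> int_power K u v k n) (int_power K u v k (n + 1))"
    and "iso_mor k k (v \<star> int_power K u v k n) (int_power K u v k (n - 1))"
proof -
  have u: "u \<in> mor k k" and v: "v \<in> mor k k" using uv by (auto simp: inverse_pair_def)
  have pu: "(HC1 K u ^^ i) (One K k) \<in> mor k k" for i
    by (induction i) (use One_Mor[OF k] HC1_Mor[OF k k k u] in auto)
  have pv: "(HC1 K v ^^ i) (One K k) \<in> mor k k" for i
    by (induction i) (use One_Mor[OF k] HC1_Mor[OF k k k v] in auto)
  show P: "int_power K u v k n \<in> mor k k" for n
    unfolding int_power_def using pu pv by simp
  note refl = category.isomorphic_refl[OF Mor_cat[OF k k]]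
  show "iso_mor k k (u \<star> int_power K u v k n) (int_power K u v k (n + 1))"
  proof (cases "0 \<le> n")
    case True
    then have "int_power K u v k (n + 1) = u \<star> int_power K u v k n"
      by (simp add: int_power_def nat_add_distrib)
    then show ?thesis using refl P by metis
  next
    case False
    then have "nat (- n) = Suc (nat (- (n + 1)))" by simp
    then have "int_power K u v k n = v \<star> int_power K u v k (n + 1)"
      using False by (cases "n = - 1") (simp_all add: int_power_def)
    then show ?thesis using inverse_pair_cancel[OF k k uv P] by simp
  qed
  show "iso_mor k k (v \<star> int_power K u v k n) (int_power K u v k (n - 1))"
  proof (cases "0 < n")
    case True
    then have "nat n = Suc (nat (n - 1))" by simp
    then have "int_power K u v k n = u \<star> int_power K u v k (n - 1)"
      using True by (simp add: int_power_def)
    then show ?thesis using inverse_pair_cancel[OF k k inverse_pair_sym[OF uv] P] by simp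
  next
    case False
    then have "nat (- (n - 1)) = Suc (nat (- n))" by simp
    then have "int_power K u v k (n - 1) = v \<star> int_power K u v k n"
      using False by (cases "n = 0") (simp_all add: int_power_def)
    then show ?thesis using refl P by metis
  qed
qed

lemma int_power_add:
  assumes k: "k \<in> Obj K" and uv: "inverse_pair K k u v"
  shows "iso_mor k k (int_power K u v k m \<star> int_power K u v k n) (int_power K u v k (m + n))"
proof -
  interpret M: triangulated_category "Mor K k k" using Mor_tri[OF k k] .
  let ?P = "int_power K u v k"
  note P = int_power_step(1)[OF k uv]
  have ob: "u \<in> mor k k" "v \<in> mor k k" using uv by (auto simp: inverse_pair_def)
  have step: "iso_mor k k (?P m' \<star> ?P n) (?P (m' + n))"
    if w: "w \<in> mor k k" and wP: "\<And>n. iso_mor k k (w \<star> ?P n) (?P (n + d))"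
      and m': "m' = m + d" and IH: "iso_mor k k (?P m \<star> ?P n) (?P (m + n))" for w d m m'
  proof -
    have "iso_mor k k (?P m' \<star> ?P n) ((w \<star> ?P m) \<star> ?P n)"
      unfolding m' using HC1_isomorphic[OF k k k M.isomorphic_sym[OF wP] M.isomorphic_refl[OF P]] .
    also have "(w \<star> ?P m) \<star> ?P n = w \<star> (?P m \<star> ?P n)" using HC1_assoc[OF k k k k w P P] .
    also have "iso_mor k k \<dots> (w \<star> ?P (m + n))"
      using HC1_isomorphic[OF k k k M.isomorphic_refl[OF w] IH] .
    also have "iso_mor k k \<dots> (?P (m + n + d))" using wP .
    also have "m + n + d = m' + n" using m' by simp
    finally show ?thesis .
  qed
  show ?thesis
  proof (induction m rule: int_induct[where k = 0])
    case base
    show ?case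
      using One_HC1[OF k k P] M.isomorphic_refl[OF P] by (simp add: int_power_def)
  next
    case (step1 i)
    show ?case
      by (rule step[OF ob(1), of 1 _ i]) (use int_power_step(2)[OF k uv] step1 in auto)
  next
    case (step2 i)
    show ?case
      by (rule step[OF ob(2), of "- 1" _ i]) (use int_power_step(3)[OF k uv] step2 in auto)
  qed
qed

lemma int_power_inverse_pair:
  assumes k: "k \<in> Obj K" and uv: "inverse_pair K k u v"
  shows "inverse_pair K k (int_power K u v k n) (int_power K u v k (- n))"
  using int_power_add[OF assms, of n "- n"] int_power_add[OF assms, of "- n" n]
    int_power_step(1)[OF assms] by (simp add: inverse_pair_def int_power_def[of K u v k 0])

end

section \<open>From 1-morphisms to functors\<close>

context concrete_triangulated_2_category
begin

lemma Cat_cat: "k \<in> Obj K \<Longrightarrow> category (Cat K k)"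
  using Cat_triangulated triangulated_category.axioms(1) additive_category.axioms(1)
    preadditive_category.axioms(1) by blast

lemma Act_functor:
  "k \<in> Obj K \<Longrightarrow> l \<in> Obj K \<Longrightarrow> f \<in> mor k l \<Longrightarrow>
    is_functor (Cat K k) (Cat K l) (ActO K f) (ActA K f)"
  using exact_functorD(1)[OF Act_exact] .

lemma isomorphic_nat_iso:
  assumes k: "k \<in> Obj K" and l: "l \<in> Obj K" and iso: "iso_mor k l f g"
  shows "nat_iso (Cat K k) (Cat K l) (ActO K f) (ActA K f) (ActO K g) (ActA K g)"
proof -
  interpret D: category "Cat K l" using Cat_cat[OF l] .
  obtain s t where st: "s \<in> Hom (Mor K k l) f g" "t \<in> Hom (Mor K k l) g f"
    "t \<cdot>\<^bsub>Mor K k l\<^esub> s = Idn (Mor K k l) f" "s \<cdot>\<^bsub>Mor K k l\<^esub> t = Idn (Mor K k l) g"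
    using category.isomorphicE[OF Mor_cat[OF k l] iso] by metis
  note ob = iso_Mor[OF k l iso]
  have "iso_arr (Cat K l) (Nat K s X)" if X: "X \<in> Ob (Cat K k)" for X
  proof (rule D.iso_arrI[OF Nat_Hom[OF k l st(1) X] Nat_Hom[OF k l st(2) X]])
    show "Nat K t X \<cdot>\<^bsub>Cat K l\<^esub> Nat K s X = Idn (Cat K l) (ActO K f X)"
      using Nat_Cmp[OF k l st(1,2) X] st(3) Nat_Idn[OF k l ob(1) X] by metis
    show "Nat K s X \<cdot>\<^bsub>Cat K l\<^esub> Nat K t X = Idn (Cat K l) (ActO K g X)"
      using Nat_Cmp[OF k l st(2,1) X] st(4) Nat_Idn[OF k l ob(2) X] by metis
  qed
  then show ?thesis
    unfolding nat_iso_def using Nat_Hom[OF k l st(1)] Nat_natural[OF k l st(1)] by blast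
qed

text \<open>A zero 1-morphism has its identity equal to its zero 2-morphism, and additivity of \<open>Nat\<close> turns
  this into the same equation for objects.\<close>

lemma ActO_zero_object:
  assumes k: "k \<in> Obj K" and l: "l \<in> Obj K" and f: "zero_mor k l f"
    and X: "X \<in> Ob (Cat K k)"
  shows "zero_object (Cat K l) (ActO K f X)"
proof -
  interpret D: triangulated_category "Cat K l" using Cat_triangulated[OF l] .
  interpret M: triangulated_category "Mor K k l" using Mor_tri[OF k l] .
  let ?z = "Zer (Mor K k l) f f"
  have fO: "f \<in> mor k l" and z: "Idn (Mor K k l) f = ?z" using f by (simp_all add: M.zero_object_iff)
  note zH = M.Zer_Hom[OF fO fO]
  have "Nat K ?z X = Zer (Cat K l) (ActO K f X) (ActO K f X)"
    using D.Zer_unique[OF Nat_Hom[OF k l zH X]] Nat_Add[OF k l zH zH X] M.Add_Zer[OF fO fO] by simp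
  then show ?thesis
    using Nat_Idn[OF k l fO X] z is_functor_Ob[OF Act_functor[OF k l fO] X]
    by (simp add: D.zero_object_iff)
qed

abbreviation adjunction :: "'w \<Rightarrow> 'w \<Rightarrow> 'f \<Rightarrow> 'f \<Rightarrow> bool" where
  "adjunction k l f g \<equiv>
     hom_adjunction (Cat K k) (Cat K l) (ActO K f) (ActA K f) (ActO K g) (ActA K g)"

lemma adjunction_HC1:
  assumes k: "k \<in> Obj K" and l: "l \<in> Obj K" and m: "m \<in> Obj K"
    and ob: "f \<in> mor k l" "g \<in> mor l k" "f' \<in> mor l m" "g' \<in> mor m l"
    and adj: "adjunction k l f g" "adjunction l m f' g'"
  shows "adjunction k m (f' \<star> f) (g \<star> g')"
proof -
  have "hom_adjunction (Cat K k) (Cat K m) (\<lambda>X. ActO K f' (ActO K f X)) (\<lambda>a. ActA K f' (ActA K f a))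
      (\<lambda>X. ActO K g (ActO K g' X)) (\<lambda>a. ActA K g (ActA K g' a))"
    using hom_adjunction_compose[OF Cat_cat[OF k] Cat_cat[OF l] Cat_cat[OF m]
        Act_functor[OF k l ob(1)] Act_functor[OF m l ob(4)] adj] .
  then show ?thesis
    by (rule hom_adjunction_cong[OF _ Cat_cat[OF k] Cat_cat[OF m]])
      (use ActO_HC1[OF k l m ob(3,1)] ActA_HC1[OF k l m ob(3,1)]
        ActO_HC1[OF m l k ob(2,4)] ActA_HC1[OF m l k ob(2,4)] in auto)
qed

lemma adjunction_isomorphic_right:
  assumes k: "k \<in> Obj K" and l: "l \<in> Obj K" and f: "f \<in> mor k l"
    and adj: "adjunction k l f g" and iso: "iso_mor l k g g'"
  shows "adjunction k l f g'"
  using hom_adjunction_nat_iso_right[OF Cat_cat[OF k] Cat_cat[OF l]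
      Act_functor[OF l k iso_Mor(1)[OF l k iso]] Act_functor[OF l k iso_Mor(2)[OF l k iso]] adj
      isomorphic_nat_iso[OF l k iso] Act_functor[OF k l f]] .

lemma inverse_pair_nat_iso:
  assumes k: "k \<in> Obj K" and uv: "inverse_pair K k u v"
  shows "nat_iso (Cat K k) (Cat K k) (\<lambda>X. ActO K u (ActO K v X)) (\<lambda>a. ActA K u (ActA K v a))
    (\<lambda>X. X) (\<lambda>a. a)"
proof -
  have ob: "u \<in> mor k k" "v \<in> mor k k"
    and iso: "iso_mor k k (u \<star> v) (One K k)"
    using uv by (auto simp: inverse_pair_def)
  interpret C: category "Cat K k" using Cat_cat[OF k] .
  have arr: "a \<in> Hom (Cat K k) X Y \<Longrightarrow> a \<in> Arr (Cat K k)" for a X Y by (simp add: Hom_def)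
  obtain \<alpha> where a: "\<And>X. X \<in> Ob (Cat K k) \<Longrightarrow>
      \<alpha> X \<in> Hom (Cat K k) (ActO K (u \<star> v) X) (ActO K (One K k) X) \<and> iso_arr (Cat K k) (\<alpha> X)"
    and nat: "\<And>X Y a. a \<in> Hom (Cat K k) X Y \<Longrightarrow>
      \<alpha> Y \<cdot>\<^bsub>Cat K k\<^esub> ActA K (u \<star> v) a = ActA K (One K k) a \<cdot>\<^bsub>Cat K k\<^esub> \<alpha> X"
    using isomorphic_nat_iso[OF k k iso] unfolding nat_iso_def by blast
  show ?thesis
    unfolding nat_iso_def
  proof (intro exI[of _ \<alpha>] conjI ballI allI)
    fix X assume "X \<in> Ob (Cat K k)"
    then show "\<alpha> X \<in> Hom (Cat K k) (ActO K u (ActO K v X)) X" "iso_arr (Cat K k) (\<alpha> X)"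
      using a[of X] ActO_HC1[OF k k k ob] ActO_One[OF k] by simp_all
  next
    fix X Y a assume a: "a \<in> Hom (Cat K k) X Y"
    show "\<alpha> Y \<cdot>\<^bsub>Cat K k\<^esub> ActA K u (ActA K v a) = a \<cdot>\<^bsub>Cat K k\<^esub> \<alpha> X"
      using nat[OF a] ActA_HC1[OF k k k ob arr[OF a]] ActA_One[OF k arr[OF a]] by simp
  qed
qed

lemma inverse_pair_adjunction:
  assumes k: "k \<in> Obj K" and uv: "inverse_pair K k u v"
  shows "adjunction k k u v" "fully_faithful (Cat K k) (Cat K k) (ActO K u) (ActA K u)"
proof -
  have ob: "u \<in> mor k k" "v \<in> mor k k"
    using uv by (auto simp: inverse_pair_def)
  note args = Cat_cat[OF k] Cat_cat[OF k] Act_functor[OF k k ob(1)] Act_functor[OF k k ob(2)]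
    inverse_pair_nat_iso[OF k inverse_pair_sym[OF uv]] inverse_pair_nat_iso[OF k uv]
  show "adjunction k k u v" using hom_adjunction_of_equivalence[OF args] .
  show "fully_faithful (Cat K k) (Cat K k) (ActO K u) (ActA K u)"
    using fully_faithful_of_equivalence[OF args] .
qed

lemma is_right_adjoint_adjunction:
  assumes k: "k \<in> Obj K" and l: "l \<in> Obj K" and "is_right_adjoint K k l f g"
  shows "adjunction k l f g"
proof -
  interpret C: category "Cat K k" using Cat_cat[OF k] .
  interpret D: category "Cat K l" using Cat_cat[OF l] .
  obtain \<eta> \<epsilon> where f: "f \<in> mor k l" and g: "g \<in> mor l k"
    and h: "\<eta> \<in> Hom (Mor K k k) (One K k) (g \<star> f)" and e: "\<epsilon> \<in> Hom (Mor K l l) (f \<star> g) (One K l)"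
    and tri1: "(\<epsilon> \<diamondop> Idn (Mor K k l) f) \<cdot>\<^bsub>Mor K k l\<^esub> (Idn (Mor K k l) f \<diamondop> \<eta>) = Idn (Mor K k l) f"
    and tri2: "(Idn (Mor K l k) g \<diamondop> \<epsilon>) \<cdot>\<^bsub>Mor K l k\<^esub> (\<eta> \<diamondop> Idn (Mor K l k) g) = Idn (Mor K l k) g"
    using assms(3) unfolding is_right_adjoint_def by blast
  note If = category.Idn_Hom[OF Mor_cat[OF k l] f] and Ig = category.Idn_Hom[OF Mor_cat[OF l k] g]
  note Ff = Act_functor[OF k l f] and Gf = Act_functor[OF l k g]
  note FO = is_functor_Ob[OF Ff] and GO = is_functor_Ob[OF Gf]
  note FH = is_functor_Hom[OF Cat_cat[OF k] Ff] and GH = is_functor_Hom[OF Cat_cat[OF l] Gf]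
  note FC = is_functor_Cmp[OF Cat_cat[OF k] Ff] and GC = is_functor_Cmp[OF Cat_cat[OF l] Gf]
  have arr: "a \<in> Hom c X Y \<Longrightarrow> a \<in> Arr c" for a X Y c by (simp add: Hom_def)
  have eta: "Nat K \<eta> X \<in> Hom (Cat K k) X (ActO K g (ActO K f X))" if "X \<in> Ob (Cat K k)" for X
    using Nat_Hom[OF k k h that] ActO_One[OF k that] ActO_HC1[OF k l k g f that] by simp
  have eps: "Nat K \<epsilon> Y \<in> Hom (Cat K l) (ActO K f (ActO K g Y)) Y" if "Y \<in> Ob (Cat K l)" for Y
    using Nat_Hom[OF l l e that] ActO_One[OF l that] ActO_HC1[OF l k l f g that] by simp
  have eta_nat: "Nat K \<eta> X' \<cdot>\<^bsub>Cat K k\<^esub> a = ActA K g (ActA K f a) \<cdot>\<^bsub>Cat K k\<^esub> Nat K \<eta> X"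
    if "a \<in> Hom (Cat K k) X X'" for X X' a
    using Nat_natural[OF k k h that] ActA_One[OF k arr[OF that]] ActA_HC1[OF k l k g f arr[OF that]]
    by simp
  have eps_nat: "Nat K \<epsilon> Y' \<cdot>\<^bsub>Cat K l\<^esub> ActA K f (ActA K g a) = a \<cdot>\<^bsub>Cat K l\<^esub> Nat K \<epsilon> Y"
    if "a \<in> Hom (Cat K l) Y Y'" for Y Y' a
    using Nat_natural[OF l l e that] ActA_One[OF l arr[OF that]] ActA_HC1[OF l k l f g arr[OF that]]
    by simp
  have t1: "Nat K \<epsilon> (ActO K f X) \<cdot>\<^bsub>Cat K l\<^esub> ActA K f (Nat K \<eta> X) = Idn (Cat K l) (ActO K f X)"
    if X: "X \<in> Ob (Cat K k)" for X
  proof -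
    have s: "Idn (Mor K k l) f \<diamondop> \<eta> \<in> Hom (Mor K k l) f (f \<star> (g \<star> f))"
      using HC2_Hom[OF k k l If h] HC1_One[OF k l f] by simp
    have t: "\<epsilon> \<diamondop> Idn (Mor K k l) f \<in> Hom (Mor K k l) (f \<star> (g \<star> f)) f"
      using HC2_Hom[OF k l l e If] One_HC1[OF k l f] HC1_assoc[OF k l k l f g f] by simp
    have FX: "ActO K f X \<in> Ob (Cat K l)" using FO[OF X] .
    have "Nat K (\<epsilon> \<diamondop> Idn (Mor K k l) f) X = Nat K \<epsilon> (ActO K f X)"
      using Nat_HC2[OF k l l e If X] Nat_Idn[OF k l f X]
        is_functor_Idn[OF Act_functor[OF l l HC1_Mor[OF l k l f g]] FX]
        D.Cmp_Idn[OF Nat_Hom[OF l l e FX]] by simp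
    moreover have "Nat K (Idn (Mor K k l) f \<diamondop> \<eta>) X = ActA K f (Nat K \<eta> X)"
      using Nat_HC2[OF k k l If h X] Nat_Idn[OF k l f] is_functor_Ob[OF Act_functor[OF k k HC1_Mor[OF k l k g f]] X]
        D.Idn_Cmp[OF FH[OF Nat_Hom[OF k k h X]]] by simp
    ultimately show ?thesis using Nat_Cmp[OF k l s t X] tri1 Nat_Idn[OF k l f X] by simp
  qed
  have t2: "ActA K g (Nat K \<epsilon> Y) \<cdot>\<^bsub>Cat K k\<^esub> Nat K \<eta> (ActO K g Y) = Idn (Cat K k) (ActO K g Y)"
    if Y: "Y \<in> Ob (Cat K l)" for Y
  proof -
    have s: "\<eta> \<diamondop> Idn (Mor K l k) g \<in> Hom (Mor K l k) g (g \<star> (f \<star> g))"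
      using HC2_Hom[OF l k k h Ig] One_HC1[OF l k g] HC1_assoc[OF l k l k g f g] by simp
    have t: "Idn (Mor K l k) g \<diamondop> \<epsilon> \<in> Hom (Mor K l k) (g \<star> (f \<star> g)) g"
      using HC2_Hom[OF l l k Ig e] HC1_One[OF l k g] by simp
    have GY: "ActO K g Y \<in> Ob (Cat K k)" using GO[OF Y] .
    have "Nat K (\<eta> \<diamondop> Idn (Mor K l k) g) Y = Nat K \<eta> (ActO K g Y)"
      using Nat_HC2[OF l k k h Ig Y] Nat_Idn[OF l k g Y] ActA_One[OF k arr[OF C.Idn_Hom[OF GY]]]
        C.Cmp_Idn[OF eta[OF GY]] by simp
    moreover have "Nat K (Idn (Mor K l k) g \<diamondop> \<epsilon>) Y = ActA K g (Nat K \<epsilon> Y)"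
      using Nat_HC2[OF l l k Ig e Y] Nat_Idn[OF l k g] ActO_One[OF l Y] Y
        C.Idn_Cmp[OF GH[OF eps[OF Y]]] by simp
    ultimately show ?thesis using Nat_Cmp[OF l k s t Y] tri2 Nat_Idn[OF l k g Y] by simp
  qed
  show ?thesis
  proof (rule hom_adjunctionI[where \<phi>="\<lambda>X Y t. ActA K g t \<cdot>\<^bsub>Cat K k\<^esub> Nat K \<eta> X"])
    fix X Y assume X: "X \<in> Ob (Cat K k)" and Y: "Y \<in> Ob (Cat K l)"
    show "bij_betw (\<lambda>t. ActA K g t \<cdot>\<^bsub>Cat K k\<^esub> Nat K \<eta> X)
        (Hom (Cat K l) (ActO K f X) Y) (Hom (Cat K k) X (ActO K g Y))"
    proof (rule bij_betw_byWitness[where f'="\<lambda>s. Nat K \<epsilon> Y \<cdot>\<^bsub>Cat K l\<^esub> ActA K f s"]; safe)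
      fix t assume t: "t \<in> Hom (Cat K l) (ActO K f X) Y"
      note FX = FO[OF X]
      show "ActA K g t \<cdot>\<^bsub>Cat K k\<^esub> Nat K \<eta> X \<in> Hom (Cat K k) X (ActO K g Y)"
        using C.Cmp_Hom[OF eta[OF X] GH[OF t]] .
      show "Nat K \<epsilon> Y \<cdot>\<^bsub>Cat K l\<^esub> ActA K f (ActA K g t \<cdot>\<^bsub>Cat K k\<^esub> Nat K \<eta> X) = t"
        using FC[OF eta[OF X] GH[OF t]] D.Cmp_assoc[OF FH[OF eta[OF X]] FH[OF GH[OF t]] eps[OF Y]]
          eps_nat[OF t] D.Cmp_assoc[OF FH[OF eta[OF X]] eps[OF FX] t] t1[OF X] D.Cmp_Idn[OF t]
        by simp
    next
      fix s assume s: "s \<in> Hom (Cat K k) X (ActO K g Y)"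
      note GY = GO[OF Y]
      show "Nat K \<epsilon> Y \<cdot>\<^bsub>Cat K l\<^esub> ActA K f s \<in> Hom (Cat K l) (ActO K f X) Y"
        using D.Cmp_Hom[OF FH[OF s] eps[OF Y]] .
      show "ActA K g (Nat K \<epsilon> Y \<cdot>\<^bsub>Cat K l\<^esub> ActA K f s) \<cdot>\<^bsub>Cat K k\<^esub> Nat K \<eta> X = s"
        using GC[OF FH[OF s] eps[OF Y]] C.Cmp_assoc[OF eta[OF X] GH[OF FH[OF s]] GH[OF eps[OF Y]]]
          eta_nat[OF s] C.Cmp_assoc[OF s eta[OF GY] GH[OF eps[OF Y]]] t2[OF Y] C.Idn_Cmp[OF s]
        by simp
    qed
  next
    fix X X' Y a t assume a: "a \<in> Hom (Cat K k) X' X" and t: "t \<in> Hom (Cat K l) (ActO K f X) Y"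
    note ob = C.Hom_Ob[OF a]
    show "ActA K g (t \<cdot>\<^bsub>Cat K l\<^esub> ActA K f a) \<cdot>\<^bsub>Cat K k\<^esub> Nat K \<eta> X' =
        (ActA K g t \<cdot>\<^bsub>Cat K k\<^esub> Nat K \<eta> X) \<cdot>\<^bsub>Cat K k\<^esub> a"
      using GC[OF FH[OF a] t] C.Cmp_assoc[OF eta[OF ob(1)] GH[OF FH[OF a]] GH[OF t]] eta_nat[OF a]
        C.Cmp_assoc[OF a eta[OF ob(2)] GH[OF t]] by simp
  next
    fix X Y Y' b t assume X: "X \<in> Ob (Cat K k)" and b: "b \<in> Hom (Cat K l) Y Y'"
      and t: "t \<in> Hom (Cat K l) (ActO K f X) Y"
    show "ActA K g (b \<cdot>\<^bsub>Cat K l\<^esub> t) \<cdot>\<^bsub>Cat K k\<^esub> Nat K \<eta> X =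
        ActA K g b \<cdot>\<^bsub>Cat K k\<^esub> (ActA K g t \<cdot>\<^bsub>Cat K k\<^esub> Nat K \<eta> X)"
      using GC[OF t b] C.Cmp_assoc[OF eta[OF X] GH[OF t] GH[OF b]] by simp
  qed
qed

lemma adjunction_fully_faithful:
  assumes k: "k \<in> Obj K" and l: "l \<in> Obj K" and f: "f \<in> mor k l" and g: "g \<in> mor l k"
    and adj: "adjunction l k g f" and one: "eqv k k (g \<star> f) (One K k)"
  shows "fully_faithful (Cat K k) (Cat K l) (ActO K f) (ActA K f)"
proof -
  obtain u v where uv: "inverse_pair K k u v" and iso: "iso_mor k k (g \<star> f) (u \<star> One K k)"
    using shift_equiv_factor[OF k k one] by blast
  have u: "u \<in> mor k k" using uv by (simp add: inverse_pair_def)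
  have arr: "a \<in> Hom (Cat K k) X Y \<Longrightarrow> a \<in> Arr (Cat K k)" for a X Y by (simp add: Hom_def)
  have "nat_iso (Cat K k) (Cat K k) (ActO K (g \<star> f)) (ActA K (g \<star> f)) (ActO K u) (ActA K u)"
    using isomorphic_nat_iso[OF k k iso] HC1_One[OF k k u] by simp
  then have "nat_iso (Cat K k) (Cat K k) (\<lambda>X. ActO K g (ActO K f X)) (\<lambda>a. ActA K g (ActA K f a))
      (ActO K u) (ActA K u)"
    using ActO_HC1[OF k l k g f] ActA_HC1[OF k l k g f arr] unfolding nat_iso_def by simp
  then show ?thesis
    using fully_faithful_of_left_adjoint[OF Cat_cat[OF k] Cat_cat[OF l] Act_functor[OF k l f]
        Act_functor[OF l k g] adj inverse_pair_adjunction(2)[OF k uv]] by blast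
qed

lemma adjunction_orthogonal:
  assumes k: "k \<in> Obj K" and l: "l \<in> Obj K" and f: "f \<in> mor k l" and g: "g \<in> mor l k"
    and f': "f' \<in> mor k l"
    and adj: "adjunction l k g f" and zero: "zero_mor k k (g \<star> f')"
    and X: "X \<in> Ob (Cat K k)" and Y: "Y \<in> Ob (Cat K k)"
  shows "Hom (Cat K l) (ActO K f' X) (ActO K f Y) = {Zer (Cat K l) (ActO K f' X) (ActO K f Y)}"
proof -
  interpret C: triangulated_category "Cat K k" using Cat_triangulated[OF k] .
  interpret D: triangulated_category "Cat K l" using Cat_triangulated[OF l] .
  have FX: "ActO K f' X \<in> Ob (Cat K l)" using is_functor_Ob[OF Act_functor[OF k l f'] X] .
  have FY: "ActO K f Y \<in> Ob (Cat K l)" using is_functor_Ob[OF Act_functor[OF k l f] Y] .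
  have "zero_object (Cat K k) (ActO K g (ActO K f' X))"
    using ActO_zero_object[OF k k zero X] ActO_HC1[OF k l k g f' X] by simp
  from C.zero_object_orthogonal(1)[OF this Y]
  have G: "\<exists>z. Hom (Cat K k) (ActO K g (ActO K f' X)) Y = {z}" by blast
  obtain \<phi> where "bij_betw \<phi> (Hom (Cat K k) (ActO K g (ActO K f' X)) Y)
      (Hom (Cat K l) (ActO K f' X) (ActO K f Y))"
    using adj adjunction_bijectionD(1)[OF _ FX Y] unfolding hom_adjunction_def by blast
  then have "\<exists>z. Hom (Cat K l) (ActO K f' X) (ActO K f Y) = {z}"
    using G by (metis bij_betw_imp_surj_on image_empty image_insert)
  then show ?thesis using D.Zer_Hom[OF FX FY] by auto
qed

end

section \<open>Crossing \<open>E\<close> and \<open>F\<close>\<close>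

lemma wt_add_wt_add: "wt_add (wt_add k m) n = wt_add k (m + n)"
  and wt_add_0: "wt_add k 0 = k"
  by (simp_all add: wt_add_def)

lemma weights_all: "k \<in> weights N \<Longrightarrow> k \<in> all_weights N"
  by (auto simp: weights_def all_weights_def)

lemma wt_add_all: "k \<in> all_weights N \<Longrightarrow> wt_add k n \<in> all_weights N"
  by (auto simp: all_weights_def wt_add_def)

context partial_categorical_action
begin

abbreviation \<Psi> :: "int \<Rightarrow> weight \<Rightarrow> 'f" where
  "\<Psi> n k \<equiv> PsiM_pow A n k"

text \<open>Twisting by \<open>n\<close> changes the index of \<open>E\<close> by \<open>n\<close> and the index of \<open>F\<close> by \<open>-n\<close>, up to shift.\<close>

definition twist :: "weight \<Rightarrow> weight \<Rightarrow> int \<Rightarrow> 'f \<Rightarrow> 'f" where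
  "twist k l n f = \<Psi> n l \<star> (f \<star> \<Psi> (- n) k)"

lemma weight_Obj: "k \<in> all_weights N \<Longrightarrow> k \<in> Obj A"
  by (simp add: Obj_weights)

lemma \<Psi>_Mor: "k \<in> all_weights N \<Longrightarrow> \<Psi> n k \<in> mor k k"
  and \<Psi>_add: "k \<in> all_weights N \<Longrightarrow> iso_mor k k (\<Psi> m k \<star> \<Psi> n k) (\<Psi> (m + n) k)"
  and \<Psi>_inverse_pair: "k \<in> all_weights N \<Longrightarrow> inverse_pair A k (\<Psi> n k) (\<Psi> (- n) k)"
proof -
  assume k: "k \<in> all_weights N"
  have "inverse_pair A k (PsiM A k) (PsiM_inv A k)"
    using PsiM_Mor[OF k] PsiM_inv_Mor[OF k] PsiM_inverse[OF k] by (simp add: inverse_pair_def)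
  note * = weight_Obj[OF k] this
  show "\<Psi> n k \<in> mor k k" "iso_mor k k (\<Psi> m k \<star> \<Psi> n k) (\<Psi> (m + n) k)"
    "inverse_pair A k (\<Psi> n k) (\<Psi> (- n) k)"
    using int_power_step(1)[OF *] int_power_add[OF *] int_power_inverse_pair[OF *]
    by (simp_all add: PsiM_pow_def)
qed

lemma \<Psi>_0: "\<Psi> 0 k = One A k"
  by (simp add: PsiM_pow_def int_power_def)

lemma \<Psi>_1: "k \<in> all_weights N \<Longrightarrow> \<Psi> 1 k = PsiM A k"
  using HC1_One[OF weight_Obj weight_Obj PsiM_Mor] by (simp add: PsiM_pow_def int_power_def)

lemma \<Psi>_\<Psi>:
  assumes k: "k \<in> all_weights N" and l: "l \<in> all_weights N" and f: "f \<in> mor k l"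
  shows "iso_mor k l (\<Psi> m l \<star> (\<Psi> n l \<star> f)) (\<Psi> (m + n) l \<star> f)"
proof -
  note kO = weight_Obj[OF k] and lO = weight_Obj[OF l]
  show ?thesis
    using HC1_isomorphic[OF kO lO lO \<Psi>_add[OF l] iso_mor_refl[OF kO lO f]]
      HC1_assoc[OF kO lO lO lO \<Psi>_Mor[OF l] \<Psi>_Mor[OF l] f] by simp
qed

lemma \<Psi>_cancel:
  assumes k: "k \<in> all_weights N" and l: "l \<in> all_weights N" and f: "f \<in> mor k l"
    and "m + n = 0"
  shows "iso_mor k l (\<Psi> m l \<star> (\<Psi> n l \<star> f)) f"
  using \<Psi>_\<Psi>[OF k l f, of m n] assms(4) One_HC1[OF weight_Obj[OF k] weight_Obj[OF l] f]
  by (simp add: \<Psi>_0)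

lemma twist_Mor:
  assumes k: "k \<in> all_weights N" and l: "l \<in> all_weights N" and f: "f \<in> mor k l"
  shows "twist k l n f \<in> mor k l"
proof -
  note kO = weight_Obj[OF k] and lO = weight_Obj[OF l]
  show ?thesis
    unfolding twist_def
    using HC1_Mor[OF kO lO lO \<Psi>_Mor[OF l] HC1_Mor[OF kO kO lO f \<Psi>_Mor[OF k]]] .
qed

lemma twist_0:
  assumes k: "k \<in> all_weights N" and l: "l \<in> all_weights N" and f: "f \<in> mor k l"
  shows "twist k l 0 f = f"
  using HC1_One[OF weight_Obj[OF k] weight_Obj[OF l] f] One_HC1[OF weight_Obj[OF k] weight_Obj[OF l] f]
  by (simp add: twist_def \<Psi>_0)

lemma twist_twist:
  assumes k: "k \<in> all_weights N" and l: "l \<in> all_weights N" and f: "f \<in> mor k l"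
  shows "iso_mor k l (twist k l m (twist k l n f)) (twist k l (m + n) f)"
proof -
  note kO = weight_Obj[OF k] and lO = weight_Obj[OF l]
  interpret M: category "Mor A k l" using Mor_cat[OF kO lO] .
  note P = \<Psi>_Mor[OF k] and Q = \<Psi>_Mor[OF l]
  have fP: "f \<star> \<Psi> i k \<in> mor k l" for i using HC1_Mor[OF kO kO lO f P] .
  have "twist k l m (twist k l n f) = \<Psi> m l \<star> (\<Psi> n l \<star> (f \<star> (\<Psi> (- n) k \<star> \<Psi> (- m) k)))"
    unfolding twist_def using HC1_assoc[OF kO kO lO lO Q fP P] HC1_assoc[OF kO kO kO lO f P P] by simp
  also have "iso_mor k l \<dots> (\<Psi> (m + n) l \<star> (f \<star> (\<Psi> (- n) k \<star> \<Psi> (- m) k)))"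
    using \<Psi>_\<Psi>[OF k l HC1_Mor[OF kO kO lO f HC1_Mor[OF kO kO kO P P]]] .
  also have "iso_mor k l \<dots> (\<Psi> (m + n) l \<star> (f \<star> \<Psi> (- n + - m) k))"
    using HC1_isomorphic[OF kO lO lO iso_mor_refl[OF lO lO Q]
        HC1_isomorphic[OF kO kO lO M.isomorphic_refl[OF f] \<Psi>_add[OF k]]] .
  also have "- n + - m = - (m + n)" by simp
  finally show ?thesis unfolding twist_def .
qed

lemma twist_shift_equiv:
  assumes k: "k \<in> all_weights N" and l: "l \<in> all_weights N" and "eqv k l f g"
  shows "eqv k l (twist k l n f) (twist k l n g)"
proof -
  note kO = weight_Obj[OF k] and lO = weight_Obj[OF l]
  show ?thesis
    unfolding twist_def using HC1_shift_equiv_right[OF kO lO lO \<Psi>_Mor[OF l]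
        HC1_shift_equiv_left[OF kO kO lO assms(3) \<Psi>_Mor[OF k]]] .
qed

lemma \<Psi>_twist:
  assumes k: "k \<in> all_weights N" and l: "l \<in> all_weights N" and f: "f \<in> mor k l"
  shows "iso_mor k l (\<Psi> n l \<star> f) (twist k l n f \<star> \<Psi> n k)"
proof -
  note kO = weight_Obj[OF k] and lO = weight_Obj[OF l]
  interpret M: category "Mor A k l" using Mor_cat[OF kO lO] .
  note P = \<Psi>_Mor[OF k] and Q = \<Psi>_Mor[OF l]
  have fP: "f \<star> \<Psi> i k \<in> mor k l" for i using HC1_Mor[OF kO kO lO f P] .
  have "twist k l n f \<star> \<Psi> n k = \<Psi> n l \<star> (f \<star> (\<Psi> (- n) k \<star> \<Psi> n k))"
    unfolding twist_def using HC1_assoc[OF kO kO lO lO Q fP P] HC1_assoc[OF kO kO kO lO f P P] by simp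
  also have "iso_mor k l \<dots> (\<Psi> n l \<star> (f \<star> \<Psi> (- n + n) k))"
    using HC1_isomorphic[OF kO lO lO iso_mor_refl[OF lO lO Q]
        HC1_isomorphic[OF kO kO lO M.isomorphic_refl[OF f] \<Psi>_add[OF k]]] .
  finally show ?thesis using M.isomorphic_sym HC1_One[OF kO lO f] by (simp add: \<Psi>_0)
qed

lemma twist_1I:
  assumes k: "k \<in> all_weights N" and l: "l \<in> all_weights N"
    and f: "f \<in> mor k l" and g: "g \<in> mor k l"
    and eqv: "eqv k l (PsiM A l \<star> f) (g \<star> PsiM A k)"
  shows "eqv k l (twist k l 1 f) g"
proof -
  note kO = weight_Obj[OF k] and lO = weight_Obj[OF l]
  note P = \<Psi>_Mor[OF k] and Q = \<Psi>_Mor[OF l]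
  have "twist k l 1 f = (\<Psi> 1 l \<star> f) \<star> \<Psi> (- 1) k"
    unfolding twist_def using HC1_assoc[OF kO kO lO lO Q f P] by simp
  also have "eqv k l \<dots> ((g \<star> \<Psi> 1 k) \<star> \<Psi> (- 1) k)"
    using HC1_shift_equiv_left[OF kO kO lO eqv P] \<Psi>_1 k l by simp
  also have "(g \<star> \<Psi> 1 k) \<star> \<Psi> (- 1) k = g \<star> (\<Psi> 1 k \<star> \<Psi> (- 1) k)"
    using HC1_assoc[OF kO kO kO lO g P P] .
  also have "eqv k l \<dots> (g \<star> \<Psi> (1 + - 1) k)"
    using HC1_shift_equiv_right[OF kO kO lO g shift_equiv_iso[OF \<Psi>_add[OF k]]] .
  finally show ?thesis using HC1_One[OF kO lO g] by (simp add: \<Psi>_0)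
qed

text \<open>Twisting moves along any family of 1-morphisms whose index is raised by passing \<open>\<Psi>\<^sup>-\<close> through.
  Both \<open>E\<^sub>r\<close> and \<open>F\<^sub>-\<^sub>s\<close> are such families.\<close>

lemma twist_family:
  assumes k: "k \<in> all_weights N" and l: "l \<in> all_weights N"
    and G: "\<And>i. i \<in> {a..b} \<Longrightarrow> G i \<in> mor k l"
    and step: "\<And>i. a \<le> i \<Longrightarrow> i < b \<Longrightarrow> eqv k l (PsiM A l \<star> G i) (G (i + 1) \<star> PsiM A k)"
    and ij: "i \<in> {a..b}" "j \<in> {a..b}"
  shows "eqv k l (twist k l (j - i) (G i)) (G j)"
proof -
  let ?eqv = "eqv k l"
  have up: "?eqv (twist k l (int n) (G i)) (G (i + int n))"
    if "i \<in> {a..b}" "i + int n \<in> {a..b}" for i n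
    using that
  proof (induction n)
    case 0
    then show ?case
      using twist_0[OF k l G] eqv_refl[OF weight_Obj[OF k] weight_Obj[OF l] G] by simp
  next
    case (Suc n)
    have n: "i + int n \<in> {a..b}" "i + int n + 1 \<in> {a..b}" "a \<le> i + int n" "i + int n < b"
      using Suc.prems by auto
    have "?eqv (twist k l (int (Suc n)) (G i)) (twist k l 1 (twist k l (int n) (G i)))"
      using shift_equiv_sym[OF shift_equiv_iso[OF twist_twist[OF k l G[OF Suc.prems(1)], of 1 "int n"]]]
      by simp
    also have "?eqv \<dots> (twist k l 1 (G (i + int n)))"
      using twist_shift_equiv[OF k l Suc.IH[OF Suc.prems(1) n(1)]] .
    also have "?eqv \<dots> (G (i + int n + 1))"
      using twist_1I[OF k l G[OF n(1)] G[OF n(2)] step[OF n(3,4)]] .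
    finally show ?case by (simp add: add_ac)
  qed
  show ?thesis
  proof (cases "i \<le> j")
    case True
    then show ?thesis using up[of i "nat (j - i)"] ij by simp
  next
    case False
    then have "?eqv (twist k l (i - j) (G j)) (G i)"
      using up[of j "nat (i - j)"] ij by simp
    from twist_shift_equiv[OF k l this, of "j - i"]
    have "?eqv (twist k l (j - i) (G i)) (twist k l (j - i) (twist k l (i - j) (G j)))"
      by (rule shift_equiv_sym)
    also have "?eqv \<dots> (G j)"
      using shift_equiv_iso[OF twist_twist[OF k l G[OF ij(2)], of "j - i" "i - j"]]
        twist_0[OF k l G[OF ij(2)]] by simp
    finally show ?thesis .
  qed
qed

lemma EE_twist:
  assumes k: "k \<in> weights N" and r: "r \<in> E_range k" and r': "r' \<in> E_range k"
  shows "eqv k (wt_add k 1) (twist k (wt_add k 1) (r' - r) (EE A r k)) (EE A r' k)"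
proof -
  note ka = weights_all[OF k]
  note la = wt_add_all[OF ka, of 1]
  note kO = weight_Obj[OF ka] and lO = weight_Obj[OF la]
  interpret M: triangulated_category "Mor A k (wt_add k 1)" using Mor_tri[OF kO lO] .
  note E = EE_Mor[OF ka]
  show ?thesis
  proof (rule twist_family[of _ _ "- fst k - 1" 0 "\<lambda>r. EE A r k", OF ka la])
    fix i assume "i \<in> {- fst k - 1..0}"
    then show "EE A i k \<in> mor k (wt_add k 1)" using E[of i] by (simp add: E_range_def)
  next
    fix i assume "- fst k - 1 \<le> i" "i < 0"
    then have i: "i \<in> E_range k" "i + 1 \<in> E_range k" by (simp_all add: E_range_def)
    show "eqv k (wt_add k 1) (PsiM A (wt_add k 1) \<star> EE A i k) (EE A (i + 1) k \<star> PsiM A k)"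
      using M.isomorphic_shift_equiv[OF PsiM_EE[OF k i] HC1_Mor[OF kO kO lO E[OF i(2)] PsiM_Mor[OF ka]]] .
  qed (use r r' in \<open>simp_all add: E_range_def\<close>)
qed

lemma FF_twist:
  assumes k: "k \<in> weights N" and s: "s \<in> F_range k" and s': "s' \<in> F_range k"
  shows "eqv k (wt_add k (- 1)) (twist k (wt_add k (- 1)) (s - s') (FF A s k)) (FF A s' k)"
proof -
  note ka = weights_all[OF k]
  note la = wt_add_all[OF ka, of "- 1"]
  note kO = weight_Obj[OF ka] and lO = weight_Obj[OF la]
  interpret M: triangulated_category "Mor A k (wt_add k (- 1))" using Mor_tri[OF kO lO] .
  note F = FF_Mor[OF ka]
  have "eqv k (wt_add k (- 1))
    (twist k (wt_add k (- 1)) (- s' - - s) (FF A (- (- s)) k)) (FF A (- (- s')) k)"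
  proof (rule twist_family[of _ _ "- snd k - 1" 0 "\<lambda>i. FF A (- i) k", OF ka la])
    fix i assume "i \<in> {- snd k - 1..0}"
    then show "FF A (- i) k \<in> mor k (wt_add k (- 1))" using F[of "- i"] by (simp add: F_range_def)
  next
    fix i assume "- snd k - 1 \<le> i" "i < 0"
    then have i: "- i \<in> F_range k" "- i - 1 \<in> F_range k" by (simp_all add: F_range_def)
    have e: "- i - 1 = - (i + 1)" by simp
    show "eqv k (wt_add k (- 1)) (PsiM A (wt_add k (- 1)) \<star> FF A (- i) k)
        (FF A (- (i + 1)) k \<star> PsiM A k)"
      using M.isomorphic_shift_equiv[OF PsiM_FF[OF k i] HC1_Mor[OF kO kO lO F[OF i(2)] PsiM_Mor[OF ka]]]
      unfolding e .
  qed (use s s' in \<open>simp_all add: F_range_def\<close>)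
  then show ?thesis by simp
qed

text \<open>\<open>F\<^sub>s\<close> for every integer \<open>s\<close>, also outside \<open>F_range\<close>: the left adjoint of \<open>E\<^bsub>-m\<^esub>\<close> involves the
  negative index \<open>m - k\<^sub>1\<close>.\<close>

definition FF_ext :: "int \<Rightarrow> weight \<Rightarrow> 'f" where
  "FF_ext s k = twist k (wt_add k (- 1)) (- s) (FF A 0 k)"

lemma zero_in_F_range: "k \<in> weights N \<Longrightarrow> 0 \<in> F_range k"
  by (auto simp: F_range_def weights_def)

lemma FF_ext_Mor: "k \<in> weights N \<Longrightarrow> FF_ext s k \<in> mor k (wt_add k (- 1))"
  unfolding FF_ext_def
  by (intro twist_Mor wt_add_all weights_all FF_Mor zero_in_F_range)

lemma twist_FF_ext:
  assumes k: "k \<in> weights N"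
  shows "eqv k (wt_add k (- 1)) (twist k (wt_add k (- 1)) j (FF_ext s k)) (FF_ext (s - j) k)"
  unfolding FF_ext_def
  using shift_equiv_iso[OF twist_twist[OF weights_all[OF k] wt_add_all[OF weights_all[OF k]]
        FF_Mor[OF weights_all[OF k] zero_in_F_range[OF k]], of j "- s"]] by simp

lemma FF_ext_FF:
  assumes "k \<in> weights N" "s \<in> F_range k"
  shows "eqv k (wt_add k (- 1)) (FF_ext s k) (FF A s k)"
  using FF_twist[OF assms(1) zero_in_F_range[OF assms(1)] assms(2)] by (simp add: FF_ext_def)

lemma \<Psi>_FF_ext:
  assumes k: "k \<in> weights N"
  shows "eqv k (wt_add k (- 1)) (\<Psi> j (wt_add k (- 1)) \<star> FF_ext s k) (FF_ext (s - j) k \<star> \<Psi> j k)"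
proof -
  note ka = weights_all[OF k]
  note la = wt_add_all[OF ka, of "- 1"]
  note kO = weight_Obj[OF ka] and lO = weight_Obj[OF la]
  from shift_equiv_iso[OF \<Psi>_twist[OF ka la FF_ext_Mor[OF k]]]
    HC1_shift_equiv_left[OF kO kO lO twist_FF_ext[OF k] \<Psi>_Mor[OF ka]]
  show ?thesis by (rule shift_equiv_trans)
qed

lemma \<Psi>_EE:
  assumes k: "k \<in> weights N" and r: "r \<in> E_range k" and r': "r + j \<in> E_range k"
  shows "eqv k (wt_add k 1) (\<Psi> j (wt_add k 1) \<star> EE A r k) (EE A (r + j) k \<star> \<Psi> j k)"
proof -
  note ka = weights_all[OF k]
  note la = wt_add_all[OF ka, of 1]
  note kO = weight_Obj[OF ka] and lO = weight_Obj[OF la]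
  have "eqv k (wt_add k 1) (twist k (wt_add k 1) j (EE A r k)) (EE A (r + j) k)"
    using EE_twist[OF k r r'] by simp
  from shift_equiv_iso[OF \<Psi>_twist[OF ka la EE_Mor[OF ka r]]]
    HC1_shift_equiv_left[OF kO kO lO this \<Psi>_Mor[OF ka]]
  show ?thesis by (rule shift_equiv_trans)
qed

text \<open>Conjugation by \<open>(\<Psi>\<^sup>-)\<^sup>j\<close> moves both indices in opposite directions without changing their
  sum, which brings them into the ranges where the relations between \<open>E\<close> and \<open>F\<close> are available.\<close>

lemma FF_ext_EE_move:
  assumes k: "k \<in> weights N" and l: "wt_add k 1 \<in> weights N" and i: "i \<in> all_weights N"
    and r: "r \<in> E_range k" and X: "X \<in> mor i k"
    and r': "r + j \<in> E_range k" and s': "s - j \<in> F_range (wt_add k 1)"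
  shows "eqv i k (FF_ext s (wt_add k 1) \<star> (EE A r k \<star> X))
    (\<Psi> (- j) k \<star> ((FF A (s - j) (wt_add k 1) \<star> EE A (r + j) k) \<star> (\<Psi> j k \<star> X)))"
proof -
  let ?l = "wt_add k 1"
  have lk: "wt_add ?l (- 1) = k" by (simp add: wt_add_wt_add wt_add_0)
  note ka = weights_all[OF k] and la = weights_all[OF l]
  note kO = weight_Obj[OF ka] and lO = weight_Obj[OF la] and iO = weight_Obj[OF i]
  let ?eqv = "eqv i k"
  have F: "FF_ext s ?l \<in> mor ?l k" for s using FF_ext_Mor[OF l] lk by simp
  have F': "FF A (s - j) ?l \<in> mor ?l k" using FF_Mor[OF la s'] lk by simp
  have E: "EE A r k \<in> mor k ?l" "EE A (r + j) k \<in> mor k ?l"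
    using EE_Mor[OF ka] r r' by auto
  note PX = HC1_Mor[OF iO kO kO \<Psi>_Mor[OF ka] X]
  note EX = HC1_Mor[OF iO kO lO E(1) X]
  have a: "?eqv (\<Psi> j k \<star> (FF_ext s ?l \<star> (EE A r k \<star> X))) ((FF A (s - j) ?l \<star> EE A (r + j) k) \<star> (\<Psi> j k \<star> X))"
  proof -
    have "\<Psi> j k \<star> (FF_ext s ?l \<star> (EE A r k \<star> X)) = (\<Psi> j k \<star> FF_ext s ?l) \<star> (EE A r k \<star> X)"
      using HC1_assoc[OF iO lO kO kO \<Psi>_Mor[OF ka] F EX] by simp
    also have "?eqv \<dots> ((FF_ext (s - j) ?l \<star> \<Psi> j ?l) \<star> (EE A r k \<star> X))"
      using HC1_shift_equiv_left[OF iO lO kO _ EX] \<Psi>_FF_ext[OF l] lk by simp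
    also have "(FF_ext (s - j) ?l \<star> \<Psi> j ?l) \<star> (EE A r k \<star> X) = FF_ext (s - j) ?l \<star> ((\<Psi> j ?l \<star> EE A r k) \<star> X)"
      using HC1_assoc[OF iO lO lO kO F \<Psi>_Mor[OF la] EX] HC1_assoc[OF iO kO lO lO \<Psi>_Mor[OF la] E(1) X]
      by simp
    also have "?eqv \<dots> (FF A (s - j) ?l \<star> ((EE A (r + j) k \<star> \<Psi> j k) \<star> X))"
      using HC1_shift_equiv[OF iO lO kO _ HC1_shift_equiv_left[OF iO kO lO \<Psi>_EE[OF k r r'] X]]
        FF_ext_FF[OF l s'] lk by simp
    also have "FF A (s - j) ?l \<star> ((EE A (r + j) k \<star> \<Psi> j k) \<star> X) =
        (FF A (s - j) ?l \<star> EE A (r + j) k) \<star> (\<Psi> j k \<star> X)"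
      using HC1_assoc[OF iO kO kO lO E(2) \<Psi>_Mor[OF ka] X] HC1_assoc[OF iO kO lO kO F' E(2) PX] by simp
    finally show ?thesis .
  qed
  have "?eqv (FF_ext s ?l \<star> (EE A r k \<star> X)) (\<Psi> (- j) k \<star> (\<Psi> j k \<star> (FF_ext s ?l \<star> (EE A r k \<star> X))))"
    using shift_equiv_sym[OF shift_equiv_iso[OF \<Psi>_cancel[OF i ka HC1_Mor[OF iO lO kO F EX], of "- j" j]]]
    by simp
  also have "?eqv \<dots> (\<Psi> (- j) k \<star> ((FF A (s - j) ?l \<star> EE A (r + j) k) \<star> (\<Psi> j k \<star> X)))"
    using HC1_shift_equiv_right[OF iO kO kO \<Psi>_Mor[OF ka] a] .
  finally show ?thesis .
qed

text \<open>If \<open>F\<^sub>s X = 0\<close>, then the term \<open>E F X\<close> in the relations vanishes: the triangle degenerates to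
  \<open>F E X \<cong> \<Psi>\<^sup>- X\<close>, and commutation gives \<open>F E X = 0\<close>.\<close>

lemma FF_ext_cross:
  assumes k: "k \<in> weights N" and l: "wt_add k 1 \<in> weights N" and i: "i \<in> all_weights N"
    and r: "r \<in> E_range k" and X: "X \<in> mor i k"
    and zero: "zero_mor i (wt_add k (- 1)) (FF_ext s k \<star> X)"
  shows "s + r = - fst k \<Longrightarrow>
      eqv i k (FF_ext s (wt_add k 1) \<star> (EE A r k \<star> X)) (\<Psi> 1 k \<star> X)"
    and "- fst k + 1 \<le> s + r \<Longrightarrow> s + r \<le> snd k - 1 \<Longrightarrow>
      zero_mor i k (FF_ext s (wt_add k 1) \<star> (EE A r k \<star> X))"
proof -
  let ?l = "wt_add k 1" and ?m = "wt_add k (- 1)"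
  have lk: "wt_add ?l (- 1) = k" and mk: "wt_add ?m 1 = k" by (simp_all add: wt_add_wt_add wt_add_0)
  note ka = weights_all[OF k] and la = weights_all[OF l]
  note ma = wt_add_all[OF ka, of "- 1"]
  note kO = weight_Obj[OF ka] and lO = weight_Obj[OF la] and iO = weight_Obj[OF i] and mO = weight_Obj[OF ma]
  have k12: "0 \<le> fst k" "0 \<le> snd k" using k by (auto simp: weights_def)
  \<comment> \<open>the indices that share the sum with \<open>s\<close> and \<open>r\<close> and lie in the ranges of both 1-morphisms\<close>
  define s' where "s' = max (s + r) 0"
  define r' where "r' = min (s + r) 0"
  define j where "j = s - s'"
  have j: "s - j = s'" "r + j = r'" "s' + r' = s + r" by (auto simp: j_def s'_def r'_def)
  let ?Y = "\<Psi> j k \<star> X"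
  let ?FE = "FF A s' ?l \<star> EE A r' k" and ?EF = "EE A r' ?m \<star> FF A s' k"
  note Y = HC1_Mor[OF iO kO kO \<Psi>_Mor[OF ka] X]
  note Pm = \<Psi>_Mor[OF ka]
  have main: "eqv i k (FF_ext s ?l \<star> (EE A r k \<star> X)) (\<Psi> (- j) k \<star> (?FE \<star> ?Y))"
    and r'k: "r' \<in> E_range k" and s'k: "s' \<in> F_range k" and r'm: "r' \<in> E_range ?m"
    if "- fst k \<le> s + r" "s + r \<le> snd k"
  proof -
    show r1: "r' \<in> E_range k" and s1: "s' \<in> F_range k" and "r' \<in> E_range ?m"
      using that k12 by (auto simp: E_range_def F_range_def r'_def s'_def wt_add_def)
    have s2: "s' \<in> F_range ?l" using s1 by (auto simp: F_range_def wt_add_def)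
    show "eqv i k (FF_ext s ?l \<star> (EE A r k \<star> X)) (\<Psi> (- j) k \<star> (?FE \<star> ?Y))"
      using FF_ext_EE_move[OF k l i r X, of j s] r1 s2 j by simp
  qed
  have zEF: "zero_mor i k (?EF \<star> ?Y)"
    if "r' \<in> E_range ?m" "s' \<in> F_range k"
  proof -
    have F: "FF A s' k \<in> mor k ?m" using FF_Mor[OF ka that(2)] .
    have E: "EE A r' ?m \<in> mor ?m k" using EE_Mor[OF ma that(1)] mk by simp
    have "eqv i ?m (FF A s' k \<star> ?Y) ((FF_ext s' k \<star> \<Psi> j k) \<star> X)"
      using HC1_shift_equiv_left[OF iO kO mO shift_equiv_sym[OF FF_ext_FF[OF k that(2)]] Y]
        HC1_assoc[OF iO kO kO mO FF_ext_Mor[OF k] Pm X] by simp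
    also have "eqv i ?m \<dots> ((\<Psi> j ?m \<star> FF_ext s k) \<star> X)"
      using HC1_shift_equiv_left[OF iO kO mO shift_equiv_sym[OF \<Psi>_FF_ext[OF k, of j s]] X] j by simp
    also have "(\<Psi> j ?m \<star> FF_ext s k) \<star> X = \<Psi> j ?m \<star> (FF_ext s k \<star> X)"
      using HC1_assoc[OF iO kO mO mO \<Psi>_Mor[OF ma] FF_ext_Mor[OF k] X] .
    finally have "zero_mor i ?m (FF A s' k \<star> ?Y)"
      using eqv_zero_object[OF iO mO] HC1_zero_object(2)[OF iO mO mO \<Psi>_Mor[OF ma] zero] by blast
    then have "zero_mor i k (EE A r' ?m \<star> (FF A s' k \<star> ?Y))"
      using HC1_zero_object(2)[OF iO mO kO E] by blast
    then show ?thesis using HC1_assoc[OF iO kO mO kO E F Y] by simp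
  qed
  show "eqv i k (FF_ext s ?l \<star> (EE A r k \<star> X)) (\<Psi> 1 k \<star> X)"
    if sr: "s + r = - fst k"
  proof -
    have ranges: "- fst k \<le> s + r" "s + r \<le> snd k" using sr k12 by auto
    interpret M: triangulated_category "Mor A i k" using Mor_tri[OF iO kO] .
    have "exact_triangle (Mor A k k) ?EF ?FE (PsiM A k)"
      using EF_bottom[OF k r'k[OF ranges] s'k[OF ranges]] j sr by simp
    then have "exact_triangle (Mor A i k) (?EF \<star> ?Y) (?FE \<star> ?Y) (PsiM A k \<star> ?Y)"
      by (rule exact_functor_triangle[OF Mor_tri[OF kO kO] Mor_tri[OF iO kO] precompose_exact[OF iO kO kO Y]])
    then have "iso_mor i k (?FE \<star> ?Y) (\<Psi> 1 k \<star> ?Y)"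
      using M.isomorphic_of_triangle_zero zEF r'm[OF ranges] s'k[OF ranges] \<Psi>_1[OF ka] by simp
    from HC1_isomorphic[OF iO kO kO iso_mor_refl[OF kO kO Pm] this, of "- j"]
    have "iso_mor i k (\<Psi> (- j) k \<star> (?FE \<star> ?Y)) (\<Psi> (- j) k \<star> (\<Psi> 1 k \<star> ?Y))" .
    also have "iso_mor i k \<dots> (\<Psi> (- j + 1) k \<star> ?Y)" using \<Psi>_\<Psi>[OF i ka Y] .
    also have "iso_mor i k \<dots> (\<Psi> (- j + 1 + j) k \<star> X)" using \<Psi>_\<Psi>[OF i ka X] .
    finally have "iso_mor i k (\<Psi> (- j) k \<star> (?FE \<star> ?Y)) (\<Psi> 1 k \<star> X)" by simp
    from shift_equiv_trans[OF main[OF ranges] shift_equiv_iso[OF this]] show ?thesis .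
  qed
  show "zero_mor i k (FF_ext s ?l \<star> (EE A r k \<star> X))"
    if sr: "- fst k + 1 \<le> s + r" "s + r \<le> snd k - 1"
  proof -
    have ranges: "- fst k \<le> s + r" "s + r \<le> snd k" using sr by auto
    interpret M: triangulated_category "Mor A i k" using Mor_tri[OF iO kO] .
    have "iso_mor k k ?FE ?EF"
      using EF_commute[OF k r'k[OF ranges] s'k[OF ranges]] j sr by simp
    from HC1_isomorphic[OF iO kO kO this M.isomorphic_refl[OF Y]]
    have "zero_mor i k (?FE \<star> ?Y)"
      using M.zero_object_isomorphic[OF zEF[OF r'm[OF ranges] s'k[OF ranges]]] M.isomorphic_sym by blast
    then show ?thesis
      using eqv_zero_object[OF iO kO main[OF ranges]] HC1_zero_object(2)[OF iO kO kO Pm] by blast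
  qed
qed

text \<open>The right adjoint \<open>G\<close> of \<open>F\<^sub>1\<close> is \<open>E\<^bsub>-k\<^sub>1-1\<^esub> (\<Psi>\<^sup>-)\<^sup>-\<^sup>1\<close>, so \<open>E\<^bsub>-m\<^esub>\<close> is \<open>(\<Psi>\<^sup>-)\<^sup>n G (\<Psi>\<^sup>-)\<^sup>1\<^sup>-\<^sup>n\<close> up to shift
  with \<open>n = k\<^sub>1 + 1 - m\<close>. The outer factors are invertible and hence have left adjoints.\<close>

lemma EE_left_adjoint:
  assumes k: "k \<in> weights N" and l: "wt_add k 1 \<in> weights N" and m: "0 \<le> m" "m \<le> fst k - 1"
  shows "\<exists>L \<in> mor (wt_add k 1) k. adjunction (wt_add k 1) k L (EE A (- m) k) \<and>
    eqv (wt_add k 1) k L (\<Psi> (- 1) k \<star> FF_ext (m - fst k) (wt_add k 1))"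
proof -
  let ?l = "wt_add k 1"
  have lk: "wt_add ?l (- 1) = k" by (simp add: wt_add_wt_add wt_add_0)
  note ka = weights_all[OF k] and la = weights_all[OF l]
  note kO = weight_Obj[OF ka] and lO = weight_Obj[OF la]
  have s1: "1 \<in> F_range ?l" using l by (auto simp: F_range_def weights_def)
  define n where "n = fst k + 1 - m"
  have r0: "- fst k - 1 \<in> E_range k" and rm: "- m \<in> E_range k"
    using m by (auto simp: E_range_def)
  have F: "FF A 1 ?l \<in> mor ?l k" using FF_Mor[OF la s1] lk by simp
  have E0: "EE A (- fst k - 1) k \<in> mor k ?l" and E: "EE A (- m) k \<in> mor k ?l"
    using EE_Mor[OF ka] r0 rm by auto
  note P = \<Psi>_Mor[OF ka] and Q = \<Psi>_Mor[OF la]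
  have "right_adjoint_iso A ?l k (FF A 1 ?l) (EE A (- fst k - 1) k \<star> \<Psi> (- 1) k)"
  proof -
    have "- fst ?l - 2 = - fst k - 1" by (simp add: wt_add_def)
    then have "right_adjoint_iso A ?l k (FF A 1 ?l)
        (shift (Mor A k ?l) (1 - 1) (\<Psi> (- 1 + 1) ?l \<star> (EE A (- fst k - 1) k \<star> \<Psi> (1 - 2) k)))"
      using FF_right_adjoint[OF l s1] lk by metis
    then show ?thesis
      using One_HC1[OF kO lO HC1_Mor[OF kO kO lO E0 P[of "- 1"]]] by (simp add: \<Psi>_0 shift_def)
  qed
  then obtain G where adjG: "is_right_adjoint A ?l k (FF A 1 ?l) G"
      and Giso: "iso_mor k ?l G (EE A (- fst k - 1) k \<star> \<Psi> (- 1) k)"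
    unfolding right_adjoint_iso_def by blast
  note G = iso_Mor(1)[OF kO lO Giso]
  note adjG' = is_right_adjoint_adjunction[OF lO kO adjG]
  interpret M: triangulated_category "Mor A k ?l" using Mor_tri[OF kO lO] .
  interpret M': triangulated_category "Mor A ?l k" using Mor_tri[OF lO kO] .
  let ?G = "\<Psi> n ?l \<star> (G \<star> \<Psi> (1 - n) k)"
  note GP = HC1_Mor[OF kO kO lO G P]
  have twG: "iso_mor k ?l (twist k ?l n (EE A (- fst k - 1) k)) ?G"
  proof -
    have "iso_mor k ?l (G \<star> \<Psi> (1 - n) k) ((EE A (- fst k - 1) k \<star> \<Psi> (- 1) k) \<star> \<Psi> (1 - n) k)"
      using HC1_isomorphic[OF kO kO lO Giso iso_mor_refl[OF kO kO P]] .
    also have "\<dots> = EE A (- fst k - 1) k \<star> (\<Psi> (- 1) k \<star> \<Psi> (1 - n) k)"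
      using HC1_assoc[OF kO kO kO lO E0 P P] .
    also have "iso_mor k ?l \<dots> (EE A (- fst k - 1) k \<star> \<Psi> (- 1 + (1 - n)) k)"
      using HC1_isomorphic[OF kO kO lO M.isomorphic_refl[OF E0] \<Psi>_add[OF ka]] .
    finally have "iso_mor k ?l (G \<star> \<Psi> (1 - n) k) (EE A (- fst k - 1) k \<star> \<Psi> (- n) k)" by simp
    from HC1_isomorphic[OF kO lO lO iso_mor_refl[OF lO lO Q] this]
    have "iso_mor k ?l ?G (twist k ?l n (EE A (- fst k - 1) k))" unfolding twist_def .
    then show ?thesis by (rule M.isomorphic_sym)
  qed
  have "eqv k ?l (twist k ?l n (EE A (- fst k - 1) k)) (EE A (- m) k)"
    using EE_twist[OF k r0 rm] by (simp add: n_def algebra_simps)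
  from shift_equiv_trans[OF shift_equiv_sym[OF this] shift_equiv_iso[OF twG]]
  obtain u v where uv: "inverse_pair A ?l u v"
      and v1: "eqv ?l ?l (One A ?l) v" and iso: "iso_mor k ?l (EE A (- m) k) (u \<star> ?G)"
    using shift_equiv_factor[OF kO lO] by blast
  have u: "u \<in> mor ?l ?l" and v: "v \<in> mor ?l ?l" using uv by (auto simp: inverse_pair_def)
  \<comment> \<open>the left adjoint of \<open>u \<Psi>\<^sup>n G \<Psi>\<^sup>1\<^sup>-\<^sup>n\<close> is composed of the left adjoints of its factors\<close>
  let ?w = "\<Psi> (- n) ?l \<star> v"
  have w: "inverse_pair A ?l ?w (u \<star> \<Psi> n ?l)"
    using inverse_pair_sym[OF inverse_pair_HC1[OF lO uv \<Psi>_inverse_pair[OF la]]] .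
  have p: "inverse_pair A k (\<Psi> (n - 1) k) (\<Psi> (1 - n) k)" using \<Psi>_inverse_pair[OF ka, of "n - 1"] by simp
  have wO: "?w \<in> mor ?l ?l" "u \<star> \<Psi> n ?l \<in> mor ?l ?l"
    using w by (auto simp: inverse_pair_def)
  have Fw: "FF A 1 ?l \<star> ?w \<in> mor ?l k" using HC1_Mor[OF lO lO kO F wO(1)] .
  have uG: "(u \<star> \<Psi> n ?l) \<star> G \<in> mor k ?l" using HC1_Mor[OF kO lO lO wO(2) G] .
  have "adjunction ?l k (FF A 1 ?l \<star> ?w) ((u \<star> \<Psi> n ?l) \<star> G)"
    using adjunction_HC1[OF lO lO kO wO F G inverse_pair_adjunction(1)[OF lO w] adjG'] .
  from adjunction_HC1[OF lO kO kO Fw uG P P this inverse_pair_adjunction(1)[OF ka[THEN weight_Obj] p]]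
  have adj: "adjunction ?l k (\<Psi> (n - 1) k \<star> (FF A 1 ?l \<star> ?w)) (((u \<star> \<Psi> n ?l) \<star> G) \<star> \<Psi> (1 - n) k)" .
  let ?L = "\<Psi> (n - 1) k \<star> (FF A 1 ?l \<star> ?w)"
  have L: "?L \<in> mor ?l k" using HC1_Mor[OF lO kO kO P Fw] .
  have "((u \<star> \<Psi> n ?l) \<star> G) \<star> \<Psi> (1 - n) k = u \<star> ?G"
    using HC1_assoc[OF kO kO lO lO wO(2) G P] HC1_assoc[OF kO lO lO lO u Q GP] by simp
  then have adjL: "adjunction ?l k ?L (EE A (- m) k)"
    using adjunction_isomorphic_right[OF lO kO L adj] M.isomorphic_sym[OF iso] by simp
  have "eqv ?l ?l ?w (\<Psi> (- n) ?l)"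
    using HC1_shift_equiv_right[OF lO lO lO Q shift_equiv_sym[OF v1]] HC1_One[OF lO lO Q] by simp
  moreover have "eqv ?l k (FF A 1 ?l) (FF_ext 1 ?l)"
    using shift_equiv_sym[OF FF_ext_FF[OF l s1]] lk by simp
  ultimately have "eqv ?l k (FF A 1 ?l \<star> ?w) (FF_ext 1 ?l \<star> \<Psi> (- n) ?l)"
    using HC1_shift_equiv[OF lO lO kO] by blast
  also have "eqv ?l k \<dots> (\<Psi> (- n) k \<star> FF_ext (1 - n) ?l)"
    using shift_equiv_sym[OF \<Psi>_FF_ext[OF l, of "- n" "1 - n"]] lk by simp
  finally have "eqv ?l k ?L (\<Psi> (n - 1) k \<star> (\<Psi> (- n) k \<star> FF_ext (1 - n) ?l))"
    by (rule HC1_shift_equiv_right[OF lO kO kO P])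
  also have "eqv ?l k \<dots> (\<Psi> (n - 1 + - n) k \<star> FF_ext (1 - n) ?l)"
    using shift_equiv_iso[OF \<Psi>_\<Psi>[OF la ka FF_ext_Mor[OF l, unfolded lk]]] .
  finally have "eqv ?l k ?L (\<Psi> (- 1) k \<star> FF_ext (m - fst k) ?l)"
    by (simp add: n_def)
  then show ?thesis using L adjL by blast
qed

end

section \<open>The sequences of \<open>E\<close>'s\<close>

context partial_categorical_action
begin

abbreviation wt :: "nat \<Rightarrow> weight" where
  "wt b \<equiv> (int N - int b, int b)"

lemma wt_weights: "b \<le> N \<Longrightarrow> wt b \<in> weights N"
  by (simp add: weights_def)

lemma wt_Suc: "wt_add (wt b) 1 = wt (Suc b)"
  by (simp add: wt_add_def)

lemma wt_Obj: "b \<le> N \<Longrightarrow> wt b \<in> Obj A"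
  by (intro weight_Obj weights_all wt_weights)

lemma P_Cons_iff:
  "m # \<mu> \<in> P a b \<longleftrightarrow>
     (\<exists>b'. b = Suc b' \<and> \<mu> \<in> P a b' \<and> 0 \<le> m \<and> m \<le> int a \<and> (\<forall>x \<in> set \<mu>. x \<le> m))"
  by (auto simp: P_def)

lemma P_nonneg: "\<mu> \<in> P a b \<Longrightarrow> x \<in> set \<mu> \<Longrightarrow> 0 \<le> x"
  by (auto simp: P_def)

lemma P_length: "\<mu> \<in> P a b \<Longrightarrow> length \<mu> = b"
  by (simp add: P_def)

lemma E_range_wt: "0 \<le> m \<Longrightarrow> m \<le> int N - int b + 1 \<Longrightarrow> - m \<in> E_range (wt b)"
  by (simp add: E_range_def)

lemma E_seq_Mor:
  assumes "\<mu> \<in> P a b" "a + b \<le> N"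
  shows "E_seq A N \<mu> \<in> mor (wt 0) (wt b)"
  using assms
proof (induction \<mu> arbitrary: b)
  case Nil
  then show ?case using One_Mor[OF wt_Obj[of 0]] by (simp add: P_def)
next
  case (Cons m \<mu>)
  obtain b' where b: "b = Suc b'" "\<mu> \<in> P a b'" "0 \<le> m" "m \<le> int a"
    using Cons.prems(1) unfolding P_Cons_iff by blast
  have bN: "0 \<le> N" "b' \<le> N" "b \<le> N" using Cons.prems(2) b(1) by auto
  have "- m \<in> E_range (wt b')" using b Cons.prems(2) by (intro E_range_wt) auto
  then have "EE A (- m) (wt b') \<in> mor (wt b') (wt b)"
    using EE_Mor[OF weights_all[OF wt_weights[OF bN(2)]]] wt_Suc b(1) by simp
  moreover have "E_seq A N \<mu> \<in> mor (wt 0) (wt b')" using Cons.IH[OF b(2)] Cons.prems(2) b(1) by simp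
  ultimately show ?case
    using HC1_Mor[OF wt_Obj[OF bN(1)] wt_Obj[OF bN(2)] wt_Obj[OF bN(3)]] P_length[OF b(2)] by simp
qed

text \<open>\<open>F\<close> moves to the right through all the factors, down to the highest weight, where it
  vanishes. The bounds keep the sum of indices in the commuting range at the first factor; at the
  later ones the lower end of that range is smaller, and its upper end is never below \<open>-1\<close>.\<close>

lemma FF_ext_E_seq_zero:
  assumes "\<mu> \<in> P a b" "a + b \<le> N"
    and "\<And>m. m \<in> set \<mu> \<Longrightarrow> - (int N - int b) \<le> s - m \<and> s - m \<le> - 1"
  shows "zero_mor (wt 0) (wt_add (wt b) (- 1)) (FF_ext s (wt b) \<star> E_seq A N \<mu>)"
  using assms
proof (induction \<mu> arbitrary: b)
  case Nil
  have b: "b = 0" using P_length[OF Nil.prems(1)] by simp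
  have w0: "wt 0 \<in> weights N" by (rule wt_weights) simp
  note w0O = weight_Obj[OF weights_all[OF w0]]
  note ma = wt_add_all[OF weights_all[OF w0], of "- 1"]
  have "wt_add (wt 0) (- 1) \<notin> weights N" by (simp add: weights_def wt_add_def)
  moreover have "FF_ext s (wt 0) \<star> One A (wt 0) \<in> mor (wt 0) (wt_add (wt 0) (- 1))"
    using HC1_Mor[OF w0O w0O weight_Obj[OF ma] FF_ext_Mor[OF w0] One_Mor[OF w0O]] .
  ultimately have "zero_mor (wt 0) (wt_add (wt 0) (- 1)) (FF_ext s (wt 0) \<star> One A (wt 0))"
    using zero_weight[OF weights_all[OF w0] ma] by blast
  then show ?case using b by simp
next
  case (Cons m \<mu>)
  obtain b' where b: "b = Suc b'" "\<mu> \<in> P a b'" "0 \<le> m" "m \<le> int a"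
    using Cons.prems(1) unfolding P_Cons_iff by blast
  have bN: "0 \<le> N" "b' \<le> N" "b \<le> N" using Cons.prems(2) b(1) by auto
  have IH: "zero_mor (wt 0) (wt_add (wt b') (- 1)) (FF_ext s (wt b') \<star> E_seq A N \<mu>)"
  proof (rule Cons.IH[OF b(2)])
    show "a + b' \<le> N" using Cons.prems(2) b(1) by simp
    fix x assume "x \<in> set \<mu>"
    then show "- (int N - int b') \<le> s - x \<and> s - x \<le> - 1" using Cons.prems(3)[of x] b(1) by simp
  qed
  have r: "- m \<in> E_range (wt b')" using b Cons.prems(2) by (intro E_range_wt) auto
  have X: "E_seq A N \<mu> \<in> mor (wt 0) (wt b')" using E_seq_Mor[OF b(2)] Cons.prems(2) b(1) by simp
  have "zero_mor (wt 0) (wt b')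
      (FF_ext s (wt_add (wt b') 1) \<star> (EE A (- m) (wt b') \<star> E_seq A N \<mu>))"
  proof (rule FF_ext_cross(2)[OF wt_weights[OF bN(2)] _ weights_all[OF wt_weights[OF bN(1)]] r X IH])
    show "wt_add (wt b') 1 \<in> weights N" using wt_weights[OF bN(3)] wt_Suc b(1) by simp
    show "- fst (wt b') + 1 \<le> s + - m" "s + - m \<le> snd (wt b') - 1"
      using Cons.prems(3)[of m] b(1) by simp_all
  qed
  moreover have "wt_add (wt b) (- 1) = wt b'" using b(1) by (simp add: wt_add_def)
  ultimately show ?case using wt_Suc P_length[OF b(2)] b(1) by simp
qed

text \<open>Peeling off the first factor: \<open>L\<^bsub>(m, \<mu>)\<^esub> = L\<^sub>\<mu> L\<^sub>m\<close> where \<open>L\<^sub>m\<close> is \<open>(\<Psi>\<^sup>-)\<^sup>-\<^sup>1 F\<^bsub>m - k\<^sub>1\<^esub>\<close>. Applied to a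
  sequence starting with \<open>n < m\<close> it gives zero, and if \<open>n = m\<close> it just removes the first factor.\<close>

lemma E_seq_left_adjoint:
  assumes "\<mu> \<in> P a b" "a + b \<le> N"
  shows "\<exists>L \<in> mor (wt b) (wt 0). adjunction (wt b) (wt 0) L (E_seq A N \<mu>) \<and>
    eqv (wt 0) (wt 0) (L \<star> E_seq A N \<mu>) (One A (wt 0)) \<and>
    (\<forall>\<nu> \<in> P a b. \<nu> < \<mu> \<longrightarrow> zero_mor (wt 0) (wt 0) (L \<star> E_seq A N \<nu>))"
  using assms
proof (induction \<mu> arbitrary: b)
  case Nil
  have b: "b = 0" using P_length[OF Nil.prems(1)] by simp
  note O0 = wt_Obj[of 0, simplified]
  note One = One_Mor[OF O0]
  have "adjunction (wt 0) (wt 0) (One A (wt 0)) (One A (wt 0))"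
    using inverse_pair_adjunction(1)[OF _ inverse_pair_One] O0 by simp
  then show ?case
    using b One One_HC1[OF O0 O0 One] eqv_refl[OF O0 O0 One] by auto
next
  case (Cons m \<mu>)
  obtain b' where b: "b = Suc b'" "\<mu> \<in> P a b'" "0 \<le> m" "m \<le> int a"
    using Cons.prems(1) unfolding P_Cons_iff by blast
  have bN: "0 \<le> N" "b' \<le> N" "b \<le> N" using Cons.prems(2) b(1) by auto
  note O0 = wt_Obj[OF bN(1)] and Ob' = wt_Obj[OF bN(2)] and Ob = wt_Obj[OF bN(3)]
  note k = wt_weights[OF bN(2)]
  note ka = weights_all[OF k] and a0 = weights_all[OF wt_weights[OF bN(1)]]
  have kl: "wt_add (wt b') 1 = wt b" using wt_Suc b(1) by simp
  have lk: "wt_add (wt b) (- 1) = wt b'" using b(1) by (simp add: wt_add_def)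
  have l: "wt_add (wt b') 1 \<in> weights N" using wt_weights[OF bN(3)] kl by simp
  obtain L' where L': "L' \<in> mor (wt b') (wt 0)" "adjunction (wt b') (wt 0) L' (E_seq A N \<mu>)"
      "eqv (wt 0) (wt 0) (L' \<star> E_seq A N \<mu>) (One A (wt 0))"
      "\<And>\<nu>. \<nu> \<in> P a b' \<Longrightarrow> \<nu> < \<mu> \<Longrightarrow> zero_mor (wt 0) (wt 0) (L' \<star> E_seq A N \<nu>)"
    using Cons.IH[OF b(2)] Cons.prems(2) b(1) by auto
  have mk: "m \<le> fst (wt b') - 1" using b Cons.prems(2) by simp
  let ?s = "m - fst (wt b')"
  obtain Lm where Lm: "Lm \<in> mor (wt b) (wt b')" "adjunction (wt b) (wt b') Lm (EE A (- m) (wt b'))"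
      "eqv (wt b) (wt b') Lm (\<Psi> (- 1) (wt b') \<star> FF_ext ?s (wt b))"
    using EE_left_adjoint[OF k l b(3) mk] unfolding kl by blast
  have E: "EE A (- n) (wt b') \<in> mor (wt b') (wt b)" if "0 \<le> n" "n \<le> int a" for n
    using EE_Mor[OF ka E_range_wt[of n b']] that Cons.prems(2) b(1) kl by simp
  have S: "E_seq A N \<nu> \<in> mor (wt 0) (wt b')" if "\<nu> \<in> P a b'" for \<nu>
    using E_seq_Mor[OF that] Cons.prems(2) b(1) by simp
  note P = \<Psi>_Mor[OF ka]
  let ?L = "L' \<star> Lm"
  have L: "?L \<in> mor (wt b) (wt 0)" using HC1_Mor[OF Ob Ob' O0 L'(1) Lm(1)] .
  have F: "FF_ext ?s (wt b) \<in> mor (wt b) (wt b')"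
    using FF_ext_Mor[OF wt_weights[OF bN(3)], of ?s] unfolding lk .
  have red: "eqv (wt 0) (wt 0) (?L \<star> (EE A (- n) (wt b') \<star> E_seq A N \<nu>))
      (L' \<star> (\<Psi> (- 1) (wt b') \<star> (FF_ext ?s (wt b) \<star> (EE A (- n) (wt b') \<star> E_seq A N \<nu>))))"
    if n: "0 \<le> n" "n \<le> int a" and \<nu>: "\<nu> \<in> P a b'" for n \<nu>
  proof -
    note ES = HC1_Mor[OF O0 Ob' Ob E[OF n] S[OF \<nu>]]
    have "?L \<star> (EE A (- n) (wt b') \<star> E_seq A N \<nu>) = L' \<star> (Lm \<star> (EE A (- n) (wt b') \<star> E_seq A N \<nu>))"
      using HC1_assoc[OF O0 Ob Ob' O0 L'(1) Lm(1) ES] .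
    also have "eqv (wt 0) (wt 0) \<dots>
        (L' \<star> ((\<Psi> (- 1) (wt b') \<star> FF_ext ?s (wt b)) \<star> (EE A (- n) (wt b') \<star> E_seq A N \<nu>)))"
      using HC1_shift_equiv_right[OF O0 Ob' O0 L'(1) HC1_shift_equiv_left[OF O0 Ob Ob' Lm(3) ES]] .
    finally show ?thesis using HC1_assoc[OF O0 Ob Ob' Ob' P F ES] by simp
  qed
  have zero: "zero_mor (wt 0) (wt_add (wt b') (- 1)) (FF_ext ?s (wt b') \<star> E_seq A N \<nu>)"
    if "n \<le> m" "n # \<nu> \<in> P a b" for n \<nu>
  proof -
    have \<nu>: "\<nu> \<in> P a b'" and n: "\<forall>x \<in> set \<nu>. x \<le> n" using that(2) b(1) by (simp_all add: P_Cons_iff)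
    show ?thesis
    proof (rule FF_ext_E_seq_zero[OF \<nu>])
      show "a + b' \<le> N" using Cons.prems(2) b(1) by simp
      fix x assume x: "x \<in> set \<nu>"
      then show "- (int N - int b') \<le> ?s - x \<and> ?s - x \<le> - 1"
        using bspec[OF n x] P_nonneg[OF \<nu> x] that(1) mk by simp
    qed
  qed
  have eq: "eqv (wt 0) (wt 0) (?L \<star> (EE A (- m) (wt b') \<star> E_seq A N \<nu>)) (L' \<star> E_seq A N \<nu>)"
    if \<nu>: "m # \<nu> \<in> P a b" for \<nu>
  proof -
    have \<nu>': "\<nu> \<in> P a b'" using \<nu> b(1) by (simp add: P_Cons_iff)
    have r: "- m \<in> E_range (wt b')" using b Cons.prems(2) by (intro E_range_wt) auto
    have "eqv (wt 0) (wt b') (FF_ext ?s (wt b) \<star> (EE A (- m) (wt b') \<star> E_seq A N \<nu>))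
        (\<Psi> 1 (wt b') \<star> E_seq A N \<nu>)"
      using FF_ext_cross(1)[OF k l a0 r S[OF \<nu>'] zero[OF order_refl \<nu>]] kl by simp
    from HC1_shift_equiv_right[OF O0 Ob' Ob' P this]
    have "eqv (wt 0) (wt b')
        (\<Psi> (- 1) (wt b') \<star> (FF_ext ?s (wt b) \<star> (EE A (- m) (wt b') \<star> E_seq A N \<nu>)))
        (\<Psi> (- 1) (wt b') \<star> (\<Psi> 1 (wt b') \<star> E_seq A N \<nu>))" .
    also have "eqv (wt 0) (wt b') \<dots> (E_seq A N \<nu>)"
      using shift_equiv_iso[OF \<Psi>_cancel[OF a0 ka S[OF \<nu>']]] by simp
    finally have "eqv (wt 0) (wt 0)
        (L' \<star> (\<Psi> (- 1) (wt b') \<star> (FF_ext ?s (wt b) \<star> (EE A (- m) (wt b') \<star> E_seq A N \<nu>))))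
        (L' \<star> E_seq A N \<nu>)"
      by (rule HC1_shift_equiv_right[OF O0 Ob' O0 L'(1)])
    with red[OF b(3,4) \<nu>'] show ?thesis by (rule shift_equiv_trans)
  qed
  have Eseq: "E_seq A N (n # \<nu>) = EE A (- n) (wt b') \<star> E_seq A N \<nu>" if "n # \<nu> \<in> P a b" for n \<nu>
    using P_length[OF that] b(1) by simp
  show ?case
  proof (intro bexI[OF _ L] conjI ballI impI)
    show "adjunction (wt b) (wt 0) ?L (E_seq A N (m # \<mu>))"
      using adjunction_HC1[OF Ob Ob' O0 Lm(1) E[OF b(3,4)] L'(1) S[OF b(2)] Lm(2) L'(2)]
        Eseq[OF Cons.prems(1)] by simp
    show "eqv (wt 0) (wt 0) (?L \<star> E_seq A N (m # \<mu>)) (One A (wt 0))"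
      using shift_equiv_trans[OF eq[OF Cons.prems(1)] L'(3)] Eseq[OF Cons.prems(1)] by simp
  next
    fix \<kappa> assume \<kappa>: "\<kappa> \<in> P a b" "\<kappa> < m # \<mu>"
    then obtain n \<nu> where n\<nu>: "\<kappa> = n # \<nu>" using P_length[of \<kappa>] b(1) by (cases \<kappa>) auto
    note n = \<kappa>(1)[unfolded n\<nu>]
    have \<nu>: "\<nu> \<in> P a b'" and n0: "0 \<le> n" "n \<le> int a" using n b(1) by (simp_all add: P_Cons_iff)
    consider "n < m" | "n = m" "\<nu> < \<mu>" using \<kappa>(2) n\<nu> by auto
    then have "zero_mor (wt 0) (wt 0) (?L \<star> (EE A (- n) (wt b') \<star> E_seq A N \<nu>))"
    proof cases
      case 1
      have r: "- n \<in> E_range (wt b')" using b(1) n0 Cons.prems(2) by (intro E_range_wt) auto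
      have "zero_mor (wt 0) (wt b') (FF_ext ?s (wt b) \<star> (EE A (- n) (wt b') \<star> E_seq A N \<nu>))"
        using FF_ext_cross(2)[OF k l a0 r S[OF \<nu>] zero[OF less_imp_le[OF 1] n]] 1 mk n0 kl by simp
      from HC1_zero_object(2)[OF O0 Ob' O0 L'(1) HC1_zero_object(2)[OF O0 Ob' Ob' P this]]
      show ?thesis using eqv_zero_object[OF O0 O0 red[OF n0 \<nu>]] by blast
    next
      case 2
      show ?thesis
        using eqv_zero_object[OF O0 O0 eq[of \<nu>]] L'(4)[OF \<nu> 2(2)] n 2(1) by simp
    qed
    then show "zero_mor (wt 0) (wt 0) (?L \<star> E_seq A N \<kappa>)" using Eseq[OF n] n\<nu> by simp
  qed
qed

lemma E_seq_right_adjoint: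
  assumes "\<mu> \<in> P a b" "a + b \<le> N"
  shows "\<exists>R \<in> mor (wt b) (wt 0). adjunction (wt 0) (wt b) (E_seq A N \<mu>) R"
  using assms
proof (induction \<mu> arbitrary: b)
  case Nil
  have b: "b = 0" using P_length[OF Nil.prems(1)] by simp
  have "adjunction (wt 0) (wt 0) (One A (wt 0)) (One A (wt 0))"
    using inverse_pair_adjunction(1)[OF _ inverse_pair_One] wt_Obj[of 0] by simp
  then show ?case using b One_Mor[OF wt_Obj[of 0]] by auto
next
  case (Cons m \<mu>)
  obtain b' where b: "b = Suc b'" "\<mu> \<in> P a b'" "0 \<le> m" "m \<le> int a"
    using Cons.prems(1) unfolding P_Cons_iff by blast
  have bN: "0 \<le> N" "b' \<le> N" "b \<le> N" using Cons.prems(2) b(1) by auto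
  note O0 = wt_Obj[OF bN(1)] and Ob' = wt_Obj[OF bN(2)] and Ob = wt_Obj[OF bN(3)]
  note k = wt_weights[OF bN(2)]
  have kl: "wt_add (wt b') 1 = wt b" using wt_Suc b(1) by simp
  have r: "- m \<in> E_range (wt b')" using b Cons.prems(2) by (intro E_range_wt) auto
  obtain R' where R': "R' \<in> mor (wt b') (wt 0)" "adjunction (wt 0) (wt b') (E_seq A N \<mu>) R'"
    using Cons.IH[OF b(2)] Cons.prems(2) b(1) by auto
  obtain R where R: "is_right_adjoint A (wt b') (wt b) (EE A (- m) (wt b')) R"
    using EE_right_adjoint[OF k r] kl unfolding right_adjoint_iso_def by metis
  have ob: "EE A (- m) (wt b') \<in> mor (wt b') (wt b)" "R \<in> mor (wt b) (wt b')"
    using R by (auto simp: is_right_adjoint_def)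
  have S: "E_seq A N \<mu> \<in> mor (wt 0) (wt b')" using E_seq_Mor[OF b(2)] Cons.prems(2) b(1) by simp
  have "adjunction (wt 0) (wt b) (EE A (- m) (wt b') \<star> E_seq A N \<mu>) (R' \<star> R)"
    using adjunction_HC1[OF O0 Ob' Ob S R'(1) ob R'(2) is_right_adjoint_adjunction[OF Ob' Ob R]] .
  then show ?case using HC1_Mor[OF Ob Ob' O0 R'(1) ob(2)] P_length[OF b(2)] by auto
qed

end

section \<open>The semiorthogonal decomposition\<close>

lemma P_decreasing_set: "set (P_decreasing a b) = P a b"
  by (simp add: P_decreasing_def finite_P)

lemma P_decreasing_less:
  assumes "i < length (P_decreasing a b)" "j < i"
  shows "P_decreasing a b ! i < P_decreasing a b ! j"
proof -
  let ?xs = "sorted_list_of_set (P a b)"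
  have "sorted_wrt (<) ?xs" by simp
  then show ?thesis
    using assms sorted_wrt_nth_less[of "(<)" ?xs "length ?xs - Suc i" "length ?xs - Suc j"]
    by (simp add: P_decreasing_def rev_nth)
qed

theorem corollary4p9:
  fixes N k :: nat and A :: "('f, 't, 'o, 'a) action_data"
  assumes "N \<ge> 2" and "k \<le> N" and "partial_categorical_action N A"
  shows "(\<forall>\<mu> \<in> P k (N - k).
            fully_faithful (Cat A (int N, 0)) (Cat A (int k, int N - int k))
              (ActO A (E_seq A N \<mu>)) (ActA A (E_seq A N \<mu>))) \<and>
         semiorthogonal_decomposition (Cat A (int k, int N - int k))
           (BB A N k # map (Im_E A N k) (P_decreasing k (N - k)))"
proof -
  interpret partial_categorical_action N A by fact
  define b where "b = N - k"
  have wtb: "wt b = (int k, int N - int k)" and wt0: "wt 0 = (int N, 0)" and kb: "k + b \<le> N"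
    using assms(2) by (simp_all add: b_def)
  have O0: "wt 0 \<in> Obj A" and Ob: "wt b \<in> Obj A" using wt_Obj[of 0] wt_Obj[of b] kb by auto
  let ?S = "Cat A (wt 0)" and ?T = "Cat A (wt b)"
  interpret S: triangulated_category ?S using Cat_triangulated[OF O0] .
  interpret T: triangulated_category ?T using Cat_triangulated[OF Ob] .
  let ?ess = "\<lambda>\<mu>. essential_image ?S ?T (ActO A (E_seq A N \<mu>))"
  have Im: "Im_E A N k \<mu> = thick_span ?T (?ess \<mu>)" for \<mu> by (simp add: Im_E_def wtb wt0)
  have ess: "?ess \<mu> \<subseteq> Ob ?T" for \<mu> by (auto simp: essential_image_def)
  note E = E_seq_Mor[OF _ kb]
  note ex = Act_exact[OF O0 Ob E]
  have ff: "fully_faithful ?S ?T (ActO A (E_seq A N \<mu>)) (ActA A (E_seq A N \<mu>))"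
    if \<mu>: "\<mu> \<in> P k b" for \<mu>
  proof -
    obtain L where L: "L \<in> mor (wt b) (wt 0)" "adjunction (wt b) (wt 0) L (E_seq A N \<mu>)"
        "eqv (wt 0) (wt 0) (L \<star>\<^bsub>A\<^esub> E_seq A N \<mu>) (One A (wt 0))"
      using E_seq_left_adjoint[OF \<mu> kb] by blast
    show ?thesis using adjunction_fully_faithful[OF O0 Ob E[OF \<mu>] L] .
  qed
  have orth: "Hom ?T X Y = {Zer ?T X Y}"
    if \<mu>: "\<mu> \<in> P k b" "\<nu> \<in> P k b" "\<nu> < \<mu>" and X: "X \<in> Im_E A N k \<nu>" and Y: "Y \<in> Im_E A N k \<mu>" for \<mu> \<nu> X Y
  proof (rule T.thick_span_orthogonal[OF ess _ _ ess _ X[unfolded Im] Y[unfolded Im]])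
    fix X assume "X \<in> ?ess \<nu>"
    then show "ShO ?T X \<in> ?ess \<nu>" "unshift ?T X \<in> ?ess \<nu>"
      using essential_image_shift_closed[OF S.triangulated_category_axioms T.triangulated_category_axioms
          ex[OF \<mu>(2)]] by blast+
  next
    fix X Y assume "X \<in> ?ess \<nu>" "Y \<in> ?ess \<mu>"
    then obtain X' Y' where X': "X' \<in> Ob ?S" "isomorphic ?T (ActO A (E_seq A N \<nu>) X') X"
        and Y': "Y' \<in> Ob ?S" "isomorphic ?T (ActO A (E_seq A N \<mu>) Y') Y"
      by (auto simp: essential_image_def)
    obtain L where L: "L \<in> mor (wt b) (wt 0)" "adjunction (wt b) (wt 0) L (E_seq A N \<mu>)"
        "zero_mor (wt 0) (wt 0) (L \<star>\<^bsub>A\<^esub> E_seq A N \<nu>)"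
      using E_seq_left_adjoint[OF \<mu>(1) kb] \<mu>(2,3) by blast
    have "Hom ?T (ActO A (E_seq A N \<nu>) X') (ActO A (E_seq A N \<mu>) Y') =
        {Zer ?T (ActO A (E_seq A N \<nu>) X') (ActO A (E_seq A N \<mu>) Y')}"
      using adjunction_orthogonal[OF O0 Ob E[OF \<mu>(1)] L(1) E[OF \<mu>(2)] L(2,3) X'(1) Y'(1)] .
    from T.orthogonal_isomorphic_right[OF T.orthogonal_isomorphic_left[OF this X'(2)] Y'(2)]
    show "Hom ?T X Y = {Zer ?T X Y}" .
  qed
  have adm: "T.right_admissible (Im_E A N k \<mu>)" if \<mu>: "\<mu> \<in> P k b" for \<mu>
  proof -
    obtain R where R: "R \<in> mor (wt b) (wt 0)" "adjunction (wt 0) (wt b) (E_seq A N \<mu>) R"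
      using E_seq_right_adjoint[OF \<mu> kb] by blast
    show ?thesis
      unfolding Im using right_admissible_image[OF S.triangulated_category_axioms
          T.triangulated_category_axioms ex[OF \<mu>] ff[OF \<mu>] Act_functor[OF Ob O0 R(1)] R(2)] .
  qed
  let ?As = "map (Im_E A N k) (P_decreasing k b)"
  have "semiorthogonal_decomposition ?T (right_orthogonal ?T (tri_span ?T (\<Union> (set ?As))) # ?As)"
  proof (rule T.semiorthogonal_decompositionI)
    fix B assume "B \<in> set ?As"
    then obtain \<mu> where "\<mu> \<in> P k b" "B = Im_E A N k \<mu>" by (auto simp: P_decreasing_set)
    then show "full_triangulated_subcategory ?T B \<and> T.right_admissible B"
      using adm T.thick_span(1)[OF ess] Im by simp
  next
    show "\<forall>i<length ?As. \<forall>j<i. \<forall>X\<in>?As ! i. \<forall>Y\<in>?As ! j. Hom ?T X Y = {Zer ?T X Y}"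
    proof (intro allI impI ballI)
      fix i j X Y assume i: "i < length ?As" "j < i" and XY: "X \<in> ?As ! i" "Y \<in> ?As ! j"
      let ?\<mu> = "\<lambda>i. P_decreasing k b ! i"
      have "?\<mu> i \<in> P k b" "?\<mu> j \<in> P k b" using i nth_mem P_decreasing_set by fastforce+
      moreover have "?\<mu> i < ?\<mu> j" using P_decreasing_less i by simp
      ultimately show "Hom ?T X Y = {Zer ?T X Y}" using orth XY i by simp
    qed
  qed
  moreover have "BB A N k = right_orthogonal ?T (tri_span ?T (\<Union> (set ?As)))"
    unfolding BB_def set_map P_decreasing_set b_def[symmetric] wtb[symmetric] ..
  ultimately show ?thesis
    unfolding b_def[symmetric] wtb[symmetric] wt0[symmetric] using ff by simp
qed

end
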